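(* Let $k$ be a field and let $V$ be an affine variety in affine $n$-space over $k$, with defining ideal $I\subseteq k[X]=k[x_1,\dots,x_n]$. (a) If $V$ is equidimensional, then so is its part at infinity. (b) If $V$ is equidimensional at the origin, then so is its tangent cone (at the origin).
   Context: For a nonzero $f\in k[X]$ let $f_{\max}$ and $f_{\min}$ denote its (standard) homogeneous components of highest, respectively lowest, degree. The part at infinity of $V$ is described by the homogeneous ideal $I_{\max}\subseteq k[X]$ generated by all $f_{\max}$, $0\ne f\in I$ (the leading ideal of $I$ for the degree order $x^a<x^b\Leftrightarrow\deg x^a<\deg x^b$); its equidimensionality means that $k[X]/I_{\max}$ is equidimensional. The tangent cone of $V$ at the origin is described by the homogeneous ideal $I_{\min}\subseteq k[X]$ generated by all $f_{\min}$, $0\neq f\in I$ (the leading ideal of $I$ for the reverse degree order $x^a<x^b\Leftrightarrow\deg x^a>\deg x^b$); its equidimensionality means that $k[X]/I_{\min}$ is equidimensional. $V$ is equidimensional if $k[X]/I$ is equidimensional, and equidimensional at the origin if the local ring $k[X]_{(X)}/Ik[X]_{(X)}$ is equidimensional, where $(X)=(x_1,\dots,x_n)$. A quotient ring $A/\mathfrak{a}$ is equidimensional if $\dim A/Q=\dim A/\mathfrak{a}$ for every minimal prime $Q$ of $\mathfrak{a}$. *)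

theory Defs
  imports
    "HOL-Algebra.QuotRing"
    "HOL-Library.Poly_Mapping"
    "HOL-Library.Extended_Real"
    "HOL-Computational_Algebra.Fraction_Field"
begin

section \<open>Polynomial rings and their localizations\<close>

text \<open>
  The product on \<open>(nat \<Rightarrow>\<^sub>0 nat) \<Rightarrow>\<^sub>0 'k\<close> is the convolution product, so this type is the polynomial
  ring over \<open>'k\<close> in countably many variables indexed by \<open>nat\<close>. The ring \<open>k[x\<^sub>1, \<dots>, x\<^sub>n]\<close> is its
  subring of polynomials in the variables with index below \<open>n\<close> (so \<open>n = 0\<close> is allowed).
\<close>
type_synonym 'k mpoly = "(nat \<Rightarrow>\<^sub>0 nat) \<Rightarrow>\<^sub>0 'k"

definition ring_on :: "'a::comm_ring_1 set \<Rightarrow> 'a ring" where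
  "ring_on S = \<lparr>carrier = S, mult = (*), one = 1, zero = 0, add = (+)\<rparr>"

definition poly_ring :: "nat \<Rightarrow> 'k::field mpoly ring" where
  "poly_ring n = ring_on {p. \<forall>m \<in> Poly_Mapping.keys p. Poly_Mapping.keys m \<subseteq> {..<n}}"

definition origin_ideal :: "nat \<Rightarrow> 'k::field mpoly set" where
  "origin_ideal n =
     genideal (poly_ring n) ((\<lambda>i. Poly_Mapping.single (Poly_Mapping.single i 1) 1) ` {..<n})"

text \<open>
  As \<open>k[X]\<close> is a domain, its localization at the prime \<open>(X)\<close> is a subring of the field of fractions.
  The field of fractions of the ambient type contains that of \<open>k[X]\<close>.
\<close>
definition origin_local_ring :: "nat \<Rightarrow> 'k::field mpoly fract ring" where
  "origin_local_ring n =
     ring_on {Fract p q | p q. p \<in> carrier (poly_ring n) \<and> q \<in> carrier (poly_ring n) - origin_ideal n}"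

definition origin_extension :: "nat \<Rightarrow> 'k::field mpoly set \<Rightarrow> 'k mpoly fract set" where
  "origin_extension n I = genideal (origin_local_ring n) ((\<lambda>p. Fract p 1) ` I)"


section \<open>Dimension and equidimensionality\<close>

text \<open>
  The supremum of the lengths \<open>l\<close> of chains \<open>C 0 \<subset> \<dots> \<subset> C l\<close> of prime ideals. The values are
  extended reals so that the zero ring, which has no prime ideals, has dimension \<open>-\<infinity>\<close> rather than \<open>0\<close>.
\<close>
definition krull_dim :: "('a, 'b) ring_scheme \<Rightarrow> ereal" where
  "krull_dim R = Sup {ereal (real l) | l.
     \<exists>C. (\<forall>i\<le>l. primeideal (C i) R) \<and> (\<forall>i<l. C i \<subset> C (Suc i))}"

definition minimal_prime :: "('a, 'b) ring_scheme \<Rightarrow> 'a set \<Rightarrow> 'a set \<Rightarrow> bool" where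
  "minimal_prime A J Q \<longleftrightarrow> primeideal Q A \<and> J \<subseteq> Q \<and>
     (\<forall>P. primeideal P A \<longrightarrow> J \<subseteq> P \<longrightarrow> P \<subseteq> Q \<longrightarrow> P = Q)"

text \<open>Equidimensionality of the quotient ring \<open>A/J\<close>.\<close>
definition equidimensional_quot :: "('a, 'b) ring_scheme \<Rightarrow> 'a set \<Rightarrow> bool" where
  "equidimensional_quot A J \<longleftrightarrow>
     (\<forall>Q. minimal_prime A J Q \<longrightarrow> krull_dim (A Quot Q) = krull_dim (A Quot J))"


section \<open>Part at infinity and tangent cone\<close>

definition mon_degree :: "(nat \<Rightarrow>\<^sub>0 nat) \<Rightarrow> nat" where
  "mon_degree m = (\<Sum>i \<in> Poly_Mapping.keys m. Poly_Mapping.lookup m i)"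

definition hom_component :: "nat \<Rightarrow> 'k::field mpoly \<Rightarrow> 'k mpoly" where
  "hom_component d p =
     (\<Sum>m \<in> {m \<in> Poly_Mapping.keys p. mon_degree m = d}.
        Poly_Mapping.single m (Poly_Mapping.lookup p m))"

text \<open>The values of the next two functions at the zero polynomial are irrelevant.\<close>
definition max_form :: "'k::field mpoly \<Rightarrow> 'k mpoly" where
  "max_form p = hom_component (Max (mon_degree ` Poly_Mapping.keys p)) p"

definition min_form :: "'k::field mpoly \<Rightarrow> 'k mpoly" where
  "min_form p = hom_component (Min (mon_degree ` Poly_Mapping.keys p)) p"

definition max_ideal :: "nat \<Rightarrow> 'k::field mpoly set \<Rightarrow> 'k mpoly set" where
  "max_ideal n I = genideal (poly_ring n) {max_form f | f. f \<in> I \<and> f \<noteq> 0}"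

definition min_ideal :: "nat \<Rightarrow> 'k::field mpoly set \<Rightarrow> 'k mpoly set" where
  "min_ideal n I = genideal (poly_ring n) {min_form f | f. f \<in> I \<and> f \<noteq> 0}"


section \<open>Affine varieties\<close>

text \<open>
  An affine variety \<open>V\<close> in affine \<open>n\<close>-space over \<open>k\<close> enters only through its defining ideal
  \<open>I \<subseteq> k[X]\<close>. No base field extension is singled out and \<open>I\<close> is not required to be radical, so
  \<open>I\<close> may be the vanishing ideal of any algebraic set.
\<close>
definition equidimensional_variety :: "nat \<Rightarrow> 'k::field mpoly set \<Rightarrow> bool" where
  "equidimensional_variety n I \<longleftrightarrow> equidimensional_quot (poly_ring n) I"

definition equidimensional_at_origin :: "nat \<Rightarrow> 'k::field mpoly set \<Rightarrow> bool" where
  "equidimensional_at_origin n I \<longleftrightarrow>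
     equidimensional_quot (origin_local_ring n) (origin_extension n I)"

definition equidimensional_part_at_infinity :: "nat \<Rightarrow> 'k::field mpoly set \<Rightarrow> bool" where
  "equidimensional_part_at_infinity n I \<longleftrightarrow> equidimensional_quot (poly_ring n) (max_ideal n I)"

definition equidimensional_tangent_cone :: "nat \<Rightarrow> 'k::field mpoly set \<Rightarrow> bool" where
  "equidimensional_tangent_cone n I \<longleftrightarrow> equidimensional_quot (poly_ring n) (min_ideal n I)"

end

theory Submission
  imports "HOL-Algebra.Algebraic_Closure_Type" Defs
begin

text \<open>
  Both parts deform \<open>V\<close> to the leading forms of its ideal: adding a variable \<open>t\<close> and weights, a
  minimal prime \<open>P\<close> of \<open>I\<close> gives a weighted homogeneous prime \<open>P'\<close> of \<open>k[X, t]\<close> of transcendence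
  degree one higher, and setting \<open>t = 0\<close> turns \<open>P'\<close> into the leading forms of \<open>P\<close>. A minimal prime \<open>Q\<close>
  of the leading ideal contains the leading forms of such a \<open>P\<close>, hence is minimal over \<open>P' + (t)\<close>,
  and the principal ideal theorem gives it the transcendence degree of \<open>P\<close>. For lowest degrees, \<open>P\<close>
  lies in \<open>(X)\<close>, since a leading form in \<open>Q\<close> cannot be a nonzero constant.

  A prime \<open>P\<close> of \<open>k[x\<^sub>1, \<dots>, x\<^sub>n]\<close> is handled through a generic point: a tuple over the algebraic
  closure of \<open>k(y\<^sub>0, y\<^sub>1, \<dots>)\<close> at which exactly the elements of \<open>P\<close> vanish. By Noether normalization
  it can be chosen so that its coordinates generate a finite module over \<open>k[y\<^sub>0, \<dots>, y\<^bsub>d-1\<^esub>]\<close>. The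
  principal ideal theorem then follows with norms, and it also identifies the Krull dimension of
  \<open>k[X]/P\<close>, and of its localization at the origin if \<open>P \<subseteq> (X)\<close>, with the transcendence degree.
\<close>

section \<open>Subrings, ideals and ring homomorphisms of commutative ring types\<close>

text \<open>Only one of the two comparisons between a minimal prime \<open>Q\<close> of the leading
  ideal and the prime \<open>P\<close> it comes from is deep. A nonzero polynomial in given
  variables has a nonzero leading form in the same variables, so \<open>Q\<close> has at most the
  transcendence degree of \<open>P\<close>. The reverse inequality, that no component of the special
  fibre is too small, is what the principal ideal theorem is for. There the ideal
  \<open>P + (t)\<close> may have several minimal primes of, so far, unrelated dimensions; a
  localization isolates \<open>Q\<close>, and a norm then yields one prime that is large enough.
  Integrality over a polynomial ring is always expressed by containment in a finitely generated
  module, and transcendence degrees are compared by counting dimensions of filtered vector spaces.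
  The base field is arbitrary, possibly finite or imperfect: normalization uses powers of a variable
  instead of linear substitutions, and conjugates are counted with multiplicity. The affine and the
  local case differ only in a set \<open>M\<close>, the polynomial ring or the ideal of the origin,
  in which the primes under consideration are contained.\<close>

definition rhom :: "('a::comm_ring_1 \<Rightarrow> 'b::comm_ring_1) \<Rightarrow> bool" where
  "rhom f \<longleftrightarrow> f 1 = 1 \<and> (\<forall>a b. f (a + b) = f a + f b) \<and> (\<forall>a b. f (a * b) = f a * f b)"

lemma rhom_1: "rhom f \<Longrightarrow> f 1 = 1"
  and rhom_add: "rhom f \<Longrightarrow> f (a + b) = f a + f b"
  and rhom_mult: "rhom f \<Longrightarrow> f (a * b) = f a * f b"
  by (auto simp: rhom_def)

lemma rhom_0: "rhom f \<Longrightarrow> f 0 = 0"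
  using rhom_add[of f 0 0] by simp

lemma rhom_minus: "rhom f \<Longrightarrow> f (- a) = - f a"
  using rhom_add[of f a "- a"] by (simp add: rhom_0 add_eq_0_iff)

lemma rhom_diff: "rhom f \<Longrightarrow> f (a - b) = f a - f b"
  using rhom_add[of f a "- b"] by (simp add: rhom_minus)

lemma rhom_power: "rhom f \<Longrightarrow> f (a ^ n) = f a ^ n"
  by (induction n) (simp_all add: rhom_1 rhom_mult)

lemma rhom_sum: "rhom f \<Longrightarrow> f (\<Sum>x\<in>A. g x) = (\<Sum>x\<in>A. f (g x))"
  by (induction A rule: infinite_finite_induct) (simp_all add: rhom_0 rhom_add)

lemma rhom_prod: "rhom f \<Longrightarrow> f (\<Prod>x\<in>A. g x) = (\<Prod>x\<in>A. f (g x))"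
  by (induction A rule: infinite_finite_induct) (simp_all add: rhom_1 rhom_mult)

lemmas rhom_simps = rhom_0 rhom_1 rhom_add rhom_mult rhom_minus rhom_diff rhom_power rhom_sum
  rhom_prod

lemma rhom_comp: "rhom f \<Longrightarrow> rhom g \<Longrightarrow> rhom (\<lambda>x. f (g x))"
  by (simp add: rhom_def)

lemma rhom_inj_iff: "rhom f \<Longrightarrow> (\<And>a. f a = 0 \<Longrightarrow> a = 0) \<Longrightarrow> f a = f b \<longleftrightarrow> a = b"
  by (metis eq_iff_diff_eq_0 rhom_diff)

lemma rhom_map_poly:
  assumes "rhom f"
  shows "rhom (map_poly f)"
proof -
  have 0: "f 0 = 0" using assms by (rule rhom_0)
  show ?thesis
    unfolding rhom_def
    by (auto simp: poly_eq_iff coeff_map_poly 0 coeff_mult rhom_simps[OF assms] map_poly_1')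
qed

lemma rhom_poly_map_poly:
  assumes "rhom f"
  shows "poly (map_poly f p) (f a) = f (poly p a)"
proof -
  have 0: "f 0 = 0" using assms by (rule rhom_0)
  show ?thesis
    by (induction p) (simp_all add: map_poly_pCons 0 rhom_simps[OF assms])
qed

text \<open>Subrings, and below ideals and primes, are plain sets inside a ring type, so that type
  class arithmetic applies directly; \<open>ideal_ring_on_iff\<close> and
  \<open>primeideal_ring_on_iff\<close> translate to the records of the statement.\<close>

definition subr :: "'a::comm_ring_1 set \<Rightarrow> bool" where
  "subr A \<longleftrightarrow> 1 \<in> A \<and> (\<forall>x\<in>A. - x \<in> A) \<and> (\<forall>x\<in>A. \<forall>y\<in>A. x + y \<in> A) \<and> (\<forall>x\<in>A. \<forall>y\<in>A. x * y \<in> A)"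

lemma subr_1: "subr A \<Longrightarrow> 1 \<in> A"
  and subr_minus: "subr A \<Longrightarrow> x \<in> A \<Longrightarrow> - x \<in> A"
  and subr_add: "subr A \<Longrightarrow> x \<in> A \<Longrightarrow> y \<in> A \<Longrightarrow> x + y \<in> A"
  and subr_mult: "subr A \<Longrightarrow> x \<in> A \<Longrightarrow> y \<in> A \<Longrightarrow> x * y \<in> A"
  by (auto simp: subr_def)

lemma subr_0: "subr A \<Longrightarrow> 0 \<in> A"
  using subr_add[of A 1 "- 1"] subr_1 subr_minus by force

lemma subr_diff: "subr A \<Longrightarrow> x \<in> A \<Longrightarrow> y \<in> A \<Longrightarrow> x - y \<in> A"
  using subr_add[of A x "- y"] subr_minus[of A y] by simp

lemma subr_power: "subr A \<Longrightarrow> x \<in> A \<Longrightarrow> x ^ n \<in> A"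
  by (induction n) (auto intro: subr_1 subr_mult)

lemma subr_sum: "subr A \<Longrightarrow> (\<And>i. i \<in> J \<Longrightarrow> f i \<in> A) \<Longrightarrow> (\<Sum>i\<in>J. f i) \<in> A"
  by (induction J rule: infinite_finite_induct) (auto intro: subr_0 subr_add)

lemma subr_prod: "subr A \<Longrightarrow> (\<And>i. i \<in> J \<Longrightarrow> f i \<in> A) \<Longrightarrow> (\<Prod>i\<in>J. f i) \<in> A"
  by (induction J rule: infinite_finite_induct) (auto intro: subr_1 subr_mult)

lemmas subr_intros = subr_0 subr_1 subr_minus subr_add subr_mult subr_diff subr_power subr_sum
  subr_prod

lemma subr_image:
  assumes "rhom f" "subr A"
  shows "subr (f ` A)"
  unfolding subr_def
proof (intro conjI ballI)
  show "1 \<in> f ` A"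
    using rhom_1[OF assms(1)] subr_1[OF assms(2)] by (metis imageI)
  show "- x \<in> f ` A" if "x \<in> f ` A" for x
    using that subr_minus[OF assms(2)] by (auto simp flip: rhom_minus[OF assms(1)])
  show "x + y \<in> f ` A" if "x \<in> f ` A" "y \<in> f ` A" for x y
    using that subr_add[OF assms(2)] by (auto simp flip: rhom_add[OF assms(1)])
  show "x * y \<in> f ` A" if "x \<in> f ` A" "y \<in> f ` A" for x y
    using that subr_mult[OF assms(2)] by (auto simp flip: rhom_mult[OF assms(1)])
qed

definition coeffs_in :: "'a::comm_ring_1 set \<Rightarrow> 'a poly set" where
  "coeffs_in A = {p. \<forall>i. coeff p i \<in> A}"

lemma subr_coeffs_in:
  assumes "subr A"
  shows "subr (coeffs_in A)"
  unfolding subr_def coeffs_in_def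
  by (auto simp: coeff_mult intro!: subr_intros[OF assms] intro: subr_0[OF assms] subr_1[OF assms])

lemma const_in_coeffs_in: "subr A \<Longrightarrow> a \<in> A \<Longrightarrow> [:a:] \<in> coeffs_in A"
  by (auto simp: coeffs_in_def coeff_pCons subr_0 split: nat.splits)

lemma monom_in_coeffs_in: "subr A \<Longrightarrow> a \<in> A \<Longrightarrow> Polynomial.monom a n \<in> coeffs_in A"
  by (auto simp: coeffs_in_def subr_0)

lemma poly_in_subr:
  assumes "subr A" "p \<in> coeffs_in A" "a \<in> A"
  shows "poly p a \<in> A"
  unfolding poly_altdef using assms by (auto simp: coeffs_in_def intro!: subr_intros)

section \<open>Ideals and prime ideals of a subring\<close>

definition idl :: "'a::comm_ring_1 set \<Rightarrow> 'a set \<Rightarrow> bool" where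
  "idl A J \<longleftrightarrow> J \<subseteq> A \<and> 0 \<in> J \<and> (\<forall>x\<in>J. \<forall>y\<in>J. x + y \<in> J) \<and> (\<forall>a\<in>A. \<forall>x\<in>J. a * x \<in> J)"

definition prm :: "'a::comm_ring_1 set \<Rightarrow> 'a set \<Rightarrow> bool" where
  "prm A P \<longleftrightarrow> idl A P \<and> 1 \<notin> P \<and> (\<forall>a\<in>A. \<forall>b\<in>A. a * b \<in> P \<longrightarrow> a \<in> P \<or> b \<in> P)"

text \<open>\<open>J\<close> is any set: the minimal primes over the bare set of leading forms are
  those over the ideal it generates, which \<open>equidim_genideal\<close> exploits.\<close>

definition min_prm :: "'a::comm_ring_1 set \<Rightarrow> 'a set \<Rightarrow> 'a set \<Rightarrow> bool" where
  "min_prm A J Q \<longleftrightarrow> prm A Q \<and> J \<subseteq> Q \<and> (\<forall>P. prm A P \<longrightarrow> J \<subseteq> P \<longrightarrow> P \<subseteq> Q \<longrightarrow> P = Q)"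

lemma idl_sub: "idl A J \<Longrightarrow> x \<in> J \<Longrightarrow> x \<in> A"
  and idl_0: "idl A J \<Longrightarrow> 0 \<in> J"
  and idl_add: "idl A J \<Longrightarrow> x \<in> J \<Longrightarrow> y \<in> J \<Longrightarrow> x + y \<in> J"
  and idl_mult: "idl A J \<Longrightarrow> a \<in> A \<Longrightarrow> x \<in> J \<Longrightarrow> a * x \<in> J"
  by (auto simp: idl_def)

lemma idl_mult2: "idl A J \<Longrightarrow> a \<in> A \<Longrightarrow> x \<in> J \<Longrightarrow> x * a \<in> J"
  using idl_mult[of A J a x] by (simp add: mult.commute)

lemma idl_minus: "subr A \<Longrightarrow> idl A J \<Longrightarrow> x \<in> J \<Longrightarrow> - x \<in> J"
  using idl_mult[of A J "- 1" x] by (simp add: subr_1 subr_minus)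

lemma idl_diff: "subr A \<Longrightarrow> idl A J \<Longrightarrow> x \<in> J \<Longrightarrow> y \<in> J \<Longrightarrow> x - y \<in> J"
  using idl_add[of A J x "- y"] idl_minus[of A J y] by simp

lemma idl_sum: "idl A J \<Longrightarrow> (\<And>i. i \<in> K \<Longrightarrow> f i \<in> J) \<Longrightarrow> (\<Sum>i\<in>K. f i) \<in> J"
  by (induction K rule: infinite_finite_induct) (auto intro: idl_0 idl_add)

lemma prm_idl: "prm A P \<Longrightarrow> idl A P"
  and prm_1: "prm A P \<Longrightarrow> 1 \<notin> P"
  and prm_prime: "prm A P \<Longrightarrow> a \<in> A \<Longrightarrow> b \<in> A \<Longrightarrow> a * b \<in> P \<Longrightarrow> a \<in> P \<or> b \<in> P"
  by (auto simp: prm_def)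

lemma prm_power: "prm A P \<Longrightarrow> subr A \<Longrightarrow> a \<in> A \<Longrightarrow> a ^ n \<in> P \<Longrightarrow> a \<in> P"
  by (induction n) (use prm_1 prm_prime subr_power in \<open>fastforce+\<close>)

lemma prm_prod:
  assumes "prm A P" "subr A" "finite J" "\<And>i. i \<in> J \<Longrightarrow> f i \<in> A - P"
  shows "(\<Prod>i\<in>J. f i) \<in> A - P"
  using assms(3,4)
proof (induction J)
  case empty
  then show ?case using assms by (simp add: prm_1 subr_1)
next
  case (insert x F)
  then show ?case using prm_prime[OF assms(1)] subr_mult[OF assms(2)] by (simp, blast)
qed

lemma prm_vimage:
  assumes "rhom f" "subr A" "prm B P" "\<And>x. x \<in> A \<Longrightarrow> f x \<in> B"
  shows "prm A {x\<in>A. f x \<in> P}"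
proof -
  have "idl A {x\<in>A. f x \<in> P}"
    unfolding idl_def using assms
    by (auto simp: rhom_simps subr_intros intro: idl_0 idl_add idl_mult dest: prm_idl)
  then show ?thesis
    using assms prm_1[OF assms(3)] prm_prime[OF assms(3)]
    unfolding prm_def by (auto simp: rhom_simps)
qed

lemma prm_inter:
  assumes "subr A" "A \<subseteq> B" "prm B P"
  shows "prm A (P \<inter> A)"
  using prm_vimage[of "\<lambda>x. x" A B P] assms by (auto simp: rhom_def Int_def conj_commute)

definition idl_insert :: "'a::comm_ring_1 set \<Rightarrow> 'a set \<Rightarrow> 'a \<Rightarrow> 'a set" where
  "idl_insert A J t = {j + a * t | j a. j \<in> J \<and> a \<in> A}"

lemma idl_insert_idl:
  assumes "subr A" "idl A J" "t \<in> A"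
  shows "idl A (idl_insert A J t)"
  unfolding idl_def
proof (intro conjI ballI)
  show "idl_insert A J t \<subseteq> A"
    using assms by (auto simp: idl_insert_def intro!: subr_intros dest: idl_sub)
  show "0 \<in> idl_insert A J t"
    unfolding idl_insert_def using idl_0[OF assms(2)] subr_0[OF assms(1)] by force
  show "x + y \<in> idl_insert A J t" if "x \<in> idl_insert A J t" "y \<in> idl_insert A J t" for x y
  proof -
    from that obtain j a j' a' where "x = j + a * t" "y = j' + a' * t" "j \<in> J" "j' \<in> J" "a \<in> A" "a' \<in> A"
      by (auto simp: idl_insert_def)
    then have "x + y = (j + j') + (a + a') * t" "j + j' \<in> J" "a + a' \<in> A"
      using assms by (auto simp: algebra_simps idl_add subr_add)
    then show ?thesis unfolding idl_insert_def by blast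
  qed
  show "b * x \<in> idl_insert A J t" if "b \<in> A" "x \<in> idl_insert A J t" for b x
  proof -
    from that obtain j a where "x = j + a * t" "j \<in> J" "a \<in> A"
      by (auto simp: idl_insert_def)
    then have "b * x = b * j + (b * a) * t" "b * j \<in> J" "b * a \<in> A"
      using assms that by (auto simp: algebra_simps idl_mult subr_mult)
    then show ?thesis unfolding idl_insert_def by blast
  qed
qed

lemma idl_insert_supset: "subr A \<Longrightarrow> J \<subseteq> idl_insert A J t"
  unfolding idl_insert_def using subr_0 by force

lemma idl_insert_mem: "subr A \<Longrightarrow> idl A J \<Longrightarrow> t \<in> idl_insert A J t"
  unfolding idl_insert_def using subr_1 idl_0 by force

lemma idl_insert_least: "idl A K \<Longrightarrow> J \<subseteq> K \<Longrightarrow> t \<in> K \<Longrightarrow> idl_insert A J t \<subseteq> K"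
  unfolding idl_insert_def by (auto intro!: idl_add idl_mult)

lemma idl_Union_chain:
  assumes "C \<noteq> {}" "\<And>J. J \<in> C \<Longrightarrow> idl A J" "\<And>J K. J \<in> C \<Longrightarrow> K \<in> C \<Longrightarrow> J \<subseteq> K \<or> K \<subseteq> J"
  shows "idl A (\<Union>C)"
  unfolding idl_def
proof (intro conjI ballI)
  show "\<Union>C \<subseteq> A" using assms(2) idl_sub by blast
  show "0 \<in> \<Union>C" using assms(1,2) idl_0 by blast
  show "x + y \<in> \<Union>C" if xy: "x \<in> \<Union>C" "y \<in> \<Union>C" for x y
  proof -
    from xy obtain J K where "J \<in> C" "x \<in> J" "K \<in> C" "y \<in> K" by auto
    moreover from this have "J \<subseteq> K \<or> K \<subseteq> J" using assms(3) by blast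
    ultimately have "\<exists>M\<in>C. x \<in> M \<and> y \<in> M" by blast
    then show ?thesis using assms(2) idl_add by blast
  qed
  show "a * x \<in> \<Union>C" if "a \<in> A" "x \<in> \<Union>C" for a x
    using that assms(2) idl_mult by blast
qed

text \<open>An ideal maximal among those containing \<open>J\<close> and missing the multiplicative
  set \<open>D\<close> is prime: if \<open>x\<close> and \<open>y\<close> lie outside it, some
  \<open>j + a * x\<close> and \<open>k + b * y\<close> lie in \<open>D\<close>, and so does their
  product, which rules out \<open>x * y\<close> in the ideal.\<close>

lemma exists_prm_avoiding:
  assumes A: "subr A" and J: "idl A J" and D: "D \<subseteq> A" "1 \<in> D" "\<And>a b. a \<in> D \<Longrightarrow> b \<in> D \<Longrightarrow> a * b \<in> D"
    and disj: "J \<inter> D = {}"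
  obtains P where "prm A P" "J \<subseteq> P" "P \<inter> D = {}"
proof -
  let ?S = "{K. idl A K \<and> J \<subseteq> K \<and> K \<inter> D = {}}"
  have "\<exists>M\<in>(?S). \<forall>M0\<in>(?S). M \<subseteq> M0 \<longrightarrow> M0 = M"
  proof (rule subset_Zorn_nonempty)
    show "?S \<noteq> {}" using J disj by blast
  next
    fix C assume C: "C \<noteq> {}" "subset.chain ?S C"
    have "idl A (\<Union>C)"
      by (rule idl_Union_chain) (use C in \<open>auto simp: subset_chain_def\<close>)
    then show "\<Union>C \<in> ?S"
      using C by (auto simp: subset_chain_def)
  qed
  then obtain M where M: "idl A M" "J \<subseteq> M" "M \<inter> D = {}"
    and max: "\<And>M0. idl A M0 \<Longrightarrow> J \<subseteq> M0 \<Longrightarrow> M0 \<inter> D = {} \<Longrightarrow> M \<subseteq> M0 \<Longrightarrow> M0 = M" by auto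
  have meet: "\<exists>j a. j \<in> M \<and> a \<in> A \<and> j + a * x \<in> D" if "x \<in> A" "x \<notin> M" for x
  proof (rule ccontr)
    assume "\<not> ?thesis"
    then have "idl_insert A M x \<inter> D = {}" by (auto simp: idl_insert_def)
    then have "idl_insert A M x = M"
      using max[OF idl_insert_idl[OF A M(1) that(1)]] idl_insert_supset[OF A, of M x] M(2) by blast
    then show False using idl_insert_mem[OF A M(1), of x] that by simp
  qed
  have "prm A M"
    unfolding prm_def
  proof (intro conjI ballI impI)
    show "1 \<notin> M" using M D by auto
    fix x y assume xy: "x \<in> A" "y \<in> A" "x * y \<in> M"
    show "x \<in> M \<or> y \<in> M"
    proof (rule ccontr)
      assume "\<not> ?thesis"
      then obtain j a k b where *: "j \<in> M" "a \<in> A" "j + a * x \<in> D" "k \<in> M" "b \<in> A" "k + b * y \<in> D"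
        using meet xy by metis
      have "(j + a * x) * (k + b * y) = (k + b * y) * j + ((a * x) * k + (a * b) * (x * y))"
        by (simp add: algebra_simps)
      also have "\<dots> \<in> M"
      proof -
        have "k + b * y \<in> A" "a * x \<in> A" "a * b \<in> A"
          using * xy D by (auto intro: subr_mult[OF A])
        then show ?thesis
          using * xy by (auto intro!: idl_add[OF M(1)] intro: idl_mult[OF M(1)])
      qed
      finally show False using * D M by blast
    qed
  qed (fact M)
  then show ?thesis using that M by blast
qed

text \<open>The intersection of a chain of primes is prime; passing to complements turns these
  intersections into the unions of Zorn's lemma.\<close>

lemma exists_min_prm_below:
  assumes P: "prm A P" "J \<subseteq> P"
  obtains Q where "min_prm A J Q" "Q \<subseteq> P"
proof -
  let ?S = "uminus ` {Q. prm A Q \<and> J \<subseteq> Q \<and> Q \<subseteq> P}"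
  have "\<exists>M\<in>(?S). \<forall>M0\<in>(?S). M \<subseteq> M0 \<longrightarrow> M0 = M"
  proof (rule subset_Zorn_nonempty)
    show "?S \<noteq> {}" using P by blast
  next
    fix C assume C: "C \<noteq> {}" "subset.chain ?S C"
    have el: "prm A (- M0) \<and> J \<subseteq> - M0 \<and> - M0 \<subseteq> P" if "M0 \<in> C" for M0
      using that C by (auto simp: subset_chain_def)
    have ch: "M0 \<subseteq> M1 \<or> M1 \<subseteq> M0" if "M0 \<in> C" "M1 \<in> C" for M0 M1
      using that C(2) by (simp add: subset_chain_def)
    have "prm A (- \<Union>C)"
      unfolding prm_def idl_def
    proof (intro conjI ballI impI)
      show "- \<Union>C \<subseteq> A" using C(1) el prm_idl idl_sub by blast
      show "0 \<in> - \<Union>C" using el prm_idl idl_0 by blast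
      show "x + y \<in> - \<Union>C" if "x \<in> - \<Union>C" "y \<in> - \<Union>C" for x y
        using that el prm_idl idl_add by blast
      show "a * x \<in> - \<Union>C" if "a \<in> A" "x \<in> - \<Union>C" for a x
        using that el prm_idl idl_mult by blast
      show "1 \<notin> - \<Union>C" using C(1) el prm_1 by blast
      fix a b assume ab: "a \<in> A" "b \<in> A" "a * b \<in> - \<Union>C"
      show "a \<in> - \<Union>C \<or> b \<in> - \<Union>C"
      proof (rule ccontr)
        assume "\<not> ?thesis"
        then obtain M0 M1 where "M0 \<in> C" "a \<in> M0" "M1 \<in> C" "b \<in> M1" by auto
        then obtain M2 where "M2 \<in> C" "a \<in> M2" "b \<in> M2" using ch[of M0 M1] by blast
        then show False using el[of M2] prm_prime[of A "- M2" a b] ab by auto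
      qed
    qed
    moreover have "J \<subseteq> - \<Union>C" "- \<Union>C \<subseteq> P" using el C(1) by blast+
    ultimately show "\<Union>C \<in> ?S" by (intro image_eqI[of _ _ "- \<Union>C"]) auto
  qed
  then obtain Q where Q: "prm A Q" "J \<subseteq> Q" "Q \<subseteq> P"
    and max: "\<And>M0. prm A M0 \<Longrightarrow> J \<subseteq> M0 \<Longrightarrow> M0 \<subseteq> P \<Longrightarrow> - Q \<subseteq> - M0 \<Longrightarrow> - M0 = - Q" by auto
  have "min_prm A J Q"
    unfolding min_prm_def using Q max by (metis Compl_anti_mono Compl_eq_Compl_iff order_trans)
  then show ?thesis using that Q by blast
qed

text \<open>In the localization at a minimal prime of \<open>J\<close> the element \<open>z\<close>
  is nilpotent modulo \<open>J\<close>. If the multiplicative set of all \<open>g * z ^ m\<close>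
  missed \<open>J\<close>, a prime avoiding it would lie in \<open>Q\<close> (take
  \<open>m = 0\<close>), hence equal \<open>Q\<close>, although it does not contain
  \<open>z\<close>.\<close>

lemma min_prm_power_mult:
  assumes A: "subr A" and J: "idl A J" and Q: "min_prm A J Q" and z: "z \<in> Q"
  obtains g m where "g \<in> A" "g \<notin> Q" "g * z ^ m \<in> J"
proof -
  have pQ: "prm A Q" using Q by (simp add: min_prm_def)
  have zA: "z \<in> A" using z idl_sub[OF prm_idl[OF pQ]] by blast
  let ?D = "{g * z ^ m | g m. g \<in> A \<and> g \<notin> Q}"
  have "J \<inter> ?D \<noteq> {}"
  proof
    assume disj: "J \<inter> ?D = {}"
    obtain P where P: "prm A P" "J \<subseteq> P" "P \<inter> ?D = {}"
    proof (rule exists_prm_avoiding[OF A J _ _ _ disj])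
      show "?D \<subseteq> A" using zA by (auto intro!: subr_intros[OF A])
      show "1 \<in> ?D"
        using prm_1[OF pQ] subr_1[OF A] by (intro CollectI exI[of _ 1] exI[of _ 0]) auto
      fix a b assume "a \<in> ?D" "b \<in> ?D"
      then obtain g m g' m' where *: "a = g * z ^ m" "b = g' * z ^ m'" "g \<in> A" "g \<notin> Q" "g' \<in> A" "g' \<notin> Q"
        by blast
      then have "a * b = (g * g') * z ^ (m + m')" "g * g' \<in> A" "g * g' \<notin> Q"
        using prm_prime[OF pQ] by (auto simp: algebra_simps power_add subr_mult[OF A])
      then show "a * b \<in> ?D" by blast
    qed
    have "P \<subseteq> Q"
    proof
      fix x assume "x \<in> P"
      then have "x \<in> A" using P(1) prm_idl idl_sub by blast
      moreover have "x = x * z ^ 0" by simp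
      ultimately show "x \<in> Q" using \<open>x \<in> P\<close> P(3) by blast
    qed
    then have "P = Q" using Q P by (auto simp: min_prm_def)
    moreover have "1 * z ^ 1 \<in> ?D" using prm_1[OF pQ] subr_1[OF A] by blast
    ultimately show False using z P(3) by auto
  qed
  then show ?thesis using that by blast
qed


section \<open>Evaluation of multivariate polynomials\<close>

abbreviation pconst :: "'k::field \<Rightarrow> 'k mpoly" where
  "pconst c \<equiv> Poly_Mapping.single 0 c"

definition pvar :: "nat \<Rightarrow> 'k::field mpoly" where
  "pvar i = Poly_Mapping.single (Poly_Mapping.single i 1) 1"

definition polys :: "nat set \<Rightarrow> 'k::field mpoly set" where
  "polys U = {p. \<forall>m \<in> Poly_Mapping.keys p. Poly_Mapping.keys m \<subseteq> U}"

definition monom_val :: "(nat \<Rightarrow> 'b::comm_ring_1) \<Rightarrow> (nat \<Rightarrow>\<^sub>0 nat) \<Rightarrow> 'b" where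
  "monom_val v m = (\<Prod>i\<in>Poly_Mapping.keys m. v i ^ Poly_Mapping.lookup m i)"

definition ev :: "('k::field \<Rightarrow> 'b::comm_ring_1) \<Rightarrow> (nat \<Rightarrow> 'b) \<Rightarrow> 'k mpoly \<Rightarrow> 'b" where
  "ev \<kappa> v p = (\<Sum>m\<in>Poly_Mapping.keys p. \<kappa> (Poly_Mapping.lookup p m) * monom_val v m)"

lemma monom_val_superset:
  assumes "finite A" "Poly_Mapping.keys m \<subseteq> A"
  shows "monom_val v m = (\<Prod>i\<in>A. v i ^ Poly_Mapping.lookup m i)"
  unfolding monom_val_def
  by (rule prod.mono_neutral_left) (use assms in \<open>auto simp: in_keys_iff\<close>)

lemma monom_val_0 [simp]: "monom_val v 0 = 1"
  by (simp add: monom_val_def)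

lemma monom_val_single [simp]: "monom_val v (Poly_Mapping.single i k) = v i ^ k"
  by (simp add: monom_val_superset[of "{i}"])

lemma keys_add_nat: "Poly_Mapping.keys (m + m' :: nat \<Rightarrow>\<^sub>0 nat) = Poly_Mapping.keys m \<union> Poly_Mapping.keys m'"
  by (auto simp: in_keys_iff lookup_add)

lemma monom_val_add: "monom_val v (m + m') = monom_val v m * monom_val v m'"
proof -
  let ?A = "Poly_Mapping.keys m \<union> Poly_Mapping.keys m'"
  have "monom_val v (m + m') = (\<Prod>i\<in>?A. v i ^ (Poly_Mapping.lookup m i + Poly_Mapping.lookup m' i))"
    by (subst monom_val_superset[of ?A]) (auto simp: keys_add_nat lookup_add)
  also have "\<dots> = monom_val v m * monom_val v m'"
    by (simp add: power_add prod.distrib monom_val_superset[of ?A])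
  finally show ?thesis .
qed

lemma mpoly_sum_single:
  "p = (\<Sum>m\<in>Poly_Mapping.keys p. Poly_Mapping.single m (Poly_Mapping.lookup p m))"
  by (rule poly_mapping_eqI)
    (auto simp: lookup_sum lookup_single when_def in_keys_iff)

lemma ev_superset:
  assumes "finite A" "Poly_Mapping.keys p \<subseteq> A" "\<kappa> 0 = 0"
  shows "ev \<kappa> v p = (\<Sum>m\<in>A. \<kappa> (Poly_Mapping.lookup p m) * monom_val v m)"
  unfolding ev_def
  by (rule sum.mono_neutral_left) (use assms in \<open>auto simp: in_keys_iff\<close>)

lemma ev_single: "\<kappa> 0 = 0 \<Longrightarrow> ev \<kappa> v (Poly_Mapping.single m c) = \<kappa> c * monom_val v m"
  by (subst ev_superset[of "{m}"]) auto

context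
  fixes \<kappa> :: "'k::field \<Rightarrow> 'b::comm_ring_1"
  assumes \<kappa>: "rhom \<kappa>"
begin

lemma ev_add: "ev \<kappa> v (p + q) = ev \<kappa> v p + ev \<kappa> v q"
proof -
  let ?A = "Poly_Mapping.keys p \<union> Poly_Mapping.keys q"
  have "Poly_Mapping.keys (p + q) \<subseteq> ?A" by (rule keys_add)
  then show ?thesis
    by (simp add: ev_superset[of ?A] rhom_simps[OF \<kappa>] lookup_add distrib_right sum.distrib)
qed

lemma ev_0: "ev \<kappa> v 0 = 0"
  by (simp add: ev_def)

lemma ev_sum: "ev \<kappa> v (\<Sum>x\<in>A. g x) = (\<Sum>x\<in>A. ev \<kappa> v (g x))"
  by (induction A rule: infinite_finite_induct) (simp_all add: ev_0 ev_add)

lemma rhom_ev: "rhom (ev \<kappa> v)"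
  unfolding rhom_def
proof (intro conjI allI)
  show "ev \<kappa> v 1 = 1"
    unfolding single_one[symmetric] by (simp add: ev_single rhom_simps[OF \<kappa>] del: single_one)
  show "ev \<kappa> v (p + q) = ev \<kappa> v p + ev \<kappa> v q" for p q by (rule ev_add)
  show "ev \<kappa> v (p * q) = ev \<kappa> v p * ev \<kappa> v q" for p q
  proof -
    have "p * q = (\<Sum>m\<in>Poly_Mapping.keys p. Poly_Mapping.single m (Poly_Mapping.lookup p m)) *
        (\<Sum>m\<in>Poly_Mapping.keys q. Poly_Mapping.single m (Poly_Mapping.lookup q m))"
      by (simp flip: mpoly_sum_single)
    then have "ev \<kappa> v (p * q) = (\<Sum>m\<in>Poly_Mapping.keys p. \<Sum>m'\<in>Poly_Mapping.keys q.
        \<kappa> (Poly_Mapping.lookup p m) * \<kappa> (Poly_Mapping.lookup q m') * (monom_val v m * monom_val v m'))"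
      by (simp only: sum_product mult_single ev_sum ev_single rhom_simps[OF \<kappa>] monom_val_add)
    also have "\<dots> = ev \<kappa> v p * ev \<kappa> v q"
      by (simp add: ev_def sum_product mult_ac)
    finally show ?thesis .
  qed
qed

lemma ev_pconst [simp]: "ev \<kappa> v (pconst c) = \<kappa> c"
  by (simp add: ev_single rhom_simps[OF \<kappa>])

lemma ev_pvar [simp]: "ev \<kappa> v (pvar i) = v i"
  by (simp add: pvar_def ev_single rhom_simps[OF \<kappa>])

lemma ev_cong: "p \<in> polys U \<Longrightarrow> (\<And>i. i \<in> U \<Longrightarrow> v i = w i) \<Longrightarrow> ev \<kappa> v p = ev \<kappa> w p"
  unfolding ev_def monom_val_def polys_def
  by (intro sum.cong prod.cong arg_cong2[where f = "(*)"] arg_cong2[where f = "(^)"] refl) blast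

lemma ev_in_subr:
  assumes "subr S" "\<And>c. \<kappa> c \<in> S" "p \<in> polys U" "\<And>i. i \<in> U \<Longrightarrow> v i \<in> S"
  shows "ev \<kappa> v p \<in> S"
  unfolding ev_def monom_val_def using assms(3,4)
  by (auto simp: polys_def intro!: subr_intros[OF assms(1)] assms(2))

lemma rhom_of_ev: "rhom f \<Longrightarrow> f (ev \<kappa> v p) = ev (\<lambda>c. f (\<kappa> c)) (\<lambda>i. f (v i)) p"
  by (simp add: ev_def monom_val_def rhom_simps)

lemma ev_poly: "ev \<kappa> v (poly P a) = poly (map_poly (ev \<kappa> v) P) (ev \<kappa> v a)"
  by (simp add: rhom_poly_map_poly[OF rhom_ev])

end

lemma rhom_pconst: "rhom pconst"
  by (simp add: rhom_def single_add mult_single)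

lemma ev_pconst_pvar: "ev pconst pvar p = p"
proof -
  have "monom_val pvar m = Poly_Mapping.single m (1::'a)" for m
  proof -
    have pow: "pvar i ^ k = Poly_Mapping.single (Poly_Mapping.single i k) (1::'a)" for i k
      by (induction k) (simp_all add: pvar_def mult_single flip: single_add)
    have "(\<Prod>i\<in>A. pvar i ^ Poly_Mapping.lookup m i) =
        Poly_Mapping.single (\<Sum>i\<in>A. Poly_Mapping.single i (Poly_Mapping.lookup m i)) (1::'a)" for A
      by (induction A rule: infinite_finite_induct) (simp_all add: pow mult_single)
    then show ?thesis
      unfolding monom_val_def using mpoly_sum_single[of m] by simp
  qed
  then show ?thesis
    unfolding ev_def using mpoly_sum_single[of p] by (simp add: mult_single)
qed

lemma ev_ev:
  assumes "rhom \<kappa>"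
  shows "ev \<kappa> v (ev pconst w p) = ev \<kappa> (\<lambda>i. ev \<kappa> v (w i)) p"
  by (subst rhom_of_ev[OF rhom_pconst rhom_ev[OF assms]]) (simp add: assms)

lemma subr_polys: "subr (polys U)"
  unfolding subr_def
proof (intro conjI ballI)
  show "1 \<in> polys U" by (simp add: polys_def)
  show "- x \<in> polys U" if "x \<in> polys U" for x :: "'a mpoly"
    using that by (simp add: polys_def in_keys_iff)
  show "x + y \<in> polys U" if "x \<in> polys U" "y \<in> polys U" for x y :: "'a mpoly"
    using that keys_add[of x y] unfolding polys_def by blast
  show "x * y \<in> polys U" if "x \<in> polys U" "y \<in> polys U" for x y :: "'a mpoly"
    using that keys_mult[of x y] unfolding polys_def
    by (auto simp: keys_add_nat dest!: subsetD)
qed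

lemma pconst_in_polys: "pconst c \<in> polys U"
  by (simp add: polys_def)

lemma pvar_in_polys: "i \<in> U \<Longrightarrow> pvar i \<in> polys U"
  by (simp add: polys_def pvar_def)

lemma polys_mono: "U \<subseteq> V \<Longrightarrow> polys U \<subseteq> polys V"
  unfolding polys_def by blast

lemmas polys_intros = subr_intros[OF subr_polys] pconst_in_polys pvar_in_polys

lemma polys_empty: "p \<in> polys {} \<Longrightarrow> p = pconst (Poly_Mapping.lookup p 0)"
  by (rule poly_mapping_eqI) (auto simp: polys_def lookup_single when_def in_keys_iff)

lemma pvar_nonzero [simp]: "pvar i \<noteq> 0"
  by (metis keys_eq_empty keys_single insert_not_empty pvar_def zero_neq_one)

lemma prm_pconst:
  assumes "prm (polys U) P" "pconst c \<in> P"
  shows "c = 0"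
proof (rule ccontr)
  assume "c \<noteq> 0"
  then have "pconst (inverse c) * pconst c = (1 :: 'a mpoly)" by (simp add: mult_single)
  then have "1 \<in> P" using idl_mult[OF prm_idl[OF assms(1)] pconst_in_polys assms(2)] by metis
  then show False using prm_1[OF assms(1)] by blast
qed

lemma prm_inter_constants:
  assumes "prm (polys U) P" "p \<in> polys {}" "p \<in> P"
  shows "p = 0"
  using polys_empty[OF assms(2)] prm_pconst[OF assms(1)] assms(3) by (metis single_zero)

lemma ev_polys: "p \<in> polys U \<Longrightarrow> (\<And>i. i \<in> U \<Longrightarrow> w i \<in> polys V) \<Longrightarrow> ev pconst w p \<in> polys V"
  by (rule ev_in_subr[OF rhom_pconst subr_polys]) (auto intro: pconst_in_polys)

lemma polys_subset_subr:
  assumes "subr S" "\<And>c. pconst c \<in> S" "\<And>i. i \<in> U \<Longrightarrow> pvar i \<in> S"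
  shows "polys U \<subseteq> S"
proof
  fix p :: "'a mpoly" assume "p \<in> polys U"
  then have "ev pconst pvar p \<in> S"
    by (rule ev_in_subr[OF rhom_pconst assms(1) assms(2)]) (use assms in auto)
  then show "p \<in> S" by (simp add: ev_pconst_pvar)
qed

text \<open>The values \<open>poly P (pvar i)\<close> form a subring that contains the constants and
  all variables involved.\<close>

lemma polys_insert_poly:
  assumes "p \<in> polys (insert i U)"
  obtains P where "P \<in> coeffs_in (polys U)" "p = poly P (pvar i)"
proof -
  let ?S = "(\<lambda>P. poly P (pvar i)) ` coeffs_in (polys U)"
  have "polys (insert i U) \<subseteq> ?S"
  proof (rule polys_subset_subr)
    show "subr ?S"
      by (rule subr_image[OF _ subr_coeffs_in[OF subr_polys]]) (simp add: rhom_def)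
    show "pconst c \<in> ?S" for c
      by (rule image_eqI[of _ _ "[:pconst c:]"])
        (auto intro: const_in_coeffs_in subr_polys pconst_in_polys)
    show "pvar j \<in> ?S" if "j \<in> insert i U" for j
    proof (cases "j = i")
      case True
      then show ?thesis
        by (intro image_eqI[of _ _ "Polynomial.monom 1 1"])
          (auto intro: monom_in_coeffs_in subr_polys polys_intros simp: poly_monom)
    next
      case False
      then show ?thesis using that
        by (intro image_eqI[of _ _ "[:pvar j:]"])
          (auto intro: const_in_coeffs_in subr_polys pvar_in_polys)
    qed
  qed
  then show ?thesis using assms that by blast
qed

lemma finite_keys_polys: "\<exists>n. (p::'k::field mpoly) \<in> polys {..<n}"
proof -
  have "finite (\<Union>m\<in>Poly_Mapping.keys p. Poly_Mapping.keys m)" by simp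
  then obtain n where "(\<Union>m\<in>Poly_Mapping.keys p. Poly_Mapping.keys m) \<subseteq> {..<n}"
    using finite_nat_iff_bounded by blast
  then show ?thesis unfolding polys_def by blast
qed


section \<open>Weights\<close>

text \<open>The weight takes values in any type, so that the same components serve for integer
  weights and for \<open>mon_degree\<close>.\<close>

definition wt_comp :: "((nat \<Rightarrow>\<^sub>0 nat) \<Rightarrow> 'c) \<Rightarrow> 'c \<Rightarrow> 'k::field mpoly \<Rightarrow> 'k mpoly" where
  "wt_comp \<omega> d p =
     (\<Sum>m \<in> {m \<in> Poly_Mapping.keys p. \<omega> m = d}. Poly_Mapping.single m (Poly_Mapping.lookup p m))"

lemma lookup_wt_comp:
  "Poly_Mapping.lookup (wt_comp \<omega> d p) m = (if \<omega> m = d then Poly_Mapping.lookup p m else 0)"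
proof -
  have "Poly_Mapping.lookup (wt_comp \<omega> d p) m =
      (\<Sum>m' \<in> {m' \<in> Poly_Mapping.keys p. \<omega> m' = d}. if m' = m then Poly_Mapping.lookup p m' else 0)"
    unfolding wt_comp_def by (simp add: lookup_sum lookup_single when_def)
  then show ?thesis by (simp add: in_keys_iff)
qed

lemma wt_comp_add: "wt_comp \<omega> d (p + q) = wt_comp \<omega> d p + wt_comp \<omega> d q"
  by (rule poly_mapping_eqI) (simp add: lookup_wt_comp lookup_add)

lemma wt_comp_0 [simp]: "wt_comp \<omega> d 0 = 0"
  by (simp add: wt_comp_def)

lemma wt_comp_sum: "wt_comp \<omega> d (\<Sum>x\<in>A. g x) = (\<Sum>x\<in>A. wt_comp \<omega> d (g x))"
  by (induction A rule: infinite_finite_induct) (simp_all add: wt_comp_add)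

lemma keys_wt_comp: "Poly_Mapping.keys (wt_comp \<omega> d p) = {m \<in> Poly_Mapping.keys p. \<omega> m = d}"
  by (auto simp: in_keys_iff lookup_wt_comp split: if_splits)

lemma wt_comp_in_polys: "p \<in> polys U \<Longrightarrow> wt_comp \<omega> d p \<in> polys U"
  by (auto simp: polys_def keys_wt_comp)

lemma wt_comp_homogeneous:
  assumes "\<And>m. m \<in> Poly_Mapping.keys p \<Longrightarrow> \<omega> m = d"
  shows "wt_comp \<omega> d p = p"
  using assms by (intro poly_mapping_eqI) (auto simp: lookup_wt_comp in_keys_iff)

lemma wt_comp_eq_0:
  assumes "\<And>m. m \<in> Poly_Mapping.keys p \<Longrightarrow> \<omega> m \<noteq> d"
  shows "wt_comp \<omega> d p = 0"
  using assms by (intro poly_mapping_eqI) (auto simp: lookup_wt_comp in_keys_iff)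

lemma sum_wt_comp:
  assumes "finite W" "\<omega> ` Poly_Mapping.keys p \<subseteq> W"
  shows "(\<Sum>d\<in>W. wt_comp \<omega> d p) = p"
proof (rule poly_mapping_eqI)
  fix m
  have "Poly_Mapping.lookup (\<Sum>d\<in>W. wt_comp \<omega> d p) m =
      (\<Sum>d\<in>W. if d = \<omega> m then Poly_Mapping.lookup p m else 0)"
    by (auto simp: lookup_sum lookup_wt_comp intro!: sum.cong)
  also have "\<dots> = Poly_Mapping.lookup p m"
    using assms by (auto simp: in_keys_iff image_subset_iff)
  finally show "Poly_Mapping.lookup (\<Sum>d\<in>W. wt_comp \<omega> d p) m = Poly_Mapping.lookup p m" .
qed

text \<open>Integer values admit the negated degree, under which lowest-degree forms become leading
  forms.\<close>

definition additive_wt :: "((nat \<Rightarrow>\<^sub>0 nat) \<Rightarrow> int) \<Rightarrow> bool" where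
  "additive_wt \<omega> \<longleftrightarrow> (\<forall>a b. \<omega> (a + b) = \<omega> a + \<omega> b)"

lemma additive_wt_add: "additive_wt \<omega> \<Longrightarrow> \<omega> (a + b) = \<omega> a + \<omega> b"
  by (simp add: additive_wt_def)

lemma additive_wt_0: "additive_wt \<omega> \<Longrightarrow> \<omega> 0 = 0"
  using additive_wt_add[of \<omega> 0 0] by simp

lemma wt_comp_mult_top:
  assumes \<omega>: "additive_wt \<omega>"
    and p: "\<And>m. m \<in> Poly_Mapping.keys p \<Longrightarrow> \<omega> m \<le> a"
    and q: "\<And>m. m \<in> Poly_Mapping.keys q \<Longrightarrow> \<omega> m \<le> b"
  shows "wt_comp \<omega> (a + b) (p * q) = wt_comp \<omega> a p * wt_comp \<omega> b q"
proof -
  define p1 where "p1 = p - wt_comp \<omega> a p"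
  define q1 where "q1 = q - wt_comp \<omega> b q"
  have p1: "\<omega> m < a" if "m \<in> Poly_Mapping.keys p1" for m
    using that p[of m] unfolding p1_def
    by (auto simp: in_keys_iff lookup_minus lookup_wt_comp split: if_splits)
  have q1: "\<omega> m < b" if "m \<in> Poly_Mapping.keys q1" for m
    using that q[of m] unfolding q1_def
    by (auto simp: in_keys_iff lookup_minus lookup_wt_comp split: if_splits)
  have "p * q = wt_comp \<omega> a p * wt_comp \<omega> b q + (wt_comp \<omega> a p * q1 + p1 * q)"
    by (simp add: p1_def q1_def algebra_simps)
  moreover have "wt_comp \<omega> (a + b) (wt_comp \<omega> a p * wt_comp \<omega> b q) = wt_comp \<omega> a p * wt_comp \<omega> b q"
    by (rule wt_comp_homogeneous)
      (use keys_mult in \<open>fastforce simp: keys_wt_comp additive_wt_add[OF \<omega>]\<close>)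
  moreover have "wt_comp \<omega> (a + b) (wt_comp \<omega> a p * q1) = 0"
  proof (rule wt_comp_eq_0)
    fix m assume "m \<in> Poly_Mapping.keys (wt_comp \<omega> a p * q1)"
    then obtain x y where "m = x + y" "x \<in> Poly_Mapping.keys (wt_comp \<omega> a p)" "y \<in> Poly_Mapping.keys q1"
      using keys_mult by blast
    then show "\<omega> m \<noteq> a + b"
      using q1[of y] by (auto simp: keys_wt_comp additive_wt_add[OF \<omega>])
  qed
  moreover have "wt_comp \<omega> (a + b) (p1 * q) = 0"
  proof (rule wt_comp_eq_0)
    fix m assume "m \<in> Poly_Mapping.keys (p1 * q)"
    then obtain x y where "m = x + y" "x \<in> Poly_Mapping.keys p1" "y \<in> Poly_Mapping.keys q"
      using keys_mult by blast
    then show "\<omega> m \<noteq> a + b"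
      using p1[of x] q[of y] by (auto simp: additive_wt_add[OF \<omega>])
  qed
  ultimately show ?thesis by (simp add: wt_comp_add)
qed

definition top_wt :: "((nat \<Rightarrow>\<^sub>0 nat) \<Rightarrow> int) \<Rightarrow> 'k::field mpoly \<Rightarrow> int" where
  "top_wt \<omega> p = Max (\<omega> ` Poly_Mapping.keys p)"

definition lead_form :: "((nat \<Rightarrow>\<^sub>0 nat) \<Rightarrow> int) \<Rightarrow> 'k::field mpoly \<Rightarrow> 'k mpoly" where
  "lead_form \<omega> p = wt_comp \<omega> (top_wt \<omega> p) p"

lemma top_wt_ge: "m \<in> Poly_Mapping.keys p \<Longrightarrow> \<omega> m \<le> top_wt \<omega> p"
  by (simp add: top_wt_def)

lemma top_wt_attained:
  assumes "p \<noteq> 0"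
  obtains m where "m \<in> Poly_Mapping.keys p" "\<omega> m = top_wt \<omega> p"
proof -
  have "top_wt \<omega> p \<in> \<omega> ` Poly_Mapping.keys p"
    unfolding top_wt_def using assms by (intro Max_in) auto
  then show ?thesis using that by auto
qed

lemma lead_form_nonzero: "p \<noteq> 0 \<Longrightarrow> lead_form \<omega> p \<noteq> 0"
  by (metis (mono_tags, lifting) keys_eq_empty empty_iff keys_wt_comp lead_form_def mem_Collect_eq
      top_wt_attained)

lemma top_wt_eqI:
  assumes "\<And>m. m \<in> Poly_Mapping.keys p \<Longrightarrow> \<omega> m \<le> a" "wt_comp \<omega> a p \<noteq> 0"
  shows "top_wt \<omega> p = a"
proof -
  obtain m where "m \<in> Poly_Mapping.keys (wt_comp \<omega> a p)"
    using assms(2) by (metis keys_eq_empty ex_in_conv)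
  then have m: "m \<in> Poly_Mapping.keys p" "\<omega> m = a" by (auto simp: keys_wt_comp)
  then show ?thesis
    unfolding top_wt_def using assms(1) by (intro Max_eqI) auto
qed

text \<open>The component of the product in the sum of the top weights is the product of the leading
  forms, and it is nonzero because polynomials form a domain.\<close>

lemma
  assumes \<omega>: "additive_wt \<omega>" and "p \<noteq> 0" "q \<noteq> 0"
  shows top_wt_mult: "top_wt \<omega> (p * q) = top_wt \<omega> p + top_wt \<omega> q"
    and lead_form_mult: "lead_form \<omega> (p * q) = lead_form \<omega> p * lead_form \<omega> q"
proof -
  have *: "wt_comp \<omega> (top_wt \<omega> p + top_wt \<omega> q) (p * q) = lead_form \<omega> p * lead_form \<omega> q"
    unfolding lead_form_def by (rule wt_comp_mult_top[OF \<omega>]) (auto intro: top_wt_ge)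
  show **: "top_wt \<omega> (p * q) = top_wt \<omega> p + top_wt \<omega> q"
  proof (rule top_wt_eqI)
    fix m assume "m \<in> Poly_Mapping.keys (p * q)"
    then obtain x y where "m = x + y" "x \<in> Poly_Mapping.keys p" "y \<in> Poly_Mapping.keys q"
      using keys_mult by blast
    then show "\<omega> m \<le> top_wt \<omega> p + top_wt \<omega> q"
      using top_wt_ge[of x p \<omega>] top_wt_ge[of y q \<omega>] by (simp add: additive_wt_add[OF \<omega>])
  next
    show "wt_comp \<omega> (top_wt \<omega> p + top_wt \<omega> q) (p * q) \<noteq> 0"
      unfolding * using assms(2,3) by (simp add: lead_form_nonzero)
  qed
  show "lead_form \<omega> (p * q) = lead_form \<omega> p * lead_form \<omega> q"
    unfolding lead_form_def[of \<omega> "p * q"] ** * ..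
qed

definition var_wt :: "nat \<Rightarrow> (nat \<Rightarrow>\<^sub>0 nat) \<Rightarrow> int" where
  "var_wt j m = int (Poly_Mapping.lookup m j)"

lemma additive_var_wt: "additive_wt (var_wt j)"
  by (simp add: additive_wt_def var_wt_def lookup_add)

lemma top_var_wt_nonneg: "p \<noteq> 0 \<Longrightarrow> 0 \<le> top_wt (var_wt j) p"
  by (metis of_nat_0_le_iff top_wt_attained var_wt_def)

lemma top_var_wt_power: "p \<noteq> 0 \<Longrightarrow> top_wt (var_wt j) (p ^ n) = int n * top_wt (var_wt j) p"
proof (induction n)
  case 0
  then show ?case by (simp add: top_wt_def var_wt_def)
next
  case (Suc n)
  then show ?case by (simp add: top_wt_mult[OF additive_var_wt] algebra_simps)
qed

text \<open>Turns membership in a polynomial subring into a numerical condition that is additive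
  under products.\<close>

lemma polys_iff_top_var_wt:
  assumes "p \<noteq> 0"
  shows "p \<in> polys U \<longleftrightarrow> (\<forall>j. j \<notin> U \<longrightarrow> top_wt (var_wt j) p = 0)"
proof
  assume p: "p \<in> polys U"
  show "\<forall>j. j \<notin> U \<longrightarrow> top_wt (var_wt j) p = 0"
  proof (intro allI impI)
    fix j assume "j \<notin> U"
    obtain m where "m \<in> Poly_Mapping.keys p" "var_wt j m = top_wt (var_wt j) p"
      using top_wt_attained[OF assms] .
    moreover from this have "Poly_Mapping.lookup m j = 0"
      using p \<open>j \<notin> U\<close> unfolding polys_def by (metis (mono_tags, lifting) mem_Collect_eq subset_iff not_in_keys_iff_lookup_eq_zero)
    ultimately show "top_wt (var_wt j) p = 0" by (simp add: var_wt_def)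
  qed
next
  assume *: "\<forall>j. j \<notin> U \<longrightarrow> top_wt (var_wt j) p = 0"
  show "p \<in> polys U"
    unfolding polys_def
  proof (intro CollectI ballI subsetI)
    fix m j assume "m \<in> Poly_Mapping.keys p" "j \<in> Poly_Mapping.keys m"
    then have "top_wt (var_wt j) p > 0"
      using top_wt_ge[of m p "var_wt j"] by (simp add: var_wt_def in_keys_iff)
    then show "j \<in> U" using * by force
  qed
qed


section \<open>Almost integral elements of the fraction field of a polynomial ring\<close>

text \<open>\<open>Max\<close> refers to the lexicographic order on exponents, in which the variable
  of smallest index is the most significant.\<close>

definition lead_mon :: "'k::field mpoly \<Rightarrow> (nat \<Rightarrow>\<^sub>0 nat)" where
  "lead_mon p = Max (Poly_Mapping.keys p)"

lemma lead_mon_in_keys: "p \<noteq> 0 \<Longrightarrow> lead_mon p \<in> Poly_Mapping.keys p"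
  by (simp add: lead_mon_def)

lemma le_lead_mon: "m \<in> Poly_Mapping.keys p \<Longrightarrow> m \<le> lead_mon p"
  by (simp add: lead_mon_def)

lemma lead_mon_eqI: "m \<in> Poly_Mapping.keys p \<Longrightarrow> (\<And>m'. m' \<in> Poly_Mapping.keys p \<Longrightarrow> m' \<le> m) \<Longrightarrow> lead_mon p = m"
  unfolding lead_mon_def by (rule Max_eqI) auto

lemma
  fixes p q :: "'k::field mpoly"
  assumes "p \<noteq> 0" "q \<noteq> 0"
  shows lead_mon_mult: "lead_mon (p * q) = lead_mon p + lead_mon q"
    and lookup_mult_lead_mon: "Poly_Mapping.lookup (p * q) (lead_mon p + lead_mon q) =
        Poly_Mapping.lookup p (lead_mon p) * Poly_Mapping.lookup q (lead_mon q)"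
proof -
  let ?a = "lead_mon p" and ?b = "lead_mon q"
  define p1 where "p1 = p - Poly_Mapping.single ?a (Poly_Mapping.lookup p ?a)"
  define q1 where "q1 = q - Poly_Mapping.single ?b (Poly_Mapping.lookup q ?b)"
  have p1: "m < ?a" if "m \<in> Poly_Mapping.keys p1" for m
  proof -
    have "m \<in> Poly_Mapping.keys p" "m \<noteq> ?a"
      using that by (auto simp: p1_def in_keys_iff lookup_minus lookup_single when_def split: if_splits)
    then show ?thesis using le_lead_mon[of m p] by simp
  qed
  have q1: "m < ?b" if "m \<in> Poly_Mapping.keys q1" for m
  proof -
    have "m \<in> Poly_Mapping.keys q" "m \<noteq> ?b"
      using that by (auto simp: q1_def in_keys_iff lookup_minus lookup_single when_def split: if_splits)
    then show ?thesis using le_lead_mon[of m q] by simp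
  qed
  have pq: "p * q = Poly_Mapping.single (?a + ?b) (Poly_Mapping.lookup p ?a * Poly_Mapping.lookup q ?b)
      + (Poly_Mapping.single ?a (Poly_Mapping.lookup p ?a) * q1 + p1 * q)"
    by (simp add: p1_def q1_def algebra_simps flip: mult_single)
  have n1: "?a + ?b \<notin> Poly_Mapping.keys (Poly_Mapping.single ?a (Poly_Mapping.lookup p ?a) * q1)"
  proof
    assume "?a + ?b \<in> Poly_Mapping.keys (Poly_Mapping.single ?a (Poly_Mapping.lookup p ?a) * q1)"
    then obtain x y where "?a + ?b = x + y"
        "x \<in> Poly_Mapping.keys (Poly_Mapping.single ?a (Poly_Mapping.lookup p ?a))"
        "y \<in> Poly_Mapping.keys q1"
      using keys_mult by blast
    then show False using q1[of y] by (auto split: if_splits)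
  qed
  have n2: "?a + ?b \<notin> Poly_Mapping.keys (p1 * q)"
  proof
    assume "?a + ?b \<in> Poly_Mapping.keys (p1 * q)"
    then obtain x y where *: "?a + ?b = x + y" "x \<in> Poly_Mapping.keys p1" "y \<in> Poly_Mapping.keys q"
      using keys_mult by blast
    then have "x + y < ?a + ?b" using p1[of x] le_lead_mon[of y q] by (intro add_less_le_mono)
    then show False using * by simp
  qed
  show *: "Poly_Mapping.lookup (p * q) (?a + ?b) = Poly_Mapping.lookup p ?a * Poly_Mapping.lookup q ?b"
    unfolding pq using n1 n2 by (simp add: lookup_add in_keys_iff)
  show "lead_mon (p * q) = ?a + ?b"
  proof (rule lead_mon_eqI)
    have "Poly_Mapping.lookup p ?a \<noteq> 0" "Poly_Mapping.lookup q ?b \<noteq> 0"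
      using assms lead_mon_in_keys by (auto simp: in_keys_iff)
    then show "?a + ?b \<in> Poly_Mapping.keys (p * q)"
      by (simp add: in_keys_iff *)
    fix m assume "m \<in> Poly_Mapping.keys (p * q)"
    then obtain x y where "m = x + y" "x \<in> Poly_Mapping.keys p" "y \<in> Poly_Mapping.keys q"
      using keys_mult by blast
    then show "m \<le> ?a + ?b" by (simp add: add_mono le_lead_mon)
  qed
qed

lemma lookup_lead_mon_power:
  "p \<noteq> 0 \<Longrightarrow> Poly_Mapping.lookup (lead_mon (p ^ n)) i = n * Poly_Mapping.lookup (lead_mon (p::'k::field mpoly)) i"
proof (induction n)
  case 0
  have "lead_mon (1 :: 'k mpoly) = 0" by (rule lead_mon_eqI) auto
  then show ?case by simp
next
  case (Suc n)
  then show ?case by (simp add: lead_mon_mult lookup_add)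
qed

text \<open>In infinitely many variables the lexicographic order is not well-founded: the variables
  themselves descend forever as their index grows. On monomials in \<open>n\<close> variables it is
  the order of lists of fixed length.\<close>

lemma wf_mon_order: "wf {(m :: nat \<Rightarrow>\<^sub>0 nat, m'). m < m' \<and> Poly_Mapping.keys m \<subseteq> {..<n} \<and> Poly_Mapping.keys m' \<subseteq> {..<n::nat}}"
  (is "wf ?R")
proof (rule wf_subset)
  let ?f = "\<lambda>m::nat \<Rightarrow>\<^sub>0 nat. map (Poly_Mapping.lookup m) [0..<n]"
  show "wf (inv_image (lexn less_than n) ?f)"
    by (intro wf_inv_image wf_lexn wf_less_than)
  show "?R \<subseteq> inv_image (lexn less_than n) ?f"
  proof clarify
    fix a b :: "nat \<Rightarrow>\<^sub>0 nat"
    assume "a < b" and keys: "Poly_Mapping.keys a \<subseteq> {..<n}" "Poly_Mapping.keys b \<subseteq> {..<n}"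
    then obtain k where k: "Poly_Mapping.lookup a k < Poly_Mapping.lookup b k"
        "\<And>k'. k' < k \<Longrightarrow> Poly_Mapping.lookup a k' = Poly_Mapping.lookup b k'"
      by (auto simp: less_poly_mapping.rep_eq less_fun_def)
    have "k < n"
      using k(1) keys by (metis gr_implies_not0 in_keys_iff lessThan_iff subset_iff)
    then have split: "[0..<n] = [0..<k] @ k # [Suc k..<n]"
      using upt_add_eq_append[of 0 k "n - k"] upt_conv_Cons[of k n] by simp
    have "?f a = map (Poly_Mapping.lookup a) [0..<k] @ Poly_Mapping.lookup a k # map (Poly_Mapping.lookup a) [Suc k..<n]"
      "?f b = map (Poly_Mapping.lookup a) [0..<k] @ Poly_Mapping.lookup b k # map (Poly_Mapping.lookup b) [Suc k..<n]"
      unfolding split using k(2) by simp_all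
    then show "(a, b) \<in> inv_image (lexn less_than n) ?f"
      unfolding in_inv_image lexn_conv using k(1) \<open>k < n\<close> by auto
  qed
qed

text \<open>Comparing leading monomials shows that the one of \<open>b\<close> divides the one of \<open>a\<close>, so one step
  of polynomial division applies and leaves the hypothesis intact.\<close>
theorem almost_integral_dvd:
  fixes a b c :: "'k::field mpoly"
  assumes b: "b \<noteq> 0" and c: "c \<noteq> 0" and dvd: "\<And>N. b ^ N dvd c * a ^ N"
  shows "b dvd a"
proof -
  obtain na where "a \<in> polys {..<na}" using finite_keys_polys by blast
  moreover obtain nb where "b \<in> polys {..<nb}" using finite_keys_polys by blast
  ultimately obtain n where ab: "a \<in> polys {..<n}" "b \<in> polys {..<n}"
    using polys_mono[of "{..<na}" "{..<max na nb}"] polys_mono[of "{..<nb}" "{..<max na nb}"]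
    by (metis lessThan_subset_iff max.cobounded1 max.cobounded2 subsetD)
  let ?R = "{(m, m'). m < m' \<and> Poly_Mapping.keys m \<subseteq> {..<n} \<and> Poly_Mapping.keys m' \<subseteq> {..<n}}"
  show ?thesis
    using dvd ab(1)
  proof (induction "lead_mon a" arbitrary: a rule: wf_induct_rule[OF wf_mon_order[of n]])
    case (1 a)
    show ?case
    proof (cases "a = 0")
      case False
      let ?ma = "lead_mon a" and ?mb = "lead_mon b"
      have le: "Poly_Mapping.lookup ?mb i \<le> Poly_Mapping.lookup ?ma i" for i
      proof (rule ccontr)
        assume "\<not> ?thesis"
        then have lt: "Poly_Mapping.lookup ?ma i + 1 \<le> Poly_Mapping.lookup ?mb i" by simp
        \<comment> \<open>With \<open>N\<close> larger than the exponent in the leading monomial of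
          \<open>c\<close>, the deficit of at least one in each factor \<open>a\<close> can no
          longer be made up by \<open>c\<close>.\<close>
        define N where "N = Suc (Poly_Mapping.lookup (lead_mon c) i)"
        obtain h where h: "c * a ^ N = b ^ N * h" using 1(2)[of N] by (elim dvdE)
        have nz: "a ^ N \<noteq> 0" "b ^ N \<noteq> 0" "h \<noteq> 0"
          using h False b c by auto
        have "lead_mon c + lead_mon (a ^ N) = lead_mon (b ^ N) + lead_mon h"
          using arg_cong[OF h, of lead_mon] nz c by (simp add: lead_mon_mult)
        then have "Poly_Mapping.lookup (lead_mon c) i + N * Poly_Mapping.lookup ?ma i \<ge> N * Poly_Mapping.lookup ?mb i"
          using lookup_lead_mon_power[OF False, of N i] lookup_lead_mon_power[OF b, of N i]
          by (metis le_add1 lookup_add)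
        moreover have "N * (Poly_Mapping.lookup ?ma i + 1) \<le> N * Poly_Mapping.lookup ?mb i"
          using lt by (rule mult_le_mono2)
        ultimately show False by (simp add: N_def)
      qed
      define q where "q = Poly_Mapping.single (?ma - ?mb) (Poly_Mapping.lookup a ?ma / Poly_Mapping.lookup b ?mb)"
      have mab: "(?ma - ?mb) + ?mb = ?ma"
        by (rule poly_mapping_eqI) (use le in \<open>simp add: lookup_add lookup_minus\<close>)
      have lb: "Poly_Mapping.lookup b ?mb \<noteq> 0" and la: "Poly_Mapping.lookup a ?ma \<noteq> 0"
        using lead_mon_in_keys b False by (auto simp: in_keys_iff)
      have q0: "q \<noteq> 0" using la lb by (metis divide_eq_0_iff lookup_single_eq lookup_zero q_def)
      have lq: "lead_mon q = ?ma - ?mb" using la lb by (intro lead_mon_eqI) (auto simp: q_def)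
      have qp: "q \<in> polys {..<n}"
      proof -
        have "Poly_Mapping.keys ?ma \<subseteq> {..<n}"
          using lead_mon_in_keys[OF False] 1(3) by (auto simp: polys_def)
        then show ?thesis using la lb by (auto simp: q_def polys_def in_keys_iff lookup_minus subset_iff)
      qed
      have qb: "lead_mon (q * b) = ?ma" "Poly_Mapping.lookup (q * b) ?ma = Poly_Mapping.lookup a ?ma"
        using lead_mon_mult[OF q0 b] lookup_mult_lead_mon[OF q0 b] lb
        by (simp_all add: lq mab) (simp add: q_def)
      define a1 where "a1 = a - q * b"
      have a1p: "a1 \<in> polys {..<n}" unfolding a1_def using 1(3) qp ab(2) by (auto intro!: polys_intros)
      \<comment> \<open>In the expansion of \<open>(a - q * b) ^ N\<close> each term contains
        \<open>c * a ^ k\<close>, divisible by \<open>b ^ k\<close>, and a further factor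
        \<open>b ^ (N - k)\<close>.\<close>
      have dvd1: "b ^ N dvd c * a1 ^ N" for N
      proof -
        have "c * a1 ^ N = (\<Sum>k\<le>N. of_nat (N choose k) * (c * a ^ k) * (- q) ^ (N - k) * b ^ (N - k))"
        proof -
          have gen: "c * (a + r * b) ^ N = (\<Sum>k\<le>N. of_nat (N choose k) * (c * a ^ k) * r ^ (N - k) * b ^ (N - k))" for r
            unfolding binomial_ring sum_distrib_left
            by (intro sum.cong refl) (simp add: power_mult_distrib mult_ac)
          show ?thesis using gen[of "- q"] by (simp add: a1_def)
        qed
        moreover have "b ^ N dvd of_nat (N choose k) * (c * a ^ k) * (- q) ^ (N - k) * b ^ (N - k)" if "k \<le> N" for k
        proof -
          have "b ^ k * b ^ (N - k) dvd (c * a ^ k) * b ^ (N - k)" using 1(2) by (rule mult_dvd_mono) simp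
          then have "b ^ N dvd (c * a ^ k) * b ^ (N - k)" using that by (simp flip: power_add)
          then have "b ^ N dvd ((c * a ^ k) * b ^ (N - k)) * (of_nat (N choose k) * (- q) ^ (N - k))" by (rule dvd_mult2)
          then show ?thesis by (simp add: mult_ac)
        qed
        ultimately show ?thesis by (simp only:) (rule dvd_sum, simp)
      qed
      have "b dvd a1"
      proof (cases "a1 = 0")
        case nz: False
        have "lead_mon a1 < ?ma"
        proof -
          have "lead_mon a1 \<in> Poly_Mapping.keys a \<union> Poly_Mapping.keys (q * b)" "lead_mon a1 \<noteq> ?ma"
            using lead_mon_in_keys[OF nz] qb(2) by (auto simp: a1_def in_keys_iff lookup_minus)
          then show ?thesis using le_lead_mon[of "lead_mon a1" a] le_lead_mon[of "lead_mon a1" "q * b"] qb(1)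
            by auto
        qed
        moreover have "Poly_Mapping.keys (lead_mon a1) \<subseteq> {..<n}" "Poly_Mapping.keys ?ma \<subseteq> {..<n}"
          using lead_mon_in_keys[OF False] lead_mon_in_keys[OF nz] 1(3) a1p by (auto simp: polys_def)
        ultimately have "(lead_mon a1, ?ma) \<in> ?R" by simp
        then show ?thesis using 1(1) dvd1 a1p by blast
      qed simp
      then have "b dvd a1 + q * b" by simp
      then show ?thesis by (simp add: a1_def)
    qed simp
  qed
qed

section \<open>Polynomials inside their fraction field\<close>

definition of_mpoly :: "'k::field mpoly \<Rightarrow> 'k mpoly fract" where
  "of_mpoly p = Fract p 1"

lemma rhom_of_mpoly: "rhom of_mpoly"
  by (simp add: rhom_def of_mpoly_def One_fract_def)

lemma of_mpoly_eq_iff [simp]: "of_mpoly p = of_mpoly q \<longleftrightarrow> p = q"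
  by (simp add: of_mpoly_def eq_fract)

lemma of_mpoly_0 [simp]: "of_mpoly 0 = 0" and of_mpoly_1 [simp]: "of_mpoly 1 = 1"
  by (simp_all add: rhom_simps[OF rhom_of_mpoly])

lemma of_mpoly_eq_0_iff [simp]: "of_mpoly p = 0 \<longleftrightarrow> p = 0"
  by (metis of_mpoly_0 of_mpoly_eq_iff)

lemmas of_mpoly_simps = rhom_simps[OF rhom_of_mpoly]

lemma fract_as_quotient:
  obtains a b where "u = of_mpoly a / of_mpoly b" "b \<noteq> 0"
  by (cases u) (simp add: of_mpoly_def)

text \<open>This is complete integral closedness of the polynomial ring; writing \<open>u\<close> as
  \<open>a / b\<close> reduces it to \<open>almost_integral_dvd\<close>.\<close>

lemma almost_integral_of_mpoly:
  assumes c: "c \<noteq> 0" and "\<And>N. \<exists>h. of_mpoly c * u ^ N = of_mpoly h"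
  obtains b where "u = of_mpoly b"
proof -
  obtain a b where u: "u = of_mpoly a / of_mpoly b" and b: "b \<noteq> 0" by (rule fract_as_quotient)
  have "b ^ N dvd c * a ^ N" for N
  proof -
    obtain h where "of_mpoly c * u ^ N = of_mpoly h" using assms(2) by blast
    then have "of_mpoly (c * a ^ N) = of_mpoly (b ^ N * h)"
      using b by (simp add: u of_mpoly_simps field_simps)
    then show ?thesis by simp
  qed
  then have "b dvd a" by (rule almost_integral_dvd[OF b c])
  then obtain q where "a = b * q" by (elim dvdE)
  then have "u = of_mpoly q" using b by (simp add: u of_mpoly_simps)
  then show ?thesis using that by blast
qed

lemma common_denominator:
  assumes "finite G"
  obtains c where "c \<noteq> 0" "\<forall>g\<in>G. \<exists>a. of_mpoly c * f g = of_mpoly a"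
proof -
  from assms have "\<exists>c. c \<noteq> 0 \<and> (\<forall>g\<in>G. \<exists>a. of_mpoly c * f g = of_mpoly a)"
  proof (induction G)
    case empty
    show ?case by (rule exI[of _ 1]) simp
  next
    case (insert x G)
    then obtain c where c: "c \<noteq> 0" "\<forall>g\<in>G. \<exists>a. of_mpoly c * f g = of_mpoly a" by blast
    obtain p q where pq: "f x = of_mpoly p / of_mpoly q" "q \<noteq> 0" by (rule fract_as_quotient)
    have "\<exists>a. of_mpoly (c * q) * f g = of_mpoly a" if "g \<in> insert x G" for g
    proof (cases "g = x")
      case True
      then have "of_mpoly (c * q) * f g = of_mpoly (c * p)"
        using pq by (simp add: of_mpoly_simps)
      then show ?thesis by blast
    next
      case False
      then have "g \<in> G" using that by simp
      then obtain a where "of_mpoly c * f g = of_mpoly a" using c(2) by metis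
      then have "of_mpoly (c * q) * f g = of_mpoly (a * q)" by (simp add: of_mpoly_simps mult_ac)
      then show ?thesis by blast
    qed
    then show ?case using c(1) pq(2) by (intro exI[of _ "c * q"]) simp
  qed
  then show ?thesis using that by blast
qed


section \<open>Finite modules inside a universal field\<close>

definition mod_span :: "'a::comm_ring_1 set \<Rightarrow> 'a set \<Rightarrow> 'a set" where
  "mod_span B G = {\<Sum>g\<in>G. c g * g | c. \<forall>g\<in>G. c g \<in> B}"

lemma mod_spanI: "(\<And>g. g \<in> G \<Longrightarrow> c g \<in> B) \<Longrightarrow> (\<Sum>g\<in>G. c g * g) \<in> mod_span B G"
  unfolding mod_span_def by blast

lemma mod_spanE:
  assumes "x \<in> mod_span B G"
  obtains c where "x = (\<Sum>g\<in>G. c g * g)" "\<forall>g\<in>G. c g \<in> B"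
  using assms unfolding mod_span_def by blast

lemma mod_span_base:
  assumes "subr B" "finite G" "g \<in> G"
  shows "g \<in> mod_span B G"
proof -
  have "(\<Sum>h\<in>G. (if h = g then 1 else 0) * h) \<in> mod_span B G"
    using assms by (intro mod_spanI) (auto intro: subr_0 subr_1)
  also have "(\<Sum>h\<in>G. (if h = g then 1 else 0) * h) = g"
    using assms by (simp add: if_distrib[of "\<lambda>x. x * _"] cong: if_cong)
  finally show ?thesis .
qed

lemma mod_span_0: "subr B \<Longrightarrow> 0 \<in> mod_span B G"
  using mod_spanI[of G "\<lambda>_. 0" B] by (simp add: subr_0)

lemma mod_span_add:
  assumes "subr B" "x \<in> mod_span B G" "y \<in> mod_span B G"
  shows "x + y \<in> mod_span B G"
proof -
  obtain c where "x = (\<Sum>g\<in>G. c g * g)" "\<forall>g\<in>G. c g \<in> B"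
    using assms(2) by (rule mod_spanE)
  moreover obtain d where "y = (\<Sum>g\<in>G. d g * g)" "\<forall>g\<in>G. d g \<in> B"
    using assms(3) by (rule mod_spanE)
  ultimately show ?thesis
    using mod_spanI[of G "\<lambda>g. c g + d g" B] assms(1) by (simp add: subr_add sum.distrib distrib_right)
qed

lemma mod_span_smult:
  assumes "subr B" "b \<in> B" "x \<in> mod_span B G"
  shows "b * x \<in> mod_span B G"
proof -
  obtain c where "x = (\<Sum>g\<in>G. c g * g)" "\<forall>g\<in>G. c g \<in> B"
    using assms(3) by (rule mod_spanE)
  then show ?thesis
    using mod_spanI[of G "\<lambda>g. b * c g" B] assms by (simp add: subr_mult sum_distrib_left mult.assoc)
qed

lemma mod_span_sum:
  "subr B \<Longrightarrow> (\<And>i. i \<in> J \<Longrightarrow> f i \<in> mod_span B G) \<Longrightarrow> (\<Sum>i\<in>J. f i) \<in> mod_span B G"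
  by (induction J rule: infinite_finite_induct) (auto intro: mod_span_0 mod_span_add)

lemma mod_span_subset:
  assumes "subr B" "S \<subseteq> M" "0 \<in> M" "\<And>x y. x \<in> M \<Longrightarrow> y \<in> M \<Longrightarrow> x + y \<in> M"
    "\<And>b x. b \<in> B \<Longrightarrow> x \<in> M \<Longrightarrow> b * x \<in> M"
  shows "mod_span B S \<subseteq> M"
proof
  fix x assume "x \<in> mod_span B S"
  then obtain c where c: "x = (\<Sum>g\<in>S. c g * g)" "\<forall>g\<in>S. c g \<in> B" by (rule mod_spanE)
  have "(\<Sum>g\<in>T. c g * g) \<in> M" if "T \<subseteq> S" for T
    using that by (induction T rule: infinite_finite_induct) (use assms c in auto)
  then show "x \<in> M" using c by auto
qed

lemma mod_span_mult:
  assumes "subr B" "finite G" "finite H" "x \<in> mod_span B G" "y \<in> mod_span B H"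
  shows "x * y \<in> mod_span B ((\<lambda>(g, h). g * h) ` (G \<times> H))"
proof -
  let ?GH = "(\<lambda>(g, h). g * h) ` (G \<times> H)"
  obtain c where c: "x = (\<Sum>g\<in>G. c g * g)" "\<forall>g\<in>G. c g \<in> B" using assms(4) by (rule mod_spanE)
  obtain d where d: "y = (\<Sum>g\<in>H. d g * g)" "\<forall>g\<in>H. d g \<in> B" using assms(5) by (rule mod_spanE)
  have "x * y = (\<Sum>g\<in>G. \<Sum>h\<in>H. (c g * d h) * (g * h))"
    unfolding c d by (simp add: sum_product mult_ac)
  also have "\<dots> \<in> mod_span B ?GH"
  proof (intro mod_span_sum[OF assms(1)])
    fix g h assume "g \<in> G" "h \<in> H"
    then have "c g * d h \<in> B" "g * h \<in> ?GH"
      using assms(1-3) c(2) d(2) by (auto intro: subr_mult)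
    then have "c g * d h \<in> B" "g * h \<in> mod_span B ?GH"
      using assms(1-3) mod_span_base[of B ?GH] by auto
    then show "c g * d h * (g * h) \<in> mod_span B ?GH"
      by (rule mod_span_smult[OF assms(1)])
  qed
  finally show ?thesis .
qed

text \<open>The generating set \<open>H\<close> depends only on the sets \<open>G i\<close>: one
  finitely generated module holds all the products, which \<open>exists_norm\<close> needs for the
  ring generated by them.\<close>

lemma mod_span_prod:
  fixes f :: "'i \<Rightarrow> 'a::comm_ring_1"
  assumes "subr B" "finite J" "\<And>i. i \<in> J \<Longrightarrow> finite (G i)"
  obtains H where "finite H"
    "\<And>f. (\<And>i. i \<in> J \<Longrightarrow> f i \<in> mod_span B (G i)) \<Longrightarrow> (\<Prod>i\<in>J. f i) \<in> mod_span B H"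
proof -
  from assms(2,3) have "\<exists>H. finite H \<and> (\<forall>f. (\<forall>i\<in>J. f i \<in> mod_span B (G i)) \<longrightarrow> (\<Prod>i\<in>J. f i) \<in> mod_span B H)"
  proof (induction J)
    case empty
    show ?case using mod_span_base[OF assms(1), of "{1}" 1] by (intro exI[of _ "{1}"]) simp
  next
    case (insert j J)
    then obtain H where "finite H" "\<And>f. (\<forall>i\<in>J. f i \<in> mod_span B (G i)) \<Longrightarrow> (\<Prod>i\<in>J. f i) \<in> mod_span B H"
      by (metis insertCI)
    then show ?case
      using insert by (intro exI[of _ "(\<lambda>(g, h). g * h) ` (G j \<times> H)"]) (auto intro!: mod_span_mult[OF assms(1)])
  qed
  then show ?thesis using that by blast
qed

text \<open>The type \<open>'k mpoly\<close> has two roles: it holds the polynomials under study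
  and, in the source of \<open>emb\<close>, independent transcendentals. As there are infinitely
  many of these, one field receives generic points for every number of variables.\<close>

locale universal_field =
  fixes emb :: "'k::field mpoly fract \<Rightarrow> 'l::alg_closed_field"
  assumes rhom_emb: "rhom emb"
begin

lemmas emb_simps = rhom_simps[OF rhom_emb]

lemma emb_eq_0_iff [simp]: "emb a = 0 \<longleftrightarrow> a = 0"
proof
  assume "emb a = 0"
  show "a = 0"
  proof (rule ccontr)
    assume "a \<noteq> 0"
    then have "emb a * emb (inverse a) = 1" by (simp flip: emb_simps(4) add: emb_simps)
    then show False using \<open>emb a = 0\<close> by simp
  qed
qed (simp add: emb_simps)

lemma emb_eq_iff [simp]: "emb a = emb b \<longleftrightarrow> a = b"
  by (rule rhom_inj_iff[OF rhom_emb]) simp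

definition \<iota> :: "'k mpoly \<Rightarrow> 'l" where
  "\<iota> p = emb (of_mpoly p)"

lemma rhom_\<iota>: "rhom \<iota>"
  unfolding \<iota>_def by (rule rhom_comp[OF rhom_emb rhom_of_mpoly])

lemmas \<iota>_simps = rhom_simps[OF rhom_\<iota>]

lemma \<iota>_eq_iff [simp]: "\<iota> p = \<iota> q \<longleftrightarrow> p = q"
  by (simp add: \<iota>_def)

lemma \<iota>_eq_0_iff [simp]: "\<iota> p = 0 \<longleftrightarrow> p = 0"
  by (simp add: \<iota>_def)

definition base :: "nat \<Rightarrow> 'l set" where
  "base d = \<iota> ` polys {..<d}"

lemma subr_base: "subr (base d)"
  unfolding base_def by (rule subr_image[OF rhom_\<iota> subr_polys])

lemma base_subset_span:
  assumes "subr S" "S = mod_span (base d) G"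
  shows "base d \<subseteq> S"
proof
  fix b assume "b \<in> base d"
  then have "b * 1 \<in> S" unfolding assms(2) using subr_1[OF assms(1)] assms(2) by (intro mod_span_smult subr_base) auto
  then show "b \<in> S" by simp
qed

sublocale vs: vector_space "\<lambda>a x. emb a * x"
  by unfold_locales (simp_all add: emb_simps algebra_simps)

sublocale vsF: vector_space "(*) :: 'k mpoly fract \<Rightarrow> _"
  by unfold_locales (simp_all add: algebra_simps)

sublocale vs_pair: vector_space_pair "\<lambda>a x. emb a * x" "(*) :: 'k mpoly fract \<Rightarrow> _" ..

sublocale vs_pair': vector_space_pair "\<lambda>a x. emb a * x" "\<lambda>a x. emb a * x" ..

text \<open>Normality of the ring \<open>base d\<close>, in module form. All powers of
  \<open>u\<close> lie in one finitely generated module; a functional \<open>l\<close>, linear over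
  the fraction field and with \<open>l 1 = 1\<close>, carries them back into the fraction field,
  where a common denominator of the values on \<open>G\<close> serves for all of them.\<close>

theorem integral_in_base:
  assumes W: "subr W" "W \<subseteq> mod_span (base d) G" and G: "finite G" and u: "emb u \<in> W"
  obtains b where "b \<in> polys {..<d}" "u = of_mpoly b"
proof -
  have "\<exists>g. Vector_Spaces.linear (\<lambda>a x. emb a * x) (*) g \<and> (\<forall>x\<in>{1}. g x = 1)"
    by (rule vs_pair.linear_independent_extend) simp
  then obtain l where l: "Vector_Spaces.linear (\<lambda>a x. emb a * x) (*) l" "l 1 = 1" by auto
  interpret l: Vector_Spaces.linear "\<lambda>a x. emb a * x" "(*)" l by fact
  obtain c where c: "c \<noteq> 0" "\<forall>g\<in>G. \<exists>a. of_mpoly c * l g = of_mpoly a"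
    by (rule common_denominator[OF G])
  then obtain a where a: "\<And>g. g \<in> G \<Longrightarrow> of_mpoly c * l g = of_mpoly (a g)" by metis
  have pw: "\<exists>\<beta>. (\<forall>g\<in>G. \<beta> g \<in> polys {..<d}) \<and> of_mpoly c * u ^ N = of_mpoly (\<Sum>g\<in>G. \<beta> g * a g)" for N
  proof -
    have "emb (u ^ N) \<in> mod_span (base d) G"
      using subr_power[OF W(1) u, of N] W(2) by (auto simp: emb_simps)
    then obtain \<gamma> where \<gamma>: "emb (u ^ N) = (\<Sum>g\<in>G. \<gamma> g * g)" "\<forall>g\<in>G. \<gamma> g \<in> base d"
      by (rule mod_spanE)
    then obtain \<beta> where \<beta>: "\<And>g. g \<in> G \<Longrightarrow> \<beta> g \<in> polys {..<d} \<and> \<gamma> g = \<iota> (\<beta> g)"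
      unfolding base_def image_iff by metis
    have "u ^ N = l (emb (u ^ N))" using l.scale[of "u ^ N" 1] l(2) by simp
    also have "\<dots> = l (\<Sum>g\<in>G. emb (of_mpoly (\<beta> g)) * g)"
      unfolding \<gamma>(1) using \<beta> by (simp add: \<iota>_def)
    also have "\<dots> = (\<Sum>g\<in>G. of_mpoly (\<beta> g) * l g)" by (simp add: l.sum l.scale)
    finally have uN: "u ^ N = (\<Sum>g\<in>G. of_mpoly (\<beta> g) * l g)" .
    have "of_mpoly c * u ^ N = (\<Sum>g\<in>G. of_mpoly (\<beta> g) * (of_mpoly c * l g))"
      unfolding uN sum_distrib_left by (rule sum.cong[OF refl]) (rule mult.left_commute)
    also have "\<dots> = of_mpoly (\<Sum>g\<in>G. \<beta> g * a g)" using a by (simp add: of_mpoly_simps)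
    finally show ?thesis using \<beta> by blast
  qed
  then obtain b where b: "u = of_mpoly b" using almost_integral_of_mpoly[OF c(1)] by metis
  have "b \<in> polys {..<d}"
  proof (cases "b = 0")
    case False
    have "top_wt (var_wt j) b = 0" if j: "j \<notin> {..<d}" for j
    proof -
      \<comment> \<open>The coefficients \<open>\<beta> g\<close> do not involve the variable
        \<open>j\<close>, so the degree of \<open>c * b ^ N\<close> in it is at most
        \<open>M\<close> for every \<open>N\<close>; this forces degree zero for
        \<open>b\<close>.\<close>
      define M where "M = Max (insert 0 ((\<lambda>g. top_wt (var_wt j) (a g)) ` G))"
      have M: "top_wt (var_wt j) (a g) \<le> M" if "g \<in> G" for g
        unfolding M_def using G that by (intro Max_ge) auto
      have M0: "0 \<le> M" unfolding M_def using G by (intro Max_ge) auto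
      have bd: "top_wt (var_wt j) c + int N * top_wt (var_wt j) b \<le> M" for N
      proof -
        obtain \<beta> where \<beta>: "\<And>g. g \<in> G \<Longrightarrow> \<beta> g \<in> polys {..<d}"
          and eq: "of_mpoly c * u ^ N = of_mpoly (\<Sum>g\<in>G. \<beta> g * a g)" using pw by blast
        have eq': "c * b ^ N = (\<Sum>g\<in>G. \<beta> g * a g)"
          using eq by (simp add: b flip: of_mpoly_simps)
        have "top_wt (var_wt j) c + int N * top_wt (var_wt j) b = top_wt (var_wt j) (c * b ^ N)"
          using False c(1) by (simp add: top_wt_mult[OF additive_var_wt] top_var_wt_power)
        moreover obtain m where m: "m \<in> Poly_Mapping.keys (c * b ^ N)" "var_wt j m = top_wt (var_wt j) (c * b ^ N)"
          using top_wt_attained[of "c * b ^ N" "var_wt j"] False c(1) by auto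
        moreover have "\<exists>g\<in>G. m \<in> Poly_Mapping.keys (\<beta> g * a g)"
          using m(1) keys_sum[of "\<lambda>g. \<beta> g * a g" G] unfolding eq' by blast
        then obtain g x y where "g \<in> G" "m = x + y" "x \<in> Poly_Mapping.keys (\<beta> g)" "y \<in> Poly_Mapping.keys (a g)"
          using keys_mult by blast
        moreover from this have "var_wt j x = 0"
          using \<beta>[of g] j by (force simp: polys_def var_wt_def simp flip: not_in_keys_iff_lookup_eq_zero)
        ultimately show ?thesis
          using M[of g] top_wt_ge[of y "a g" "var_wt j"] by (simp add: additive_wt_add[OF additive_var_wt])
      qed
      show ?thesis
      proof (rule ccontr)
        assume "top_wt (var_wt j) b \<noteq> 0"
        then have "1 \<le> top_wt (var_wt j) b" using top_var_wt_nonneg[OF False, of j] by simp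
        then have "(M + 1) * 1 \<le> (M + 1) * top_wt (var_wt j) b"
          using M0 by (intro mult_left_mono) auto
        moreover have "int (nat (M + 1)) = M + 1" using M0 by simp
        ultimately show False using bd[of "nat (M + 1)"] top_var_wt_nonneg[OF c(1), of j] by simp
      qed
    qed
    then show ?thesis using polys_iff_top_var_wt[OF False] by blast
  qed (simp add: polys_intros)
  then show ?thesis using that b by blast
qed

end


section \<open>Norms of integral elements\<close>

context universal_field
begin

abbreviation ev_emb :: "'k mpoly fract poly \<Rightarrow> 'l \<Rightarrow> 'l" where
  "ev_emb p x \<equiv> poly (map_poly emb p) x"

lemma rhom_ev_emb: "rhom (\<lambda>p. ev_emb p x)"
  by (rule rhom_comp[OF _ rhom_map_poly[OF rhom_emb]]) (simp add: rhom_def)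

lemmas ev_emb_simps = rhom_simps[OF rhom_ev_emb]

lemma ev_emb_const [simp]: "ev_emb [:a:] x = emb a"
  by (simp add: map_poly_pCons emb_simps)

lemma ev_emb_pCons: "ev_emb (pCons a p) x = emb a + x * ev_emb p x"
  by (simp add: map_poly_pCons emb_simps)

lemma ev_emb_monom: "ev_emb (Polynomial.monom a j) y = emb a * y ^ j"
  by (simp add: map_poly_monom emb_simps poly_monom)

lemma ev_emb_smult [simp]: "ev_emb (smult a p) x = emb a * ev_emb p x"
  using rhom_mult[OF rhom_ev_emb, of "[:a:]" p x] by simp

lemma ev_emb_X [simp]: "ev_emb [:0, 1:] x = x"
  by (simp add: map_poly_pCons emb_simps)

text \<open>The linear map extends the isomorphism \<open>F(t) \<cong> F(x)\<close> for a conjugate \<open>x\<close> of \<open>t\<close>. It carries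
  finitely generated modules containing all powers of \<open>t\<close> to such modules for \<open>x\<close>, which takes
  the place of integral equations.\<close>
lemma exists_conjugation:
  assumes m: "m \<noteq> 0" "ev_emb m t = 0" and min: "\<And>p. p \<noteq> 0 \<Longrightarrow> ev_emb p t = 0 \<Longrightarrow> degree m \<le> degree p"
    and x: "ev_emb m x = 0"
  obtains L where "Vector_Spaces.linear (\<lambda>a y. emb a * y) (\<lambda>a y. emb a * y) L"
    "\<And>p. L (ev_emb p t) = ev_emb p x"
proof -
  let ?r = "degree m"
  have inj: "p = 0" if "ev_emb p t = 0" "degree p < ?r" for p
    using min[of p] that by force
  have deg: "degree p < ?r \<Longrightarrow> degree q < ?r \<Longrightarrow> degree (p - q) < ?r" for p q :: "'k mpoly fract poly"
    by (metis degree_diff_le_max le_less_trans max_less_iff_conj)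
  have r: "?r > 0"
  proof (rule ccontr)
    assume "\<not> ?thesis"
    then obtain c where "m = [:c:]" by (auto elim: degree_eq_zeroE)
    then show False using m by auto
  qed
  let ?B = "(\<lambda>j. t ^ j) ` {..<?r}"
  have injB: "inj_on (\<lambda>j. t ^ j) {..<?r}"
  proof (rule inj_onI)
    fix i j assume ij: "i \<in> {..<?r}" "j \<in> {..<?r}" "t ^ i = t ^ j"
    have "ev_emb (Polynomial.monom 1 i - Polynomial.monom 1 j) t = 0"
      using ij(3) by (simp add: ev_emb_simps ev_emb_monom emb_simps)
    moreover have "degree (Polynomial.monom (1 :: 'k mpoly fract) i - Polynomial.monom 1 j) < ?r"
      using ij by (intro deg) (simp_all add: degree_monom_eq)
    ultimately have "Polynomial.monom (1 :: 'k mpoly fract) i - Polynomial.monom 1 j = 0" by (rule inj)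
    then show "i = j" by (simp add: monom_eq_iff')
  qed
  have indep: "vs.independent ?B"
  proof (rule vs.independent_if_scalars_zero)
    show "finite ?B" by simp
    fix f y assume sum0: "(\<Sum>y\<in>?B. emb (f y) * y) = 0" and y: "y \<in> ?B"
    let ?p = "\<Sum>j<?r. Polynomial.monom (f (t ^ j)) j"
    have "ev_emb ?p t = (\<Sum>j<?r. emb (f (t ^ j)) * t ^ j)"
      by (simp add: ev_emb_simps ev_emb_monom)
    also have "\<dots> = 0" using sum0 by (simp add: sum.reindex[OF injB])
    finally have "?p = 0"
    proof (rule inj)
      show "degree ?p < ?r"
        using r by (intro degree_sum_less) (auto intro: le_less_trans[OF degree_monom_le])
    qed
    from y obtain j where j: "j < ?r" "y = t ^ j" by auto
    have "coeff ?p j = f (t ^ j)" using j(1) by (simp add: coeff_sum)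
    then show "f y = 0" using \<open>?p = 0\<close> j by simp
  qed
  \<comment> \<open>The powers of \<open>t\<close> below the degree of \<open>m\<close> are
    independent, so \<open>t ^ j\<close> can be sent to \<open>x ^ j\<close>; the inverse of the
    enumeration recovers \<open>j\<close>. Reduction modulo \<open>m\<close> extends the formula to
    all polynomials.\<close>
  obtain L where L: "Vector_Spaces.linear (\<lambda>a y. emb a * y) (\<lambda>a y. emb a * y) L"
    "\<And>y. y \<in> ?B \<Longrightarrow> L y = x ^ (the_inv_into {..<?r} (\<lambda>j. t ^ j) y)"
    using vs_pair'.linear_independent_extend[OF indep, of "\<lambda>y. x ^ (the_inv_into {..<?r} (\<lambda>j. t ^ j) y)"] by blast
  interpret L: Vector_Spaces.linear "\<lambda>a y. emb a * y" "\<lambda>a y. emb a * y" L by fact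
  have Lpow: "L (t ^ j) = x ^ j" if "j < ?r" for j
    using L(2)[of "t ^ j"] that the_inv_into_f_f[OF injB, of j] by auto
  have "L (ev_emb p t) = ev_emb p x" for p
  proof -
    define q where "q = p mod m"
    have q: "degree q < ?r" using degree_mod_less[OF m(1), of p] r by (auto simp: q_def)
    have red: "ev_emb p y = ev_emb q y" if "ev_emb m y = 0" for y
    proof -
      have "ev_emb (p div m * m + q) y = ev_emb q y"
        using that by (simp only: ev_emb_simps) simp
      then show ?thesis by (simp add: q_def)
    qed
    have exp: "q = (\<Sum>j<?r. Polynomial.monom (coeff q j) j)"
      using q by (intro poly_eqI) (auto simp: coeff_sum coeff_eq_0)
    have evq: "ev_emb q y = (\<Sum>j<?r. emb (coeff q j) * y ^ j)" for y
      by (subst exp) (simp add: ev_emb_simps ev_emb_monom)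
    show ?thesis
      unfolding red[OF m(2)] red[OF x] evq
      by (simp add: L.sum L.scale Lpow)
  qed
  then show ?thesis using that L(1) by blast
qed

text \<open>The first \<open>card G + 1\<close> powers of \<open>t\<close> lie in a space spanned by
  \<open>card G\<close> elements, so they satisfy a relation. The polynomial is minimal over the
  whole fraction field; that its coefficients come from \<open>polys {..<d}\<close> emerges only in
  \<open>exists_norm\<close>.\<close>

lemma exists_minimal_polynomial:
  assumes S: "subr S" "S \<subseteq> mod_span (base d) G" "finite G" and t: "t \<in> S"
  obtains m where "m \<noteq> 0" "ev_emb m t = 0" "lead_coeff m = 1"
    "\<And>p. p \<noteq> 0 \<Longrightarrow> ev_emb p t = 0 \<Longrightarrow> degree m \<le> degree p"
proof -
  have "\<exists>p. p \<noteq> 0 \<and> ev_emb p t = 0"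
  proof (rule ccontr)
    assume no: "\<not> ?thesis"
    have sp: "mod_span (base d) G \<subseteq> vs.span G"
      by (rule mod_span_subset[OF subr_base])
        (auto intro: vs.span_base vs.span_zero vs.span_add vs.span_scale simp: base_def \<iota>_def)
    let ?T = "(\<lambda>j. t ^ j) ` {..card G}"
    have injT: "inj_on (\<lambda>j. t ^ j) {..card G}"
    proof (rule inj_onI)
      fix i j assume "t ^ i = t ^ j"
      then have "ev_emb (Polynomial.monom 1 i - Polynomial.monom 1 j) t = 0"
        by (simp add: ev_emb_simps ev_emb_monom emb_simps)
      then have "Polynomial.monom (1 :: 'k mpoly fract) i - Polynomial.monom 1 j = 0" using no by blast
      then show "i = j" by (simp add: monom_eq_iff')
    qed
    have "vs.independent ?T"
    proof (rule vs.independent_if_scalars_zero)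
      fix f y assume sum0: "(\<Sum>y\<in>?T. emb (f y) * y) = 0" and y: "y \<in> ?T"
      let ?p = "\<Sum>j\<le>card G. Polynomial.monom (f (t ^ j)) j"
      have "ev_emb ?p t = 0"
        using sum0 by (simp add: ev_emb_simps ev_emb_monom sum.reindex[OF injT])
      then have "?p = 0" using no by blast
      from y obtain j where j: "j \<le> card G" "y = t ^ j" by auto
      have "coeff ?p j = f (t ^ j)" using j(1) by (simp add: coeff_sum)
      then show "f y = 0" using \<open>?p = 0\<close> j by simp
    qed simp
    moreover have "?T \<subseteq> vs.span G"
      using subr_power[OF S(1) t] S(2) sp by blast
    ultimately have "card ?T \<le> card G"
      using vs.independent_span_bound[OF S(3)] by blast
    then show False by (simp add: card_image[OF injT])
  qed
  then obtain m0 where m0: "m0 \<noteq> 0" "ev_emb m0 t = 0"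
    and min: "\<And>p. p \<noteq> 0 \<and> ev_emb p t = 0 \<Longrightarrow> degree m0 \<le> degree p"
    using ex_has_least_nat[of "\<lambda>p. p \<noteq> 0 \<and> ev_emb p t = 0" _ degree] by blast
  define m where "m = [:inverse (lead_coeff m0):] * m0"
  have "m \<noteq> 0" "lead_coeff m = 1" "degree m = degree m0" "ev_emb m t = 0"
    using m0 by (simp_all add: m_def ev_emb_simps)
  then show ?thesis using that min by metis
qed

text \<open>The element \<open>a\<close> is the norm of \<open>t\<close> up to sign.\<close>
theorem exists_norm:
  assumes S: "subr S" "S = mod_span (base d) G" and G: "finite G"
    and t: "t \<in> S" "t \<noteq> 0"
  obtains a r where "a \<in> polys {..<d}" "a \<noteq> 0" "\<exists>s\<in>S. \<iota> a = t * s"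
    "\<And>f s. f \<in> polys {..<d} \<Longrightarrow> s \<in> S \<Longrightarrow> \<iota> f = t * s \<Longrightarrow> a dvd f ^ r"
proof -
  note baseS = base_subset_span[OF S]
  obtain m where m: "m \<noteq> 0" "ev_emb m t = 0" "lead_coeff m = 1"
    and min: "\<And>p. p \<noteq> 0 \<Longrightarrow> ev_emb p t = 0 \<Longrightarrow> degree m \<le> degree p"
    using exists_minimal_polynomial[OF S(1) _ G t(1)] S(2) by blast
  \<comment> \<open>Otherwise dividing \<open>m\<close> by its variable would give a polynomial of
    smaller degree vanishing at \<open>t\<close>.\<close>
  have m0: "coeff m 0 \<noteq> 0"
  proof
    assume "coeff m 0 = 0"
    then obtain q where q: "m = [:0, 1:] * q"
      by (metis mpoly_base_conv(2) poly_0_coeff_0 dvdE poly_eq_0_iff_dvd minus_zero)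
    then have "ev_emb q t = 0" "q \<noteq> 0" using m t by (auto simp: ev_emb_pCons emb_simps)
    then have "degree m \<le> degree q" by (intro min)
    then show False using q \<open>q \<noteq> 0\<close> by (simp add: degree_mult_eq)
  qed
  have lcm: "lead_coeff (map_poly emb m) = 1" "map_poly emb m \<noteq> 0" "degree (map_poly emb m) = degree m"
    using m by (simp_all add: emb_simps map_poly_eq_0_iff degree_map_poly coeff_map_poly)
  obtain A where A: "size A = degree (map_poly emb m)"
      "map_poly emb m = smult (lead_coeff (map_poly emb m)) (\<Prod>x\<in>#A. [:-x, 1:])"
    using alg_closed_imp_factorization[OF lcm(2)] by blast
  obtain xs where xs: "mset xs = A" using ex_mset by blast
  define r where "r = length xs"
  \<comment> \<open>Roots are listed with multiplicity, which covers inseparable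
    \<open>t\<close>.\<close>
  have fac: "map_poly emb m = (\<Prod>i<r. [:- (xs ! i), 1:])"
  proof -
    have "map_poly emb m = prod_list (map (\<lambda>x. [:-x, 1:]) xs)"
      using A(2) lcm(1) by (simp flip: xs prod_mset_prod_list)
    also have "\<dots> = (\<Prod>i<r. [:- (xs ! i), 1:])"
      by (simp add: prod.list_conv_set_nth r_def atLeast0LessThan)
    finally show ?thesis .
  qed
  have root: "ev_emb m (xs ! i) = 0" if "i < r" for i
    unfolding fac poly_prod using that by (intro prod_zero) auto
  have "\<forall>i. \<exists>L. i < r \<longrightarrow> Vector_Spaces.linear (\<lambda>a y. emb a * y) (\<lambda>a y. emb a * y) L \<and>
      (\<forall>p. L (ev_emb p t) = ev_emb p (xs ! i))"
    using exists_conjugation[OF m(1,2) min root] by metis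
  then obtain L where L: "\<And>i. i < r \<Longrightarrow> Vector_Spaces.linear (\<lambda>a y. emb a * y) (\<lambda>a y. emb a * y) (L i)"
      "\<And>i p. i < r \<Longrightarrow> L i (ev_emb p t) = ev_emb p (xs ! i)" by metis
  \<comment> \<open>\<open>Sp\<close> presents the elements of \<open>S\<close> that are polynomials
    in \<open>t\<close> over the fraction field; on these the maps \<open>L i\<close> act as
    conjugations.\<close>
  define Sp where "Sp = {p. ev_emb p t \<in> S}"
  have Sp: "subr Sp"
    unfolding subr_def Sp_def using S(1) by (auto simp: ev_emb_simps intro: subr_intros)
  have Lspan: "ev_emb p (xs ! i) \<in> mod_span (base d) (L i ` G)" if p: "p \<in> Sp" and i: "i < r" for p i
  proof -
    interpret Li: Vector_Spaces.linear "\<lambda>a y. emb a * y" "\<lambda>a y. emb a * y" "L i" by (rule L(1)[OF i])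
    have "mod_span (base d) G \<subseteq> {y. L i y \<in> mod_span (base d) (L i ` G)}"
    proof (rule mod_span_subset[OF subr_base])
      fix b y assume "b \<in> base d" and y: "y \<in> {y. L i y \<in> mod_span (base d) (L i ` G)}"
      then obtain c where c: "b = emb (of_mpoly c)" "b \<in> base d" by (auto simp: base_def \<iota>_def)
      then show "b * y \<in> {y. L i y \<in> mod_span (base d) (L i ` G)}"
        using y mod_span_smult[OF subr_base c(2)] by (simp add: Li.scale)
    qed (use G subr_base in \<open>auto intro: mod_span_base mod_span_add mod_span_0 simp: Li.add Li.zero\<close>)
    then show ?thesis using p S(2) L(2)[OF i, of p] by (auto simp: Sp_def)
  qed
  obtain H where H: "finite H" "\<And>f. (\<And>i. i \<in> {..<r} \<Longrightarrow> f i \<in> mod_span (base d) (L i ` G)) \<Longrightarrow> (\<Prod>i\<in>{..<r}. f i) \<in> mod_span (base d) H"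
    using mod_span_prod[OF subr_base, of "{..<r}" "\<lambda>i. L i ` G" d] G by auto
  \<comment> \<open>Products with one conjugate for each root. They all lie in one finitely
    generated module, and their signed sums, collected in \<open>W\<close>, form a ring that
    contains all the conjugates at once.\<close>
  define W0 where "W0 = {\<Prod>i<r. ev_emb (p i) (xs ! i) | p. \<forall>i<r. p i \<in> Sp}"
  have W0_mult: "x * y \<in> W0" if "x \<in> W0" "y \<in> W0" for x y
  proof -
    from that obtain p q where "x = (\<Prod>i<r. ev_emb (p i) (xs ! i))" "y = (\<Prod>i<r. ev_emb (q i) (xs ! i))"
        "\<forall>i<r. p i \<in> Sp" "\<forall>i<r. q i \<in> Sp" by (auto simp: W0_def)
    then have "x * y = (\<Prod>i<r. ev_emb (p i * q i) (xs ! i))" "\<forall>i<r. p i * q i \<in> Sp"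
      by (auto simp: ev_emb_simps prod.distrib intro: subr_mult[OF Sp])
    then show ?thesis
      unfolding W0_def by (intro CollectI exI[of _ "\<lambda>i. p i * q i"] conjI)
  qed
  define W where "W = {\<Sum>j<(n::nat). c j * w j | n c w. \<forall>j<n. w j \<in> W0 \<and> c j \<in> {1, - 1 :: 'l}}"
  have W0W: "c * w \<in> W" if "w \<in> W0" "c \<in> {1, -1}" for c w
    unfolding W_def
    by (rule CollectI, rule exI[of _ 1], rule exI[of _ "\<lambda>_. c"], rule exI[of _ "\<lambda>_. w"]) (use that in simp)
  have W_add: "x + y \<in> W" if "x \<in> W" "y \<in> W" for x y
  proof -
    from that obtain n c w n' c' w' where *: "x = (\<Sum>j<(n::nat). c j * w j)" "y = (\<Sum>j<(n'::nat). c' j * w' j)"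
        "\<forall>j<n. w j \<in> W0 \<and> c j \<in> {1, - 1 :: 'l}" "\<forall>j<n'. w' j \<in> W0 \<and> c' j \<in> {1, - 1 :: 'l}"
      unfolding W_def by blast
    let ?c = "\<lambda>j. if j < n then c j else c' (j - n)" and ?w = "\<lambda>j. if j < n then w j else w' (j - n)"
    have "(\<Sum>j<n + n'. ?c j * ?w j) = x + y"
    proof -
      have split: "(\<Sum>j<n + k. f j) = (\<Sum>j<n. f j) + (\<Sum>j<k. f (n + j))" for f :: "nat \<Rightarrow> 'l" and k
        by (induction k) (simp_all add: add.assoc)
      show ?thesis unfolding * split by simp
    qed
    moreover have "\<forall>j<n + n'. ?w j \<in> W0 \<and> ?c j \<in> {1, - 1}"
      using *(3,4) by auto
    ultimately show ?thesis unfolding W_def by (intro CollectI exI conjI) (auto intro: sym)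
  qed
  have W_0: "0 \<in> W" unfolding W_def by (rule CollectI, rule exI[of _ 0]) simp
  have W_sum: "(\<Sum>j\<in>J. f j) \<in> W" if "\<And>j. j \<in> J \<Longrightarrow> f j \<in> W" for J and f :: "'z \<Rightarrow> 'l"
    using that by (induction J rule: infinite_finite_induct) (auto intro: W_0 W_add)
  have subrW: "subr W"
    unfolding subr_def
  proof (intro conjI ballI)
    have "1 \<in> W0" unfolding W0_def
      by (rule CollectI, rule exI[of _ "\<lambda>_. 1"]) (simp add: ev_emb_simps subr_1[OF Sp])
    then show "1 \<in> W" using W0W[of 1 1] by simp
    show "x + y \<in> W" if "x \<in> W" "y \<in> W" for x y using that by (rule W_add)
    show "- x \<in> W" if "x \<in> W" for x
    proof -
      from that obtain n c w where x: "x = (\<Sum>j<(n::nat). c j * w j)" "\<forall>j<n. w j \<in> W0 \<and> c j \<in> {1, - 1 :: 'l}"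
        unfolding W_def by blast
      then have "- x = (\<Sum>j<n. (- c j) * w j)" by (simp add: sum_negf)
      also have "\<dots> \<in> W" using x(2) by (intro W_sum W0W) auto
      finally show ?thesis .
    qed
    show "x * y \<in> W" if "x \<in> W" "y \<in> W" for x y
    proof -
      from that obtain n c w n' c' w' where *: "x = (\<Sum>j<(n::nat). c j * w j)" "y = (\<Sum>j<(n'::nat). c' j * w' j)"
          "\<forall>j<n. w j \<in> W0 \<and> c j \<in> {1, - 1 :: 'l}" "\<forall>j<n'. w' j \<in> W0 \<and> c' j \<in> {1, - 1 :: 'l}"
        unfolding W_def by blast
      have "x * y = (\<Sum>j<n. \<Sum>j'<n'. (c j * c' j') * (w j * w' j'))"
        unfolding * sum_product by (simp add: mult_ac)
      also have "\<dots> \<in> W" using *(3,4) by (intro W_sum W0W W0_mult) force+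
      finally show ?thesis .
    qed
  qed
  have W0H: "W0 \<subseteq> mod_span (base d) H"
    unfolding W0_def using Lspan by (auto intro!: H(2)[simplified])
  have WH: "W \<subseteq> mod_span (base d) H"
  proof
    fix x assume "x \<in> W"
    then obtain n c w where x: "x = (\<Sum>j<(n::nat). c j * w j)" "\<forall>j<n. w j \<in> W0 \<and> c j \<in> {1, - 1 :: 'l}"
      unfolding W_def by blast
    have "1 \<in> base d" "- 1 \<in> base d" using subr_base by (auto intro: subr_1 subr_minus)
    then show "x \<in> mod_span (base d) H" unfolding x(1)
      using x(2) W0H by (intro mod_span_sum[OF subr_base] mod_span_smult[OF subr_base]) auto
  qed
  have XSp: "[:0, 1:] \<in> Sp" using t by (simp add: Sp_def)
  have rootW: "xs ! i \<in> W" if i: "i < r" for i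
  proof -
    have "(\<Prod>j<r. ev_emb (if j = i then [:0, 1:] else 1) (xs ! j)) = (\<Prod>j<r. if j = i then xs ! j else 1)"
      by (intro prod.cong) (auto simp: ev_emb_simps)
    also have "\<dots> = xs ! i" using i by simp
    finally have "xs ! i \<in> W0"
      unfolding W0_def using XSp subr_1[OF Sp]
      by (intro CollectI exI[of _ "\<lambda>j. if j = i then [:0, 1:] else 1"]) auto
    then show ?thesis using W0W[of "xs ! i" 1] by simp
  qed
  \<comment> \<open>The coefficients of \<open>m\<close> are polynomials in its roots, so they lie
    in \<open>W\<close> as well as in the fraction field, and \<open>integral_in_base\<close>
    applies to them.\<close>
  have "map_poly emb m \<in> coeffs_in W"
    unfolding fac
  proof (rule subr_prod[OF subr_coeffs_in[OF subrW]])
    fix i assume "i \<in> {..<r}"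
    then have "- (xs ! i) \<in> W" using rootW subrW by (auto intro: subr_minus)
    then show "[:- (xs ! i), 1:] \<in> coeffs_in W"
      using subrW by (auto simp: coeffs_in_def coeff_pCons subr_1 subr_0 split: nat.splits)
  qed
  then have "\<exists>b. b \<in> polys {..<d} \<and> coeff m i = of_mpoly b" for i
    using integral_in_base[OF subrW WH H(1), of "coeff m i"]
    by (auto simp: coeffs_in_def coeff_map_poly emb_simps)
  then obtain b where b: "\<And>i. b i \<in> polys {..<d}" "\<And>i. coeff m i = of_mpoly (b i)" by metis
  show ?thesis
  \<comment> \<open>The constant coefficient of \<open>m\<close> is the product of the negated
    roots, and \<open>r\<close> is the degree of \<open>m\<close>.\<close>
  proof (rule that[of "b 0" r])
    show "b 0 \<in> polys {..<d}" by (rule b)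
    show "b 0 \<noteq> 0" using m0 b(2)[of 0] by auto
    obtain q where q: "m = pCons (coeff m 0) q" by (metis pCons_cases coeff_pCons_0)
    have coq: "coeff q i = of_mpoly (b (Suc i))" for i
      using b(2)[of "Suc i"] by (metis coeff_pCons_Suc q)
    have "0 = \<iota> (b 0) + t * ev_emb q t"
      using m(2) b(2)[of 0] by (subst (asm) q) (simp add: map_poly_pCons emb_simps \<iota>_def)
    moreover have "ev_emb q t \<in> S"
    proof (rule poly_in_subr[OF S(1) _ t(1)])
      show "map_poly emb q \<in> coeffs_in S"
        using baseS b(1) by (auto simp: coeffs_in_def coeff_map_poly emb_simps coq base_def \<iota>_def)
    qed
    ultimately have "\<iota> (b 0) = t * (- ev_emb q t)" "- ev_emb q t \<in> S"
      by (auto simp: eq_neg_iff_add_eq_0 intro: subr_minus[OF S(1)])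
    then show "\<exists>s\<in>S. \<iota> (b 0) = t * s" by blast
    have b0: "\<iota> (b 0) = (\<Prod>i<r. - (xs ! i))"
    proof -
      have "\<iota> (b 0) = poly (map_poly emb m) 0"
        by (simp add: poly_0_coeff_0 coeff_map_poly emb_simps b(2) \<iota>_def)
      also have "\<dots> = (\<Prod>i<r. - (xs ! i))" unfolding fac poly_prod by simp
      finally show ?thesis .
    qed
    fix f s assume f: "f \<in> polys {..<d}" and s: "s \<in> S" "\<iota> f = t * s"
    \<comment> \<open>\<open>s = f / t\<close> lies in \<open>F(t)\<close>: as a polynomial in \<open>t\<close> it is \<open>- (f / b\<^sub>0) q(t)\<close>.\<close>
    define h where "h = [:- of_mpoly f / of_mpoly (b 0):] * q"
    have hX: "ev_emb h x * x = \<iota> f" if "ev_emb m x = 0" for x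
    proof -
      have "x * ev_emb q x = - \<iota> (b 0)"
        using that b(2)[of 0] by (subst (asm) q) (simp add: map_poly_pCons emb_simps \<iota>_def eq_neg_iff_add_eq_0 add.commute)
      moreover have "ev_emb h x * x = emb (- of_mpoly f / of_mpoly (b 0)) * (x * ev_emb q x)"
        unfolding h_def by (simp only: rhom_mult[OF rhom_ev_emb] ev_emb_const mult_ac)
      moreover have "emb (- of_mpoly f / of_mpoly (b 0)) * \<iota> (b 0) = - \<iota> f"
        using \<open>b 0 \<noteq> 0\<close> by (simp add: \<iota>_def emb_simps flip: emb_simps(4))
      ultimately show ?thesis by simp
    qed
    have "ev_emb h t = s" using hX[OF m(2)] s(2) t(2) by (simp add: mult.commute)
    then have hSp: "h \<in> Sp" using s by (simp add: Sp_def)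
    \<comment> \<open>\<open>u\<close> is the norm of \<open>s = f / t\<close>. It lies in
      \<open>W\<close> and in the fraction field, hence in the base ring, and
      \<open>u * \<iota> (b 0)\<close> is the norm of \<open>f\<close> up to sign.\<close>
    define u where "u = (\<Prod>i<r. ev_emb h (xs ! i))"
    have "u \<in> W" using W0W[of u 1] hSp unfolding W0_def u_def by force
    have "u * \<iota> (b 0) = (\<Prod>i<r. - \<iota> f)"
      unfolding u_def b0 prod.distrib[symmetric] using hX root by (intro prod.cong) auto
    then have uf: "u * \<iota> (b 0) = (- \<iota> f) ^ r" by simp
    then have "u = emb ((- of_mpoly f) ^ r / of_mpoly (b 0))"
    proof -
      have "emb ((- of_mpoly f) ^ r / of_mpoly (b 0)) * \<iota> (b 0) = (- \<iota> f) ^ r"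
        using \<open>b 0 \<noteq> 0\<close> by (simp add: \<iota>_def emb_simps flip: emb_simps(4))
      then show ?thesis using uf \<open>b 0 \<noteq> 0\<close> by (metis \<iota>_eq_0_iff mult_right_cancel)
    qed
    then obtain c where c: "u = \<iota> c"
      using integral_in_base[OF subrW WH H(1)] \<open>u \<in> W\<close> unfolding \<iota>_def by metis
    have "\<iota> (c * b 0) = \<iota> ((- f) ^ r)" using uf unfolding c by (simp add: \<iota>_simps)
    then have "c * b 0 = (- f) ^ r" by simp
    then have "b 0 dvd (- f) ^ r" by (metis dvd_triv_right)
    also have "(- f) ^ r dvd f ^ r"
      by (intro dvd_power_same) simp
    finally show "b 0 dvd f ^ r" .
  qed
qed

end


section \<open>Bounding the number of algebraically independent elements\<close>

definition box :: "nat set \<Rightarrow> nat \<Rightarrow> (nat \<Rightarrow>\<^sub>0 nat) set" where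
  "box A D = {m. Poly_Mapping.keys m \<subseteq> A \<and> (\<forall>i. Poly_Mapping.lookup m i \<le> D)}"

lemma
  assumes "finite A"
  shows finite_box: "finite (box A D)" and card_box: "card (box A D) = (D + 1) ^ card A"
proof -
  let ?h = "\<lambda>h. \<Sum>j\<in>A. Poly_Mapping.single j (h j :: nat)"
  have lk: "Poly_Mapping.lookup (?h h) i = (if i \<in> A then h i else 0)" for h i
    using assms by (simp add: lookup_sum lookup_single when_def)
  have img: "?h ` PiE A (\<lambda>_. {..D}) = box A D"
  proof
    show "?h ` PiE A (\<lambda>_. {..D}) \<subseteq> box A D"
    proof clarify
      fix h assume "h \<in> PiE A (\<lambda>_. {..D})"
      then show "?h h \<in> box A D"
        unfolding box_def by (auto simp: lk in_keys_iff PiE_iff simp del: lookup_sum split: if_splits)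
    qed
    show "box A D \<subseteq> ?h ` PiE A (\<lambda>_. {..D})"
    proof
      fix m assume m: "m \<in> box A D"
      have "m = ?h (restrict (Poly_Mapping.lookup m) A)"
        by (rule poly_mapping_eqI) (use m in \<open>auto simp: lk box_def in_keys_iff\<close>)
      moreover have "restrict (Poly_Mapping.lookup m) A \<in> PiE A (\<lambda>_. {..D})"
        using m by (auto simp: box_def)
      ultimately show "m \<in> ?h ` PiE A (\<lambda>_. {..D})" by blast
    qed
  qed
  have inj: "inj_on ?h (PiE A (\<lambda>_. {..D}))"
  proof (rule inj_onI)
    fix h h' assume *: "h \<in> PiE A (\<lambda>_. {..D})" "h' \<in> PiE A (\<lambda>_. {..D})" "?h h = ?h h'"
    show "h = h'"
    proof (rule PiE_ext[OF *(1,2)])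
      fix i assume "i \<in> A"
      then show "h i = h' i" using lk[of h i] lk[of h' i] *(3) by simp
    qed
  qed
  have fin: "finite (PiE A (\<lambda>_. {..D}))" using assms by (intro finite_PiE) auto
  show "finite (box A D)" unfolding img[symmetric] using fin by simp
  show "card (box A D) = (D + 1) ^ card A"
    unfolding img[symmetric] card_image[OF inj] using assms by (simp add: card_PiE)
qed

lemma power_growth:
  assumes "\<And>s::nat. (s + 1) ^ m \<le> A * (B * s + 1) ^ e"
  shows "m \<le> e"
proof (rule ccontr)
  assume "\<not> m \<le> e"
  \<comment> \<open>This value turns the bound into \<open>(s + 1) * X \<le> s * X\<close> with
    \<open>X = (s + 1) ^ e\<close>.\<close>
  define s where "s = A * (B + 1) ^ e"
  have "(s + 1) * (s + 1) ^ e = (s + 1) ^ Suc e" by simp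
  also have "\<dots> \<le> (s + 1) ^ m" using \<open>\<not> m \<le> e\<close> by (intro power_increasing) auto
  also have "\<dots> \<le> A * (B * s + 1) ^ e" by (rule assms)
  also have "\<dots> \<le> A * ((B + 1) * (s + 1)) ^ e"
    by (intro mult_le_mono power_mono) (auto simp: algebra_simps)
  also have "\<dots> = s * (s + 1) ^ e" by (simp only: s_def power_mult_distrib mult_ac)
  finally show False by simp
qed

text \<open>A growth count takes the place of an exchange argument. Products of elements of
  \<open>G\<close> with monomials in \<open>u\<close> of exponents at most \<open>D\<close> span a
  space whose dimension is bounded by a multiple of \<open>(D + 1) ^ card U\<close>. After
  multiplication by a fixed \<open>e\<close>, each \<open>f j\<close> raises \<open>D\<close> by a
  bounded amount only, so the \<open>(s + 1) ^ card J\<close> independent monomials in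
  \<open>f\<close> with exponents at most \<open>s\<close> fit into a space with \<open>D\<close>
  linear in \<open>s\<close>.\<close>

theorem alg_independent_card_le:
  fixes \<kappa> :: "'k::field \<Rightarrow> 'l::field" and u f x :: "nat \<Rightarrow> 'l"
  assumes \<kappa>: "rhom \<kappa>" and U: "finite U" and J: "finite J" and I: "finite I" and G: "finite G"
    and g0: "g0 \<in> G" "g0 \<noteq> 0"
    and c: "c \<in> ev \<kappa> u ` polys U" "c \<noteq> 0"
    and xG: "\<And>i g. i \<in> I \<Longrightarrow> g \<in> G \<Longrightarrow> c * x i * g \<in> mod_span (ev \<kappa> u ` polys U) G"
    and b: "b \<in> ev \<kappa> x ` polys I" "b \<noteq> 0"
    and f: "\<And>j. j \<in> J \<Longrightarrow> b * f j \<in> ev \<kappa> x ` polys I"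
    and indep: "\<And>F. F \<in> polys J \<Longrightarrow> ev \<kappa> f F = 0 \<Longrightarrow> F = 0"
  shows "card J \<le> card U"
proof -
  interpret vector_space "\<lambda>a y. \<kappa> a * y"
    by unfold_locales (simp_all add: rhom_simps[OF \<kappa>] algebra_simps)
  let ?K = "ev \<kappa> u ` polys U"
  define M where "M D = (\<lambda>(g, m). g * monom_val u m) ` (G \<times> box U D)" for D
  define V where "V D = span (M D)" for D
  have finM: "finite (M D)" for D using G finite_box[OF U] by (simp add: M_def)
  have cardM: "card (M D) \<le> card G * (D + 1) ^ card U" for D
    unfolding M_def using card_image_le[of "G \<times> box U D"] G finite_box[OF U] card_box[OF U]
    by (metis card_cartesian_product finite_cartesian_product)
  have V_mono: "V D \<subseteq> V D'" if "D \<le> D'" for D D'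
    unfolding V_def M_def using that by (intro span_mono image_mono) (auto simp: box_def intro: le_trans)
  have V_add: "y + z \<in> V D" if "y \<in> V D" "z \<in> V D" for y z D using that by (simp add: V_def span_add)
  have V_0: "0 \<in> V D" for D by (simp add: V_def span_zero)
  have V_scale: "\<kappa> a * y \<in> V D" if "y \<in> V D" for a y D using that by (simp add: V_def span_scale)
  have V_map: "a * y \<in> V D'" if y: "y \<in> V D" and h: "\<And>g m. g \<in> G \<Longrightarrow> m \<in> box U D \<Longrightarrow> a * (g * monom_val u m) \<in> V D'" for a y D D'
  proof -
    from y have "y \<in> span (M D)" by (simp add: V_def)
    then show ?thesis
    proof (induction rule: span_induct_alt)
      case base then show ?case by (simp add: V_0)
    next
      case (step r z y)
      then obtain g m where "g \<in> G" "m \<in> box U D" "z = g * monom_val u m" by (auto simp: M_def)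
      then have "\<kappa> r * (a * z) \<in> V D'" using h by (intro V_scale) auto
      then show ?case using step V_add[of "\<kappa> r * (a * z)" D' "a * y"] by (simp add: algebra_simps)
    qed
  qed
  \<comment> \<open>The multipliers that raise the filtration index by a bounded amount; they form a
    subring.\<close>
  define T where "T = {a. \<exists>C. \<forall>D. \<forall>y\<in>V D. a * y \<in> V (D + C)}"
  have subrT: "subr T"
    unfolding subr_def
  proof (intro conjI ballI)
    show "1 \<in> T" unfolding T_def by (intro CollectI exI[of _ 0]) simp
    show "- a \<in> T" if "a \<in> T" for a
    proof -
      from that obtain C where "\<forall>D. \<forall>y\<in>V D. a * y \<in> V (D + C)" by (auto simp: T_def)
      then have "\<forall>D. \<forall>y\<in>V D. - a * y \<in> V (D + C)" by (auto simp: V_def intro: span_neg)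
      then show ?thesis by (auto simp: T_def)
    qed
    fix a a' assume "a \<in> T" "a' \<in> T"
    then obtain C C' where "\<forall>D. \<forall>y\<in>V D. a * y \<in> V (D + C)" "\<forall>D. \<forall>y\<in>V D. a' * y \<in> V (D + C')"
      unfolding T_def by blast
    then have C: "\<And>D y. y \<in> V D \<Longrightarrow> a * y \<in> V (D + C)" "\<And>D y. y \<in> V D \<Longrightarrow> a' * y \<in> V (D + C')"
      by blast+
    have "(a + a') * y \<in> V (D + (C + C'))" if "y \<in> V D" for D y
      using C[OF that] V_mono[of "D + C" "D + (C + C')"] V_mono[of "D + C'" "D + (C + C')"]
      by (auto simp: distrib_right intro!: V_add)
    then show "a + a' \<in> T" by (auto simp: T_def)
    have "(a * a') * y \<in> V (D + (C' + C))" if "y \<in> V D" for D y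
      using C(1)[OF C(2)[OF that]] by (simp add: mult.assoc add.assoc)
    then show "a * a' \<in> T" unfolding T_def by blast
  qed
  have \<kappa>T: "\<kappa> a \<in> T" for a unfolding T_def using V_scale by (intro CollectI exI[of _ 0]) auto
  have uT: "u i \<in> T" if i: "i \<in> U" for i
  proof -
    have "u i * y \<in> V (D + 1)" if "y \<in> V D" for D y
    proof (rule V_map[OF that])
      fix g m assume gm: "g \<in> G" "m \<in> box U D"
      have "u i * (g * monom_val u m) = g * monom_val u (m + Poly_Mapping.single i 1)"
        by (simp add: monom_val_add)
      moreover have "m + Poly_Mapping.single i 1 \<in> box U (D + 1)"
        using gm(2) i
        by (auto simp: box_def keys_add_nat lookup_add lookup_single when_def le_SucI split: if_splits)
      ultimately show "u i * (g * monom_val u m) \<in> V (D + 1)"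
        unfolding V_def M_def using gm(1)
        by (intro span_base image_eqI[of _ _ "(g, m + Poly_Mapping.single i 1)"]) auto
    qed
    then show ?thesis unfolding T_def by blast
  qed
  have KT: "?K \<subseteq> T" by (auto intro!: ev_in_subr[OF \<kappa> subrT \<kappa>T] uT)
  have xT: "c * x i \<in> T" if i: "i \<in> I" for i
  proof -
    have "\<exists>k. (c * x i * g = (\<Sum>h\<in>G. k h * h)) \<and> (\<forall>h\<in>G. k h \<in> ?K)" if "g \<in> G" for g
      using xG[OF i that] unfolding mod_span_def by blast
    then obtain k where k: "\<And>g. g \<in> G \<Longrightarrow> c * x i * g = (\<Sum>h\<in>G. k g h * h)" "\<And>g h. g \<in> G \<Longrightarrow> h \<in> G \<Longrightarrow> k g h \<in> ?K"
      by metis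
    have "\<forall>g h. \<exists>C. g \<in> G \<longrightarrow> h \<in> G \<longrightarrow> (\<forall>D. \<forall>y\<in>V D. k g h * y \<in> V (D + C))"
      using k(2) KT unfolding T_def by blast
    then obtain C where C: "\<And>g h D y. g \<in> G \<Longrightarrow> h \<in> G \<Longrightarrow> y \<in> V D \<Longrightarrow> k g h * y \<in> V (D + C g h)"
      by metis
    define C0 where "C0 = (\<Sum>g\<in>G. \<Sum>h\<in>G. C g h)"
    have C0: "C g h \<le> C0" if "g \<in> G" "h \<in> G" for g h
    proof -
      have "C g h \<le> (\<Sum>h\<in>G. C g h)" using G that by (intro member_le_sum) auto
      also have "\<dots> \<le> C0" unfolding C0_def using G that by (intro member_le_sum) auto
      finally show ?thesis .
    qed
    have "(c * x i) * y \<in> V (D + C0)" if "y \<in> V D" for D y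
    proof (rule V_map[OF that])
      fix g m assume gm: "g \<in> G" "m \<in> box U D"
      have "c * x i * (g * monom_val u m) = (c * x i * g) * monom_val u m" by simp
      also have "\<dots> = (\<Sum>h\<in>G. k g h * (h * monom_val u m))"
        unfolding k(1)[OF gm(1)] by (simp add: sum_distrib_right mult.assoc)
      also have "\<dots> \<in> V (D + C0)"
        unfolding V_def
      proof (rule span_sum)
        fix h assume "h \<in> G"
        have "h * monom_val u m \<in> V D"
          unfolding V_def M_def using gm(2) \<open>h \<in> G\<close> by (auto intro!: span_base)
        then show "k g h * (h * monom_val u m) \<in> span (M (D + C0))"
          using C[OF gm(1) \<open>h \<in> G\<close>] C0[OF gm(1) \<open>h \<in> G\<close>] V_mono unfolding V_def by (meson add_left_mono subsetD)
      qed
      finally show "c * x i * (g * monom_val u m) \<in> V (D + C0)" .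
    qed
    then show ?thesis unfolding T_def by blast
  qed
  have cT: "c \<in> T" using c KT by blast
  \<comment> \<open>Only \<open>c * x i\<close> is known to lie in \<open>T\<close>, so polynomials
    in the \<open>x i\<close> lie there after multiplication by a power of \<open>c\<close>.\<close>
  define T' where "T' = {p. \<exists>N. c ^ N * p \<in> T}"
  have T'I: "c ^ N' * p \<in> T" if "c ^ N * p \<in> T" "N \<le> N'" for N N' p
  proof -
    have "c ^ (N' - N) * (c ^ N * p) \<in> T"
      using subr_mult[OF subrT subr_power[OF subrT cT] that(1)] .
    then show ?thesis using that(2) by (simp flip: mult.assoc power_add)
  qed
  have subrT': "subr T'"
    unfolding subr_def
  proof (intro conjI ballI)
    show "1 \<in> T'" unfolding T'_def using subr_1[OF subrT] by (intro CollectI exI[of _ 0]) simp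
    show "- p \<in> T'" if p: "p \<in> T'" for p
    proof -
      obtain N where "c ^ N * p \<in> T" using p by (auto simp: T'_def)
      then have "c ^ N * - p \<in> T" using subr_minus[OF subrT] by fastforce
      then show ?thesis unfolding T'_def by blast
    qed
    fix p q assume "p \<in> T'" "q \<in> T'"
    then obtain N N' where N: "c ^ N * p \<in> T" "c ^ N' * q \<in> T" by (auto simp: T'_def)
    have "c ^ (N + N') * (p + q) \<in> T"
      using T'I[OF N(1), of "N + N'"] T'I[OF N(2), of "N + N'"] by (auto simp: distrib_left intro!: subr_add[OF subrT])
    then show "p + q \<in> T'" by (auto simp: T'_def)
    have "c ^ (N + N') * (p * q) \<in> T"
      using subr_mult[OF subrT N] by (simp add: power_add mult_ac)
    then show "p * q \<in> T'" by (auto simp: T'_def)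
  qed
  have evT': "ev \<kappa> x ` polys I \<subseteq> T'"
  proof -
    have "\<kappa> a \<in> T'" for a unfolding T'_def using \<kappa>T by (intro CollectI exI[of _ 0]) simp
    moreover have "x i \<in> T'" if "i \<in> I" for i unfolding T'_def using xT[OF that] by (intro CollectI exI[of _ 1]) simp
    ultimately show ?thesis by (auto intro!: ev_in_subr[OF \<kappa> subrT'])
  qed
  have "\<forall>j. \<exists>N. j \<in> J \<longrightarrow> c ^ N * (b * f j) \<in> T" using f evT' by (auto simp: T'_def)
  then obtain Nj where Nj: "\<And>j. j \<in> J \<Longrightarrow> c ^ Nj j * (b * f j) \<in> T" by metis
  obtain Nb where Nb: "c ^ Nb * b \<in> T" using b(1) evT' by (auto simp: T'_def)
  define N where "N = Nb + (\<Sum>j\<in>J. Nj j)"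
  \<comment> \<open>\<open>b\<close> clears the denominators of the \<open>f j\<close>, and
    \<open>c ^ N\<close> moves \<open>b\<close> and all \<open>b * f j\<close> into
    \<open>T\<close>.\<close>
  define e where "e = c ^ N * b"
  have eT: "e \<in> T" unfolding e_def by (rule T'I[OF Nb]) (simp add: N_def)
  have efT: "e * f j \<in> T" if "j \<in> J" for j
  proof -
    have "Nj j \<le> N" unfolding N_def using member_le_sum[OF that, of Nj] J by simp
    then show ?thesis using T'I[OF Nj[OF that]] by (simp add: e_def mult.assoc)
  qed
  have e0: "e \<noteq> 0" using b(2) c(2) by (simp add: e_def)
  have "\<forall>j. \<exists>C. j \<in> J \<longrightarrow> (\<forall>D. \<forall>y\<in>V D. e * f j * y \<in> V (D + C))"
    using efT by (auto simp: T_def)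
  then obtain Cj where Cj: "\<And>j D y. j \<in> J \<Longrightarrow> y \<in> V D \<Longrightarrow> e * f j * y \<in> V (D + Cj j)" by metis
  obtain Ce where "\<forall>D. \<forall>y\<in>V D. e * y \<in> V (D + Ce)" using eT unfolding T_def by blast
  then have Ce: "\<And>D y. y \<in> V D \<Longrightarrow> e * y \<in> V (D + Ce)" by blast
  define C where "C = Ce + (\<Sum>j\<in>J. Cj j)"
  have C1: "e * y \<in> V (D + C)" if "y \<in> V D" for y D
    using Ce[OF that] V_mono[of "D + Ce" "D + C"] by (auto simp: C_def)
  have C2: "e * f j * y \<in> V (D + C)" if "j \<in> J" "y \<in> V D" for j y D
  proof -
    have "Cj j \<le> C" unfolding C_def using member_le_sum[OF that(1), of Cj] J by simp
    then show ?thesis using Cj[OF that] V_mono[of "D + Cj j" "D + C"] by auto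
  qed
  have pw: "a ^ n * y \<in> V (D + n * C)" if "\<And>y D. y \<in> V D \<Longrightarrow> a * y \<in> V (D + C)" "y \<in> V D" for a n y D
    using that(2)
  proof (induction n arbitrary: D y)
    case (Suc n)
    from Suc.IH[OF that(1)[OF Suc.prems]] show ?case by (simp add: mult_ac add_ac)
  qed simp
  have main: "(s + 1) ^ card J \<le> card G * (card J * C * s + 1) ^ card U" for s
  proof -
    \<comment> \<open>Each \<open>j\<close> in \<open>J\<close> receives \<open>s\<close> of the
      factors \<open>e\<close>: as many as the exponent of \<open>j\<close> are absorbed into powers
      of \<open>e * f j\<close>, the others remain powers of \<open>e\<close>. Each of these
      \<open>s * card J\<close> factors raises the index by \<open>C\<close>, starting from
      \<open>g0\<close> at index zero.\<close>
    define w where "w m = e ^ (s * card J) * monom_val f m * g0" for m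
    have wV: "w m \<in> V (card J * C * s)" if m: "m \<in> box J s" for m
    proof -
      have mk: "Poly_Mapping.keys m \<subseteq> J" "Poly_Mapping.lookup m j \<le> s" for j using m by (auto simp: box_def)
      have step: "(\<Prod>j\<in>J'. (e * f j) ^ Poly_Mapping.lookup m j * e ^ (s - Poly_Mapping.lookup m j)) * g0 \<in> V (card J' * (s * C))"
        if "J' \<subseteq> J" for J'
        using finite_subset[OF that J] that
      proof (induction J')
        case empty
        have "g0 * monom_val u 0 \<in> M 0" 
          unfolding M_def using g0(1) by (intro image_eqI[of _ _ "(g0, 0)"]) (auto simp: box_def)
        then show ?case by (simp add: V_def span_base)
      next
        case (insert j J')
        let ?m = "Poly_Mapping.lookup m j"
        have "(e * f j) ^ ?m * (e ^ (s - ?m) * ((\<Prod>j\<in>J'. (e * f j) ^ Poly_Mapping.lookup m j * e ^ (s - Poly_Mapping.lookup m j)) * g0)) \<in> V (card J' * (s * C) + (s - ?m) * C + ?m * C)"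
          using insert by (intro pw C1 C2) auto
        moreover have "card J' * (s * C) + (s - ?m) * C + ?m * C = card (insert j J') * (s * C)"
        proof -
          have "(s - ?m) * C + ?m * C = s * C" using mk(2)[of j] by (simp flip: distrib_right)
          then show ?thesis using insert(1,2) by simp
        qed
        ultimately show ?case by (simp only: prod.insert[OF insert(1,2)] mult.assoc)
      qed
      have "(\<Prod>j\<in>J. (e * f j) ^ Poly_Mapping.lookup m j * e ^ (s - Poly_Mapping.lookup m j)) =
          (\<Prod>j\<in>J. e ^ s * f j ^ Poly_Mapping.lookup m j)"
      proof (rule prod.cong[OF refl])
        fix j assume "j \<in> J"
        have "e ^ Poly_Mapping.lookup m j * e ^ (s - Poly_Mapping.lookup m j) = e ^ s"
          using mk(2)[of j] by (simp flip: power_add)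
        then show "(e * f j) ^ Poly_Mapping.lookup m j * e ^ (s - Poly_Mapping.lookup m j) = e ^ s * f j ^ Poly_Mapping.lookup m j"
          by (metis (no_types, lifting) mult.assoc mult.commute power_mult_distrib)
      qed
      also have "\<dots> = e ^ (s * card J) * monom_val f m"
        by (simp add: prod.distrib power_mult monom_val_superset[OF J mk(1)])
      finally show ?thesis using step[OF order_refl] by (simp add: w_def mult_ac)
    qed
    have zero: "\<forall>m\<in>box J s. a m = 0" if "(\<Sum>m\<in>box J s. \<kappa> (a m) * w m) = 0" for a
    proof -
      let ?F = "\<Sum>m\<in>box J s. Poly_Mapping.single m (a m)"
      have "(\<Sum>m\<in>box J s. \<kappa> (a m) * w m) = e ^ (s * card J) * g0 * ev \<kappa> f ?F"
        by (simp add: w_def ev_sum[OF \<kappa>] ev_single rhom_0[OF \<kappa>] sum_distrib_left mult_ac)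
      then have "ev \<kappa> f ?F = 0" using that e0 g0 by simp
      moreover have "?F \<in> polys J"
        by (rule subr_sum[OF subr_polys]) (auto simp: polys_def box_def)
      ultimately have "?F = 0" using indep by blast
      have "a m = 0" if "m \<in> box J s" for m
      proof -
        have "Poly_Mapping.lookup ?F m = a m"
          using that finite_box[OF J] by (simp add: lookup_sum lookup_single when_def)
        then show ?thesis unfolding \<open>?F = 0\<close> by simp
      qed
      then show ?thesis by blast
    qed
    have injw: "inj_on w (box J s)"
    proof (rule inj_onI)
      fix m m' assume mm: "m \<in> box J s" "m' \<in> box J s" "w m = w m'"
      show "m = m'"
      proof (rule ccontr)
        assume ne: "m \<noteq> m'"
        let ?a = "\<lambda>k. if k = m then 1 else if k = m' then - 1 else 0"
        have "(\<Sum>k\<in>box J s. \<kappa> (?a k) * w k) = (\<Sum>k\<in>{m, m'}. \<kappa> (?a k) * w k)"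
          using mm finite_box[OF J] by (intro sum.mono_neutral_right) (auto simp: rhom_simps[OF \<kappa>])
        also have "\<dots> = 0" using ne mm(3) by (simp add: rhom_simps[OF \<kappa>])
        finally show False using zero[of ?a] mm(1) by fastforce
      qed
    qed
    have "independent (w ` box J s)"
    proof (rule independent_if_scalars_zero)
      show "finite (w ` box J s)" using finite_box[OF J] by simp
      fix a y assume "(\<Sum>y\<in>w ` box J s. \<kappa> (a y) * y) = 0" "y \<in> w ` box J s"
      then show "a y = 0" using zero[of "\<lambda>m. a (w m)"] by (auto simp: sum.reindex[OF injw])
    qed
    moreover have "w ` box J s \<subseteq> span (M (card J * C * s))" using wV by (auto simp: V_def)
    ultimately have "card (w ` box J s) \<le> card (M (card J * C * s))"
      using independent_span_bound[OF finM] by blast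
    then show ?thesis using cardM[of "card J * C * s"] by (simp add: card_image[OF injw] card_box[OF J])
  qed
  then show ?thesis by (rule power_growth)
qed

text \<open>Clearing denominators makes the products of bounded powers of the \<open>x\<^sub>i\<close> a module over the
  polynomials in \<open>u\<close> as required by the previous theorem.\<close>
corollary alg_independent_card_le_algebraic:
  fixes \<kappa> :: "'k::field \<Rightarrow> 'l::field" and u f x :: "nat \<Rightarrow> 'l"
  assumes \<kappa>: "rhom \<kappa>" and U: "finite U" and J: "finite J" and I: "finite I"
    and alg: "\<And>i. i \<in> I \<Longrightarrow> \<exists>q. q \<noteq> 0 \<and> q \<in> coeffs_in (ev \<kappa> u ` polys U) \<and> poly q (x i) = 0"
    and b: "b \<in> ev \<kappa> x ` polys I" "b \<noteq> 0"
    and f: "\<And>j. j \<in> J \<Longrightarrow> b * f j \<in> ev \<kappa> x ` polys I"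
    and indep: "\<And>F. F \<in> polys J \<Longrightarrow> ev \<kappa> f F = 0 \<Longrightarrow> F = 0"
  shows "card J \<le> card U"
proof -
  let ?K = "ev \<kappa> u ` polys U"
  have K: "subr ?K" by (rule subr_image[OF rhom_ev[OF \<kappa>] subr_polys])
  obtain q where q: "\<And>i. i \<in> I \<Longrightarrow> q i \<noteq> 0 \<and> q i \<in> coeffs_in ?K \<and> poly (q i) (x i) = 0"
    using alg by metis
  \<comment> \<open>Having every leading coefficient as a factor, \<open>c\<close> makes each
    equation \<open>q i\<close> solvable for its highest power of \<open>x i\<close>.\<close>
  define c where "c = (\<Prod>i\<in>I. lead_coeff (q i))"
  have cK: "c \<in> ?K" unfolding c_def using q by (intro subr_prod[OF K]) (auto simp: coeffs_in_def)
  have c0: "c \<noteq> 0" unfolding c_def using q I by auto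
  define N where "N = Suc (\<Sum>i\<in>I. degree (q i))"
  have N: "degree (q i) < N" if "i \<in> I" for i
    unfolding N_def using member_le_sum[OF that, of "\<lambda>i. degree (q i)"] I by simp
  define G where "G = monom_val x ` box I (N - 1)"
  have finG: "finite G" unfolding G_def using finite_box[OF I] by simp
  have oneG: "1 \<in> G" unfolding G_def by (rule image_eqI[of _ _ 0]) (auto simp: box_def)
  show ?thesis
  proof (rule alg_independent_card_le[OF \<kappa> U J I finG oneG _ cK c0 _ b f indep])
    fix i g assume i: "i \<in> I" and "g \<in> G"
    then obtain m where m: "m \<in> box I (N - 1)" "g = monom_val x m" by (auto simp: G_def)
    let ?k = "Poly_Mapping.lookup m i"
    define m0 where "m0 = m - Poly_Mapping.single i ?k"
    have m0: "m = m0 + Poly_Mapping.single i ?k"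
      by (rule poly_mapping_eqI) (simp add: m0_def lookup_add lookup_minus lookup_single when_def)
    have low: "monom_val x m0 * x i ^ j \<in> G" if "j < N" for j
    proof -
      have "Poly_Mapping.lookup (m0 + Poly_Mapping.single i j) l = (if l = i then j else Poly_Mapping.lookup m l)" for l
        by (simp add: m0_def lookup_add lookup_minus lookup_single when_def)
      moreover have "l \<in> I" if "Poly_Mapping.lookup m l \<noteq> 0" for l
        using that m(1) unfolding box_def by (metis (no_types, lifting) in_keys_iff mem_Collect_eq subsetD)
      ultimately have "m0 + Poly_Mapping.single i j \<in> box I (N - 1)"
        using m(1) that i by (auto simp: box_def in_keys_iff split: if_splits)
      then show ?thesis unfolding G_def by (intro image_eqI[of _ _ "m0 + Poly_Mapping.single i j"]) (simp_all add: monom_val_add)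
    qed
    have g: "x i * g = monom_val x m0 * x i ^ Suc ?k"
      unfolding m(2) by (subst m0) (simp add: monom_val_add mult_ac)
    show "c * x i * g \<in> mod_span ?K G"
    proof (cases "Suc ?k < N")
      case True
      then have "c * (x i * g) \<in> mod_span ?K G"
        unfolding g by (intro mod_span_smult[OF K cK] mod_span_base[OF K finG] low)
      then show ?thesis by (simp add: mult.assoc)
    next
      case False
      \<comment> \<open>The exponent of \<open>x i\<close> has just reached \<open>N\<close>. The
        equation replaces \<open>degree (q i)\<close> of these factors by lower powers, which brings
        the exponent below \<open>N\<close> again.\<close>
      then have sk: "Suc ?k = N" using m(1) by (simp add: box_def N_def) (metis Suc_leI le_antisym le_imp_less_Suc not_less)
      let ?d = "degree (q i)"
      have "0 = poly (q i) (x i)" using q[OF i] by simp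
      also have "\<dots> = (\<Sum>j<?d. coeff (q i) j * x i ^ j) + lead_coeff (q i) * x i ^ ?d"
        by (simp add: poly_altdef lessThan_Suc_atMost[symmetric])
      finally have lead: "lead_coeff (q i) * x i ^ ?d = - (\<Sum>j<?d. coeff (q i) j * x i ^ j)"
        by (simp add: eq_neg_iff_add_eq_0 add.commute)
      define c' where "c' = (\<Prod>i'\<in>I - {i}. lead_coeff (q i'))"
      have c': "c = c' * lead_coeff (q i)" unfolding c_def c'_def using I i by (simp add: prod.remove mult.commute)
      have c'K: "c' \<in> ?K" unfolding c'_def using q by (intro subr_prod[OF K]) (auto simp: coeffs_in_def)
      have "c * (x i * g) = c' * monom_val x m0 * x i ^ (N - ?d) * (lead_coeff (q i) * x i ^ ?d)"
      proof -
        have "x i * g = monom_val x m0 * (x i ^ (N - ?d) * x i ^ ?d)"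
          using N[OF i] by (simp add: g sk flip: power_add del: power_Suc)
        then show ?thesis unfolding c' by (simp only: mult_ac)
      qed
      also have "\<dots> = (\<Sum>j<?d. - (c' * coeff (q i) j) * (monom_val x m0 * x i ^ (N - ?d + j)))"
        unfolding lead by (simp add: sum_distrib_left power_add mult_ac sum_negf)
      also have "\<dots> \<in> mod_span ?K G"
        using N[OF i] q[OF i] c'K
        by (intro mod_span_sum[OF K] mod_span_smult[OF K] mod_span_base[OF K finG] low subr_minus[OF K] subr_mult[OF K])
          (auto simp: coeffs_in_def)
      finally show ?thesis by (simp add: mult.assoc)
    qed
  qed simp
qed


section \<open>Noether normalization with generic points\<close>

lemma mod_span_one: "mod_span B {1} = B"
  unfolding mod_span_def by (auto intro!: exI[of _ "\<lambda>_. _"])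

text \<open>Uniqueness of expansions in base \<open>N\<close>, with the most significant digit at
  index zero to match the exponents \<open>N ^ (n - i)\<close> of the substitution below.\<close>

lemma digits_inj:
  fixes a b :: "nat \<Rightarrow> nat"
  assumes "\<And>i. i < n \<Longrightarrow> a i < N" "\<And>i. i < n \<Longrightarrow> b i < N"
    and "(\<Sum>i<n. a i * N ^ (n - Suc i)) = (\<Sum>i<n. b i * N ^ (n - Suc i))"
  shows "\<forall>i<n. a i = b i"
  using assms
proof (induction n)
  case (Suc n)
  have step: "(\<Sum>i<Suc n. a i * N ^ (Suc n - Suc i)) = N * (\<Sum>i<n. a i * N ^ (n - Suc i)) + a n" for a :: "nat \<Rightarrow> nat"
  proof -
    have "(\<Sum>i<n. a i * N ^ (Suc n - Suc i)) = (\<Sum>i<n. N * (a i * N ^ (n - Suc i)))"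
    proof (rule sum.cong[OF refl])
      fix i assume "i \<in> {..<n}"
      then have "Suc n - Suc i = Suc (n - Suc i)" by auto
      then show "a i * N ^ (Suc n - Suc i) = N * (a i * N ^ (n - Suc i))" by simp
    qed
    then show ?thesis by (simp add: sum_distrib_left)
  qed
  have lt: "a n < N" "b n < N" using Suc.prems by auto
  have eq: "N * (\<Sum>i<n. a i * N ^ (n - Suc i)) + a n = N * (\<Sum>i<n. b i * N ^ (n - Suc i)) + b n"
    using Suc.prems(3) unfolding step .
  have uniq: "x = y \<and> r = s" if "N * x + r = N * y + s" "r < N" "s < N" for x y r s :: nat
  proof -
    have "(N * x + r) div N = x" "(N * y + s) div N = y" using that(2,3) by simp_all
    then have "x = y" unfolding that(1) by simp
    then show ?thesis using that(1) by simp
  qed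
  have ab: "(\<Sum>i<n. a i * N ^ (n - Suc i)) = (\<Sum>i<n. b i * N ^ (n - Suc i)) \<and> a n = b n"
    by (rule uniq[OF eq lt])
  have "\<forall>i<n. a i = b i"
  proof (rule Suc.IH)
    show "a i < N" "b i < N" if "i < n" for i using Suc.prems(1,2)[of i] that by auto
  qed (use ab in blast)
  with ab have "a n = b n" "\<forall>i<n. a i = b i" by blast+
  then show ?case by (auto simp: less_Suc_eq)
qed simp

text \<open>The summand of largest degree is not cancelled by any other.\<close>

lemma sum_monic_distinct_degrees:
  fixes g :: "'i \<Rightarrow> 'l::field poly"
  assumes S: "finite S" "S \<noteq> {}" and c: "\<And>m. m \<in> S \<Longrightarrow> c m \<noteq> 0"
    and g: "\<And>m. m \<in> S \<Longrightarrow> lead_coeff (g m) = 1" and inj: "inj_on (\<lambda>m. degree (g m)) S"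
  obtains m where "m \<in> S" "lead_coeff (\<Sum>m\<in>S. smult (c m) (g m)) = c m"
proof -
  let ?D = "Max ((\<lambda>m. degree (g m)) ` S)"
  have "?D \<in> (\<lambda>m. degree (g m)) ` S" using S by (intro Max_in) auto
  then obtain m where m: "m \<in> S" "degree (g m) = ?D" by auto
  have le: "degree (g m') \<le> ?D" if "m' \<in> S" for m' using S that by (intro Max_ge) auto
  let ?h = "\<Sum>m\<in>S. smult (c m) (g m)"
  have "coeff ?h ?D = (\<Sum>m'\<in>S. c m' * coeff (g m') ?D)" by (simp add: coeff_sum)
  also have "\<dots> = (\<Sum>m'\<in>{m}. c m' * coeff (g m') ?D)"
  proof (rule sum.mono_neutral_right[OF S(1)])
    show "\<forall>m'\<in>S - {m}. c m' * coeff (g m') ?D = 0"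
    proof
      fix m' assume m': "m' \<in> S - {m}"
      then have "degree (g m') \<noteq> ?D" using inj m by (metis DiffD1 DiffD2 inj_onD singletonI)
      then have "degree (g m') < ?D" using le m' by force
      then show "c m' * coeff (g m') ?D = 0" by (simp add: coeff_eq_0)
    qed
  qed (use m in auto)
  finally have co: "coeff ?h ?D = c m" using g[OF m(1)] m(2) by simp
  have "degree ?h \<le> ?D"
    by (rule degree_sum_le[OF S(1)]) (use le degree_smult_le le_trans in blast)
  moreover have "degree ?h \<ge> ?D" by (rule le_degree) (use co c m in simp)
  ultimately have "degree ?h = ?D" by simp
  then show ?thesis using that m(1) co by metis
qed

lemma degree_cancel_leading:
  fixes p q :: "'l::field poly"
  assumes "p \<noteq> 0" "q \<noteq> 0" "degree q \<le> degree p"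
    and r: "r = smult (lead_coeff q) p - Polynomial.monom (lead_coeff p) (degree p - degree q) * q"
  shows "r = 0 \<or> degree r < degree p"
proof (cases "r = 0")
  case False
  have "degree (Polynomial.monom (lead_coeff p) (degree p - degree q) * q) = degree p"
    using assms by (simp add: degree_mult_eq degree_monom_eq)
  then have "degree r \<le> degree p" unfolding r by (intro degree_diff_le) auto
  moreover have "coeff r (degree p) = 0"
    using assms(3) unfolding r by (simp add: coeff_monom_mult)
  ultimately show ?thesis using False by (metis leading_coeff_0_iff order_le_less)
qed simp

section \<open>Generic points in the universal field\<close>

context universal_field
begin

definition kap :: "'k \<Rightarrow> 'l" where
  "kap c = \<iota> (pconst c)"

lemma rhom_kap: "rhom kap"
  unfolding kap_def by (rule rhom_comp[OF rhom_\<iota> rhom_pconst])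

lemma kap_eq_0_iff [simp]: "kap c = 0 \<longleftrightarrow> c = 0"
  by (metis \<iota>_eq_0_iff kap_def lookup_single_eq lookup_zero single_zero)

abbreviation EV :: "(nat \<Rightarrow> 'l) \<Rightarrow> 'k mpoly \<Rightarrow> 'l" where
  "EV \<equiv> ev kap"

lemmas rhom_EV = rhom_ev[OF rhom_kap]
lemmas EV_simps = rhom_simps[OF rhom_EV] ev_pconst[OF rhom_kap] ev_pvar[OF rhom_kap]

lemma EV_pvar: "EV (\<lambda>i. \<iota> (pvar i)) p = \<iota> p"
  using rhom_of_ev[OF rhom_pconst rhom_\<iota>, of pvar p] by (simp add: ev_pconst_pvar kap_def[abs_def])

lemma EV_poly: "EV v (poly P (pvar i)) = poly (map_poly (EV v) P) (v i)"
  by (simp add: ev_poly[OF rhom_kap] EV_simps)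

lemma EV_upd: "p \<in> polys U \<Longrightarrow> i \<notin> U \<Longrightarrow> EV (v(i := a)) p = EV v p"
  by (rule ev_cong[OF rhom_kap]) auto

lemma EV_upd_poly:
  assumes P: "P \<in> coeffs_in (polys U)" and i: "i \<notin> U"
  shows "EV (v(i := a)) (poly P (pvar i)) = poly (map_poly (EV v) P) a"
proof -
  have "map_poly (EV (v(i := a))) P = map_poly (EV v) P"
    using P i by (intro poly_eqI) (simp add: coeff_map_poly EV_simps coeffs_in_def EV_upd[of _ U])
  then show ?thesis by (simp add: EV_poly)
qed

lemma poly_in_polys_insert:
  assumes "P \<in> coeffs_in (polys U)" shows "poly P (pvar i) \<in> polys (insert i U)"
  by (rule poly_in_subr[OF subr_polys])
    (use assms polys_mono[of U "insert i U"] in \<open>auto simp: coeffs_in_def intro: pvar_in_polys\<close>)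

text \<open>The new coordinate is a root of an element of \<open>P\<close> whose image has least
  degree; over the fraction field of the coordinate ring of \<open>v\<close>, this image is the
  irreducible generator of what \<open>P\<close> becomes. That field is never formed:
  pseudo-division with multipliers \<open>c\<close> satisfying \<open>EV v c \<noteq> 0\<close>
  takes its place.\<close>

lemma extend_generic_point:
  assumes P: "prm (polys (insert n U)) P" and n: "n \<notin> U"
    and v: "\<And>p. p \<in> polys U \<Longrightarrow> EV v p = 0 \<longleftrightarrow> p \<in> P"
    and f0: "f0 \<in> coeffs_in (polys U)" "poly f0 (pvar n) \<in> P" "map_poly (EV v) f0 \<noteq> 0"
  obtains a where "\<And>p. p \<in> polys (insert n U) \<Longrightarrow> EV (v(n := a)) p = 0 \<longleftrightarrow> p \<in> P"
proof -
  let ?A = "polys U :: 'k mpoly set" and ?A1 = "polys (insert n U) :: 'k mpoly set"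
  let ?C = "coeffs_in ?A"
  let ?h = "map_poly (EV v)"
  let ?\<phi> = "\<lambda>Q. poly Q (pvar n)"
  have A: "subr ?A" "subr ?A1" by (rule subr_polys)+
  have C: "subr ?C" by (rule subr_coeffs_in[OF A(1)])
  have idl: "idl ?A1 P" using P by (rule prm_idl)
  have sub: "?A \<subseteq> ?A1" by (rule polys_mono) auto
  have h: "rhom ?h" by (rule rhom_map_poly[OF rhom_EV])
  note h_simps = rhom_simps[OF h]
  have coeff_h: "coeff (?h Q) i = EV v (coeff Q i)" for Q i by (simp add: coeff_map_poly EV_simps)
  have \<phi>A1: "?\<phi> Q \<in> ?A1" if "Q \<in> ?C" for Q using that by (rule poly_in_polys_insert)
  have cA: "coeff Q i \<in> ?A" if "Q \<in> ?C" for Q i using that by (simp add: coeffs_in_def)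
  have zero: "?\<phi> Q \<in> P" if "Q \<in> ?C" "?h Q = 0" for Q
    unfolding poly_altdef
  proof (rule idl_sum[OF idl])
    fix i
    have "coeff Q i \<in> P" using v[OF cA[OF that(1)], of i] coeff_h[of Q i] that(2) by simp
    then show "coeff Q i * pvar n ^ i \<in> P"
      by (intro idl_mult2[OF idl] subr_power[OF A(2)] pvar_in_polys) auto
  qed
  let ?Q = "\<lambda>Q. Q \<in> ?C \<and> ?\<phi> Q \<in> P \<and> ?h Q \<noteq> 0"
  obtain f where f: "f \<in> ?C" "?\<phi> f \<in> P" "?h f \<noteq> 0"
    and fmin: "\<And>Q. ?Q Q \<Longrightarrow> degree (?h f) \<le> degree (?h Q)"
    using ex_has_least_nat[of ?Q f0 "\<lambda>Q. degree (?h Q)"] f0 by blast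
  have fmin': "?h Q = 0" if "Q \<in> ?C" "?\<phi> Q \<in> P" "degree (?h Q) < degree (?h f)" for Q
    using fmin[of Q] that by force
  have "degree (?h f) > 0"
  proof (rule ccontr)
    assume "\<not> ?thesis"
    obtain c g where cg: "f = pCons c g" by (metis pCons_cases)
    have gC: "g \<in> ?C" unfolding coeffs_in_def using f(1) cg by (auto simp: coeffs_in_def) (metis coeff_pCons_Suc)
    have cA': "c \<in> ?A" using cA[OF f(1), of 0] cg by simp
    have hf: "?h f = pCons (EV v c) (?h g)" unfolding cg by (simp add: map_poly_pCons EV_simps)
    then have "?h g = 0" using \<open>\<not> degree (?h f) > 0\<close> by (auto split: if_splits)
    then have "pvar n * ?\<phi> g \<in> P" using zero[OF gC] by (intro idl_mult[OF idl] pvar_in_polys) auto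
    then have "?\<phi> f - pvar n * ?\<phi> g \<in> P" using f(2) by (intro idl_diff[OF A(2) idl])
    then have "EV v c = 0" using v[OF cA'] by (simp add: cg)
    then show False using hf \<open>?h g = 0\<close> f(3) by simp
  qed
  then obtain a where a: "poly (?h f) a = 0" using alg_closed_imp_poly_has_root by blast
  let ?lc = "\<lambda>Q. coeff Q (degree (?h Q))"
  have pdiv: "\<exists>c H. c \<in> ?A \<and> EV v c \<noteq> 0 \<and> H \<in> ?C \<and>
      (?h (smult c R - H * Q) = 0 \<or> degree (?h (smult c R - H * Q)) < degree (?h Q))"
    if Q: "Q \<in> ?C" "?h Q \<noteq> 0" and R: "R \<in> ?C" for Q R
    using R
  proof (induction "if ?h R = 0 then 0 else Suc (degree (?h R))" arbitrary: R rule: less_induct)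
    case (less R)
    show ?case
    proof (cases "?h R = 0 \<or> degree (?h R) < degree (?h Q)")
      case True
      then show ?thesis
        using subr_1[OF A(1)] subr_0[OF C] by (intro exI[of _ 1] exI[of _ 0]) (simp add: EV_simps)
    next
      case False
      define M where "M = Polynomial.monom (?lc R) (degree (?h R) - degree (?h Q))"
      define R' where "R' = smult (?lc Q) R - M * Q"
      have MC: "M \<in> ?C" unfolding M_def by (rule monom_in_coeffs_in[OF A(1) cA[OF less.prems]])
      have smC: "smult c Z \<in> ?C" if "c \<in> ?A" "Z \<in> ?C" for c Z
        using that by (auto simp: coeffs_in_def intro: subr_mult[OF A(1)])
      have R'C: "R' \<in> ?C" unfolding R'_def using MC Q less.prems cA
        by (intro subr_diff[OF C] subr_mult[OF C] smC) auto
      have h_smult: "?h (smult c Z) = smult (EV v c) (?h Z)" for c Z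
        by (intro poly_eqI) (simp add: coeff_h EV_simps)
      have "?h R' = smult (lead_coeff (?h Q)) (?h R) - Polynomial.monom (lead_coeff (?h R)) (degree (?h R) - degree (?h Q)) * ?h Q"
        by (simp add: R'_def h_simps h_smult M_def map_poly_monom EV_simps coeff_h)
      then have "?h R' = 0 \<or> degree (?h R') < degree (?h R)"
        using False Q(2) by (intro degree_cancel_leading) auto
      then have "(if ?h R' = 0 then 0 else Suc (degree (?h R'))) < (if ?h R = 0 then 0 else Suc (degree (?h R)))"
        using False by auto
      from less.hyps[OF this R'C] obtain c H where cH: "c \<in> ?A" "EV v c \<noteq> 0" "H \<in> ?C"
        "?h (smult c R' - H * Q) = 0 \<or> degree (?h (smult c R' - H * Q)) < degree (?h Q)"
        by blast
      have eq: "smult c R' - H * Q = smult (c * ?lc Q) R - (smult c M + H) * Q"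
        by (simp add: R'_def algebra_simps smult_diff_right)
      show ?thesis
      proof (intro exI conjI)
        show "c * ?lc Q \<in> ?A" using cH(1) cA[OF Q(1)] by (rule subr_mult[OF A(1)])
        show "EV v (c * ?lc Q) \<noteq> 0" using cH(2) Q(2) by (simp add: EV_simps flip: coeff_h)
        show "smult c M + H \<in> ?C" using cH MC by (intro subr_add[OF C] smC)
        show "?h (smult (c * ?lc Q) R - (smult c M + H) * Q) = 0 \<or>
            degree (?h (smult (c * ?lc Q) R - (smult c M + H) * Q)) < degree (?h Q)"
          using cH(4) unfolding eq .
      qed
    qed
  qed
  have h_lin: "?h (smult c R - H * Q) = smult (EV v c) (?h R) - ?h H * ?h Q" for c R H Q
    by (intro poly_eqI) (simp add: h_simps coeff_h EV_simps)
  have \<phi>_lin: "?\<phi> (smult c R - H * Q) = c * ?\<phi> R - ?\<phi> H * ?\<phi> Q" for c R H Q by simp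
  have linC: "smult c R - H * Q \<in> ?C" if "c \<in> ?A" "R \<in> ?C" "H \<in> ?C" "Q \<in> ?C" for c R H Q
    using that by (intro subr_diff[OF C] subr_mult[OF C]) (auto simp: coeffs_in_def intro: subr_mult[OF A(1)])
  have root_if: "poly (?h R) a = 0" if R: "R \<in> ?C" "?\<phi> R \<in> P" for R
  proof -
    obtain c H where cH: "c \<in> ?A" "EV v c \<noteq> 0" "H \<in> ?C"
        "?h (smult c R - H * f) = 0 \<or> degree (?h (smult c R - H * f)) < degree (?h f)"
      using pdiv[OF f(1,3) R(1)] by blast
    have "?\<phi> (smult c R - H * f) \<in> P"
      unfolding \<phi>_lin using R f(2) cH sub \<phi>A1 by (intro idl_diff[OF A(2) idl] idl_mult[OF idl]) auto
    then have "?h (smult c R - H * f) = 0"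
      using cH(4) fmin'[OF linC[OF cH(1) R(1) cH(3) f(1)]] by blast
    then have "poly (smult (EV v c) (?h R) - ?h H * ?h f) a = 0" unfolding h_lin by simp
    then show ?thesis using a cH(2) by simp
  qed
  \<comment> \<open>Consider a counterexample \<open>p\<close> of least degree. Dividing by
    \<open>f\<close> shows that its degree is below that of \<open>f\<close>; dividing
    \<open>f\<close> by \<open>p\<close> makes a multiple of \<open>f\<close> equal to
    \<open>H * p\<close> on images. Then \<open>?\<phi> H\<close> lies in the prime
    \<open>P\<close>, but its image has smaller degree than that of \<open>f\<close>.\<close>
  have root_imp: "?\<phi> R \<in> P" if R: "R \<in> ?C" "poly (?h R) a = 0" for R
  proof (rule ccontr)
    assume R2: "?\<phi> R \<notin> P"
    let ?B = "\<lambda>Q. Q \<in> ?C \<and> poly (?h Q) a = 0 \<and> ?\<phi> Q \<notin> P"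
    obtain p where p: "?B p" and pmin: "\<And>Q. ?B Q \<Longrightarrow> degree (?h p) \<le> degree (?h Q)"
      using ex_has_least_nat[of ?B R "\<lambda>Q. degree (?h Q)"] R R2 by blast
    have hp0: "?h p \<noteq> 0" using zero p by blast
    have dp: "degree (?h p) > 0"
      using p hp0 by (metis degree_eq_zeroE gr0I pCons_0_0 poly_pCons add.right_neutral mult_zero_right poly_0)
    have small: "degree (?h p) < degree (?h f)"
    proof -
      obtain c H where cH: "c \<in> ?A" "EV v c \<noteq> 0" "H \<in> ?C"
          "?h (smult c p - H * f) = 0 \<or> degree (?h (smult c p - H * f)) < degree (?h f)"
        using pdiv[OF f(1,3)] p by blast
      let ?r = "smult c p - H * f"
      have rC: "?r \<in> ?C" using cH p f by (intro linC) auto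
      have "?\<phi> ?r \<notin> P"
      proof
        assume "?\<phi> ?r \<in> P"
        moreover have "?\<phi> H * ?\<phi> f \<in> P" using \<phi>A1[OF cH(3)] f(2) by (rule idl_mult[OF idl])
        ultimately have "c * ?\<phi> p \<in> P" using idl_add[OF idl, of "?\<phi> ?r" "?\<phi> H * ?\<phi> f"] by simp
        then have "c \<in> P" using prm_prime[OF P, of c "?\<phi> p"] cH(1) sub p \<phi>A1 by blast
        then show False using v[OF cH(1)] cH(2) by simp
      qed
      moreover have "poly (?h ?r) a = 0" unfolding h_lin using p a by simp
      ultimately have "?B ?r" using rC by blast
      then have "degree (?h p) \<le> degree (?h ?r)" "?h ?r \<noteq> 0" using pmin zero by blast+
      then show ?thesis using cH(4) by simp
    qed
    obtain c H where cH: "c \<in> ?A" "EV v c \<noteq> 0" "H \<in> ?C"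
        "?h (smult c f - H * p) = 0 \<or> degree (?h (smult c f - H * p)) < degree (?h p)"
      using pdiv[OF _ hp0 f(1)] p by blast
    let ?r = "smult c f - H * p"
    have rC: "?r \<in> ?C" using cH p f by (intro linC) auto
    have rP: "?\<phi> ?r \<in> P"
    proof (rule ccontr)
      assume "?\<phi> ?r \<notin> P"
      moreover have "poly (?h ?r) a = 0" unfolding h_lin using p a by simp
      ultimately have "?B ?r" using rC by blast
      then have "degree (?h p) \<le> degree (?h ?r)" "?h ?r \<noteq> 0" using pmin zero by blast+
      then show False using cH(4) by simp
    qed
    have "?h ?r = 0" using cH(4) small fmin'[OF rC rP] by force
    then have heq: "smult (EV v c) (?h f) = ?h H * ?h p" unfolding h_lin by simp
    have "c * ?\<phi> f \<in> P" using f(2) cH(1) sub by (intro idl_mult[OF idl]) auto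
    then have "c * ?\<phi> f - ?\<phi> ?r \<in> P" using rP by (rule idl_diff[OF A(2) idl])
    then have "?\<phi> H * ?\<phi> p \<in> P" by simp
    then have "?\<phi> H \<in> P" using prm_prime[OF P, of "?\<phi> H" "?\<phi> p"] p \<phi>A1 cH(3) by blast
    moreover have hH: "?h H \<noteq> 0" using heq f(3) cH(2) by auto
    ultimately have "degree (?h f) \<le> degree (?h H)" using fmin cH(3) by blast
    moreover have "degree (?h f) = degree (?h H) + degree (?h p)"
      using arg_cong[OF heq, of degree] cH(2) hH hp0 by (simp add: degree_mult_eq)
    ultimately show False using dp by simp
  qed
  show ?thesis
  proof (rule that)
    fix p assume "p \<in> ?A1"
    then obtain R where R: "R \<in> ?C" "p = ?\<phi> R" by (rule polys_insert_poly)
    show "EV (v(n := a)) p = 0 \<longleftrightarrow> p \<in> P"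
      unfolding R(2) EV_upd_poly[OF R(1) n] using root_if[OF R(1)] root_imp[OF R(1)] by blast
  qed
qed

text \<open>Nagata's substitution: the exponents \<open>N ^ (n - i)\<close> turn the monomials of \<open>f\<close> into monic
  polynomials in the last variable whose degrees, read in base \<open>N\<close>, are pairwise distinct.\<close>
lemma nagata_monic:
  fixes f :: "'k mpoly" and v :: "nat \<Rightarrow> 'l"
  assumes f: "f \<in> polys {..<Suc n}" "f \<noteq> 0" and N: "\<And>m i. m \<in> Poly_Mapping.keys f \<Longrightarrow> Poly_Mapping.lookup m i < N"
    and F: "F \<in> coeffs_in (polys {..<n})"
    and \<sigma>: "poly F (pvar n) = ev pconst (\<lambda>i. if i < n then pvar i + pvar n ^ N ^ (n - i) else pvar i) f"
  obtains c where "c \<noteq> 0" "lead_coeff (map_poly (EV v) F) = kap c"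
proof -
  let ?\<kappa> = "\<lambda>c. [:kap c:]" and ?X = "[:0, 1:] :: 'l poly"
  let ?w = "\<lambda>i. if i = n then ?X else [:v i:]"
  have const: "rhom (\<lambda>a. [:a::'l:])" by (simp add: rhom_def one_pCons mult.commute)
  have \<kappa>: "rhom ?\<kappa>" by (rule rhom_comp[OF const rhom_kap])
  have evc: "ev ?\<kappa> ?w c = [:EV v c:]" if "c \<in> polys {..<n}" for c
  proof -
    have "ev ?\<kappa> ?w c = ev ?\<kappa> (\<lambda>i. [:v i:]) c" by (rule ev_cong[OF \<kappa> that]) auto
    then show ?thesis using rhom_of_ev[OF rhom_kap const, of v c] by simp
  qed
  have "ev ?\<kappa> ?w (poly F (pvar n)) = poly (map_poly (ev ?\<kappa> ?w) F) ?X"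
    by (simp add: ev_poly[OF \<kappa>] ev_pvar[OF \<kappa>])
  also have "map_poly (ev ?\<kappa> ?w) F = map_poly (\<lambda>a. [:a:]) (map_poly (EV v) F)"
    using F by (intro poly_eqI)
      (simp add: coeff_map_poly ev_0[OF \<kappa>] EV_simps coeffs_in_def evc)
  also have "poly (map_poly (\<lambda>a. [:a:]) p) ?X = p" for p :: "'l poly"
    by (induction p) (simp_all add: map_poly_pCons)
  finally have F': "map_poly (EV v) F = ev ?\<kappa> ?w (poly F (pvar n))" by simp
  \<comment> \<open>The images of the variables as polynomials in the last one. For
    \<open>i = n\<close> the degree is \<open>N ^ 0\<close>, so one degree formula covers all
    variables.\<close>
  define y where "y i = (if i < n then [:v i:] + Polynomial.monom 1 (N ^ (n - i)) else ?w i)" for i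
  have Xpow: "?X ^ k = Polynomial.monom 1 k" for k by (metis monom_altdef smult_1_left)
  have "map_poly (EV v) F = ev ?\<kappa> y f"
    unfolding F' \<sigma> ev_ev[OF \<kappa>]
    by (rule arg_cong2[where f = "ev ?\<kappa>"])
      (auto simp: y_def fun_eq_iff rhom_simps[OF rhom_ev[OF \<kappa>]] ev_pvar[OF \<kappa>] Xpow)
  also have "\<dots> = (\<Sum>m\<in>Poly_Mapping.keys f. smult (kap (Poly_Mapping.lookup f m)) (monom_val y m))"
    by (simp add: ev_def)
  finally have sum: "map_poly (EV v) F = (\<Sum>m\<in>Poly_Mapping.keys f. smult (kap (Poly_Mapping.lookup f m)) (monom_val y m))" .
  have keys: "Poly_Mapping.keys m \<subseteq> {..<Suc n}" if "m \<in> Poly_Mapping.keys f" for m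
    using f(1) that by (auto simp: polys_def)
  have "N > 0"
  proof -
    obtain m where "m \<in> Poly_Mapping.keys f" using f(2) by (metis keys_eq_empty ex_in_conv)
    then show ?thesis using N[of m 0] by simp
  qed
  have y: "lead_coeff (y i) = 1 \<and> degree (y i) = N ^ (n - i)" if "i < Suc n" for i
  proof (cases "i < n")
    case True
    have "degree ([:v i:] + Polynomial.monom 1 (N ^ (n - i))) = N ^ (n - i)"
      using \<open>N > 0\<close> by (subst degree_add_eq_right) (auto simp: degree_monom_eq)
    moreover have "coeff [:v i:] (N ^ (n - i)) = 0"
      using \<open>N > 0\<close> by (simp add: coeff_eq_0)
    ultimately show ?thesis using True by (simp add: y_def)
  qed (use that in \<open>simp add: y_def\<close>)
  have mv: "lead_coeff (monom_val y m) = 1 \<and> degree (monom_val y m) = (\<Sum>i<Suc n. Poly_Mapping.lookup m i * N ^ (Suc n - Suc i))"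
    if "m \<in> Poly_Mapping.keys f" for m
  proof -
    have nz: "y i ^ k \<noteq> 0" if "i < Suc n" for i k using y[OF that] by auto
    have "lead_coeff (monom_val y m) = (\<Prod>i<Suc n. lead_coeff (y i) ^ Poly_Mapping.lookup m i)"
      unfolding monom_val_superset[OF finite_lessThan keys[OF that]] lead_coeff_prod
      by (simp only: lead_coeff_power)
    also have "\<dots> = 1"
    proof (intro prod.neutral ballI)
      fix i assume "i \<in> {..<Suc n}"
      then have "lead_coeff (y i) = 1" using y by blast
      then show "lead_coeff (y i) ^ Poly_Mapping.lookup m i = 1" by (simp only: power_one)
    qed
    finally have "lead_coeff (monom_val y m) = 1" .
    moreover have "degree (monom_val y m) = (\<Sum>i<Suc n. degree (y i ^ Poly_Mapping.lookup m i))"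
      unfolding monom_val_superset[OF finite_lessThan keys[OF that]]
      using nz by (intro degree_prod_eq_sum_degree) blast
    moreover have "\<dots> = (\<Sum>i<Suc n. Poly_Mapping.lookup m i * N ^ (Suc n - Suc i))"
    proof (intro sum.cong refl)
      fix i assume "i \<in> {..<Suc n}"
      then show "degree (y i ^ Poly_Mapping.lookup m i) = Poly_Mapping.lookup m i * N ^ (Suc n - Suc i)"
        using y[of i] nz[of i 1] by (simp add: degree_power_eq)
    qed
    ultimately show ?thesis by simp
  qed
  have inj: "inj_on (\<lambda>m. degree (monom_val y m)) (Poly_Mapping.keys f)"
  proof (rule inj_onI)
    fix m m' assume mm: "m \<in> Poly_Mapping.keys f" "m' \<in> Poly_Mapping.keys f" "degree (monom_val y m) = degree (monom_val y m')"
    have "\<forall>i<Suc n. Poly_Mapping.lookup m i = Poly_Mapping.lookup m' i"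
      using mm(3) mv[OF mm(1)] mv[OF mm(2)] N mm(1,2) by (intro digits_inj[of "Suc n" _ N]) auto
    moreover have "Poly_Mapping.lookup m i = 0" "Poly_Mapping.lookup m' i = 0" if "\<not> i < Suc n" for i
      using that keys[OF mm(1)] keys[OF mm(2)] by (metis in_keys_iff lessThan_iff subsetD)+
    ultimately show "m = m'" by (metis poly_mapping_eqI)
  qed
  have ne: "Poly_Mapping.keys f \<noteq> {}" using f(2) by simp
  have nz: "kap (Poly_Mapping.lookup f m) \<noteq> 0" if "m \<in> Poly_Mapping.keys f" for m
    using that by (simp add: in_keys_iff)
  obtain m where m: "m \<in> Poly_Mapping.keys f"
      "lead_coeff (\<Sum>m\<in>Poly_Mapping.keys f. smult (kap (Poly_Mapping.lookup f m)) (monom_val y m)) = kap (Poly_Mapping.lookup f m)"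
    by (rule sum_monic_distinct_degrees[OF finite_keys ne, of "\<lambda>m. kap (Poly_Mapping.lookup f m)" "monom_val y"])
      (use nz mv inj in \<open>blast+\<close>)
  then show ?thesis using that[of "Poly_Mapping.lookup f m"] by (simp add: sum in_keys_iff)
qed

text \<open>The leading coefficient of \<open>q\<close> is a nonzero constant, so
  \<open>a ^ degree q\<close> is a combination of lower powers over \<open>S0\<close>, and the
  products \<open>g * a ^ j\<close> with \<open>j < degree q\<close> generate.\<close>

lemma mod_span_adjoin:
  assumes S0: "subr S0" "S0 = mod_span (base d) G" "finite G"
    and q: "q \<in> coeffs_in S0" "poly q a = 0" "lead_coeff q = kap c" "c \<noteq> 0"
  obtains G' where "finite G'" "(\<lambda>Q. poly Q a) ` coeffs_in S0 = mod_span (base d) G'"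
proof -
  let ?S1 = "(\<lambda>Q. poly Q a) ` coeffs_in S0"
  let ?M = "degree q"
  define G' where "G' = (\<lambda>(g, j). g * a ^ j) ` (G \<times> {..<?M})"
  have finG': "finite G'" using S0(3) by (simp add: G'_def)
  let ?Y = "mod_span (base d) G'"
  note baseS = base_subset_span[OF S0(1,2)]
  have kapS: "kap x \<in> S0" for x
    using baseS by (auto simp: base_def kap_def intro: pconst_in_polys)
  have S1: "subr ?S1" by (rule subr_image[OF _ subr_coeffs_in[OF S0(1)]]) (simp add: rhom_def)
  have S0S1: "s \<in> ?S1" if "s \<in> S0" for s
    by (rule image_eqI[of _ _ "[:s:]"]) (use that in \<open>auto intro: const_in_coeffs_in[OF S0(1)]\<close>)
  have aS1: "a \<in> ?S1"
    by (rule image_eqI[of _ _ "Polynomial.monom 1 1"])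
      (auto simp: poly_monom intro: monom_in_coeffs_in[OF S0(1)] subr_1[OF S0(1)])
  have M: "?M > 0"
  proof (rule ccontr)
    assume "\<not> ?thesis"
    then obtain z where "q = [:z:]" by (auto elim: degree_eq_zeroE)
    then show False using q(2-4) by auto
  qed
  have 1: "s * a ^ j \<in> ?Y" if s: "s \<in> S0" and j: "j < ?M" for s j
  proof -
    have "s \<in> mod_span (base d) G" using s S0(2) by simp
    then obtain \<beta> where "s = (\<Sum>g\<in>G. \<beta> g * g)" "\<forall>g\<in>G. \<beta> g \<in> base d" by (rule mod_spanE)
    then have "s * a ^ j = (\<Sum>g\<in>G. \<beta> g * (g * a ^ j))" by (simp add: sum_distrib_right mult.assoc)
    also have "\<dots> \<in> ?Y"
    proof (rule mod_span_sum[OF subr_base])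
      fix g assume "g \<in> G"
      then have "\<beta> g \<in> base d" using \<open>\<forall>g\<in>G. \<beta> g \<in> base d\<close> by blast
      moreover have "g * a ^ j \<in> G'"
        unfolding G'_def using \<open>g \<in> G\<close> j by (intro image_eqI[of _ _ "(g, j)"]) auto
      ultimately show "\<beta> g * (g * a ^ j) \<in> ?Y"
        by (intro mod_span_smult[OF subr_base] mod_span_base[OF subr_base finG'])
    qed
    finally show ?thesis .
  qed
  have aM: "a ^ ?M = (\<Sum>j<?M. (- kap (inverse c) * coeff q j) * a ^ j)"
  proof -
    have "0 = (\<Sum>j<?M. coeff q j * a ^ j) + kap c * a ^ ?M"
      using q(2,3) by (simp add: poly_altdef lessThan_Suc_atMost[symmetric])
    then have "kap c * a ^ ?M = - (\<Sum>j<?M. coeff q j * a ^ j)" by (simp add: eq_neg_iff_add_eq_0 add.commute)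
    then have "kap (inverse c) * (kap c * a ^ ?M) = - kap (inverse c) * (\<Sum>j<?M. coeff q j * a ^ j)" by simp
    moreover have "kap (inverse c) * kap c = 1"
      using q(4) by (simp add: rhom_1[OF rhom_kap] flip: rhom_mult[OF rhom_kap])
    ultimately show ?thesis by (simp add: sum_distrib_left mult.assoc[symmetric])
  qed
  have aY: "a * y \<in> ?Y" if "y \<in> ?Y" for y
  proof -
    have "?Y \<subseteq> {y. a * y \<in> ?Y}"
    proof (rule mod_span_subset[OF subr_base])
      show "G' \<subseteq> {y. a * y \<in> ?Y}"
      proof
        fix h assume "h \<in> G'"
        then obtain g j where gj: "g \<in> G" "j < ?M" "h = g * a ^ j" by (auto simp: G'_def)
        have gS: "g \<in> S0" unfolding S0(2) by (rule mod_span_base[OF subr_base S0(3) gj(1)])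
        show "h \<in> {y. a * y \<in> ?Y}"
        proof (cases "Suc j < ?M")
          case True
          then show ?thesis using 1[OF gS True] by (simp add: gj(3) mult_ac)
        next
          case False
          then have "Suc j = ?M" using gj(2) by simp
          then have "a * h = g * a ^ ?M" by (simp add: gj(3) mult_ac flip: power_Suc)
          also have "\<dots> = (\<Sum>j<?M. (g * (- kap (inverse c) * coeff q j)) * a ^ j)"
            unfolding aM by (simp add: sum_distrib_left mult.assoc)
          also have "\<dots> \<in> ?Y"
          proof (rule mod_span_sum[OF subr_base], rule 1)
            fix i
            show "g * (- kap (inverse c) * coeff q i) \<in> S0"
              using q(1) gS kapS
              by (intro subr_mult[OF S0(1)] subr_minus[OF S0(1)]) (auto simp: coeffs_in_def)
          qed simp
          finally show ?thesis by simp
        qed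
      qed
    qed (auto simp: distrib_left mult.left_commute[of a] intro: mod_span_0 mod_span_add mod_span_smult subr_base)
    then show ?thesis using that by blast
  qed
  have pw: "s * a ^ i \<in> ?Y" if "s \<in> S0" for s i
  proof (induction i)
    case 0
    then show ?case using 1[OF that M] by simp
  next
    case (Suc i)
    then show ?case using aY[OF Suc] by (simp add: mult_ac)
  qed
  have "?S1 = ?Y"
  proof
    show "?S1 \<subseteq> ?Y"
    proof
      fix z assume "z \<in> ?S1"
      then obtain Q where "z = poly Q a" "Q \<in> coeffs_in S0" by auto
      then show "z \<in> ?Y" unfolding poly_altdef
        by (auto simp: coeffs_in_def poly_altdef intro!: mod_span_sum[OF subr_base] pw)
    qed
    show "?Y \<subseteq> ?S1"
    proof (rule mod_span_subset[OF subr_base])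
      show "G' \<subseteq> ?S1"
      proof
        fix h assume "h \<in> G'"
        then obtain g j where gj: "g \<in> G" "h = g * a ^ j" by (auto simp: G'_def)
        have "g \<in> S0" unfolding S0(2) by (rule mod_span_base[OF subr_base S0(3) gj(1)])
        then show "h \<in> ?S1" unfolding gj(2) by (intro subr_mult[OF S1] subr_power[OF S1] S0S1 aS1)
      qed
      show "b * x \<in> ?S1" if "b \<in> base d" "x \<in> ?S1" for b x
        using that baseS S0S1 by (intro subr_mult[OF S1]) auto
    qed (use S1 in \<open>auto intro: subr_0 subr_add\<close>)
  qed
  then show ?thesis using that finG' by blast
qed

text \<open>Induction on the number of variables. For the zero ideal the independent transcendentals
  themselves are a generic point. Otherwise a nonzero element of \<open>P\<close> becomes monic in
  the last variable up to a constant, and that variable is adjoined as an integral element to the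
  generic point of the contraction; \<open>d\<close> does not change in this step.\<close>

theorem noether_generic_point:
  assumes "prm (polys {..<n}) P"
  shows "\<exists>v d G. finite G \<and> (\<forall>p\<in>polys {..<n}. EV v p = 0 \<longleftrightarrow> p \<in> P) \<and> EV v ` polys {..<n} = mod_span (base d) G"
  using assms
proof (induction n arbitrary: P)
  case 0
  have "p \<in> P \<longleftrightarrow> p = 0" if "p \<in> polys {..<0}" for p
    using prm_inter_constants[OF 0] idl_0[OF prm_idl[OF 0]] that by auto
  then show ?case
    by (intro exI[of _ "\<lambda>i. \<iota> (pvar i)"] exI[of _ 0] exI[of _ "{1}"])
      (simp add: EV_pvar mod_span_one base_def)
next
  case (Suc n)
  let ?A1 = "polys {..<Suc n} :: 'k mpoly set" and ?A = "polys {..<n} :: 'k mpoly set"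
  show ?case
  proof (cases "P = {0}")
    case True
    then show ?thesis
      by (intro exI[of _ "\<lambda>i. \<iota> (pvar i)"] exI[of _ "Suc n"] exI[of _ "{1}"])
        (simp add: EV_pvar mod_span_one base_def)
  next
    case False
    have "0 \<in> P" using idl_0[OF prm_idl[OF Suc.prems]] .
    then obtain f where f: "f \<in> P" "f \<noteq> 0" using False by blast
    have fA: "f \<in> ?A1" using f(1) idl_sub[OF prm_idl[OF Suc.prems]] by blast
    define N where "N = Suc (\<Sum>m\<in>Poly_Mapping.keys f. \<Sum>i\<in>Poly_Mapping.keys m. Poly_Mapping.lookup m i)"
    have N: "Poly_Mapping.lookup m i < N" if "m \<in> Poly_Mapping.keys f" for m i
    proof (cases "i \<in> Poly_Mapping.keys m")
      case True
      have "Poly_Mapping.lookup m i \<le> (\<Sum>i\<in>Poly_Mapping.keys m. Poly_Mapping.lookup m i)"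
        using True by (intro member_le_sum) auto
      also have "\<dots> < N" unfolding N_def less_Suc_eq_le
        using that by (intro member_le_sum[of m _ "\<lambda>m. \<Sum>i\<in>Poly_Mapping.keys m. Poly_Mapping.lookup m i"]) auto
      finally show ?thesis .
    next
      case False
      then show ?thesis by (simp add: in_keys_iff N_def)
    qed
    \<comment> \<open>A triangular automorphism with inverse \<open>\<sigma>'\<close>: the last
      variable is fixed, so subtracting its powers undoes adding them.\<close>
    define \<sigma> :: "nat \<Rightarrow> 'k mpoly" where "\<sigma> = (\<lambda>i. if i < n then pvar i + pvar n ^ N ^ (n - i) else pvar i)"
    define \<sigma>' :: "nat \<Rightarrow> 'k mpoly" where "\<sigma>' = (\<lambda>i. if i < n then pvar i - pvar n ^ N ^ (n - i) else pvar i)"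
    let ?\<tau> = "ev pconst \<sigma>" and ?\<tau>' = "ev pconst \<sigma>'"
    note hom = rhom_ev[OF rhom_pconst]
    have inv: "?\<tau>' (?\<tau> p) = p" "?\<tau> (?\<tau>' p) = p" for p
    proof -
      have "(\<lambda>i. ?\<tau>' (\<sigma> i)) = pvar" "(\<lambda>i. ?\<tau> (\<sigma>' i)) = pvar"
        by (auto simp: fun_eq_iff \<sigma>_def \<sigma>'_def rhom_simps[OF hom] ev_pvar[OF rhom_pconst])
      then show "?\<tau>' (?\<tau> p) = p" "?\<tau> (?\<tau>' p) = p"
        by (simp_all add: ev_ev[OF rhom_pconst] ev_pconst_pvar)
    qed
    have \<tau>A: "?\<tau> p \<in> ?A1" "?\<tau>' p \<in> ?A1" if "p \<in> ?A1" for p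
      using that by (auto intro!: ev_polys[of p "{..<Suc n}"] polys_intros simp: \<sigma>_def \<sigma>'_def)
    define P1 where "P1 = {p \<in> ?A1. ?\<tau>' p \<in> P}"
    have P1: "prm ?A1 P1"
      unfolding P1_def by (rule prm_vimage[OF hom subr_polys Suc.prems \<tau>A(2)])
    have sub: "?A \<subseteq> ?A1" by (rule polys_mono) auto
    have ins: "{..<Suc n} = insert n {..<n}" by auto
    obtain v d G where G: "finite G" and v: "\<forall>p\<in>?A. EV v p = 0 \<longleftrightarrow> p \<in> P1 \<inter> ?A"
      and S0: "EV v ` ?A = mod_span (base d) G"
      using Suc.IH[OF prm_inter[OF subr_polys sub P1]] by blast
    obtain F where F: "F \<in> coeffs_in ?A" "?\<tau> f = poly F (pvar n)"
      using polys_insert_poly[of "?\<tau> f" n "{..<n}"] \<tau>A(1)[OF fA] unfolding ins by blast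
    have FP1: "poly F (pvar n) \<in> P1"
      unfolding P1_def F(2)[symmetric] using \<tau>A(1)[OF fA] f(1) by (simp add: inv)
    obtain c where c: "c \<noteq> 0" "lead_coeff (map_poly (EV v) F) = kap c"
      using nagata_monic[OF fA f(2) N F(1), of v] F(2) unfolding \<sigma>_def by metis
    have F0: "map_poly (EV v) F \<noteq> 0" using c by auto
    obtain a where a: "\<And>p. p \<in> ?A1 \<Longrightarrow> EV (v(n := a)) p = 0 \<longleftrightarrow> p \<in> P1"
      using extend_generic_point[of n "{..<n}" P1 v F] P1 v F(1) FP1 F0 unfolding ins by auto
    let ?v1 = "v(n := a)"
    have im: "EV ?v1 ` ?A1 = (\<lambda>Q. poly Q a) ` coeffs_in (EV v ` ?A)"
    proof
      show "EV ?v1 ` ?A1 \<subseteq> (\<lambda>Q. poly Q a) ` coeffs_in (EV v ` ?A)"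
      proof clarify
        fix p assume "p \<in> ?A1"
        then obtain Q where Q: "Q \<in> coeffs_in ?A" "p = poly Q (pvar n)"
          unfolding ins by (rule polys_insert_poly)
        then show "EV ?v1 p \<in> (\<lambda>Q. poly Q a) ` coeffs_in (EV v ` ?A)"
          by (intro image_eqI[of _ _ "map_poly (EV v) Q"])
            (auto simp: EV_upd_poly[OF Q(1)] coeffs_in_def coeff_map_poly EV_simps)
      qed
      have "subr (EV ?v1 ` ?A1)" by (rule subr_image[OF rhom_EV subr_polys])
      moreover have "a \<in> EV ?v1 ` ?A1"
        by (rule image_eqI[of _ _ "pvar n"]) (auto simp: EV_simps intro: pvar_in_polys)
      moreover have "coeffs_in (EV v ` ?A) \<subseteq> coeffs_in (EV ?v1 ` ?A1)"
      proof -
        have "EV v ` ?A \<subseteq> EV ?v1 ` ?A1"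
        proof clarify
          fix p assume "p \<in> ?A"
          then show "EV v p \<in> EV ?v1 ` ?A1"
            using sub EV_upd[of p "{..<n}" n v a] by (intro image_eqI[of _ _ p]) auto
        qed
        then show ?thesis unfolding coeffs_in_def by blast
      qed
      ultimately show "(\<lambda>Q. poly Q a) ` coeffs_in (EV v ` ?A) \<subseteq> EV ?v1 ` ?A1"
        by (auto intro!: poly_in_subr)
    qed
    have qa: "poly (map_poly (EV v) F) a = 0"
      using a[of "poly F (pvar n)"] FP1 poly_in_polys_insert[OF F(1)] EV_upd_poly[OF F(1), of n v a]
      unfolding ins by simp
    have qC: "map_poly (EV v) F \<in> coeffs_in (EV v ` ?A)"
      using F(1) by (auto simp: coeffs_in_def coeff_map_poly EV_simps)
    obtain G' where G': "finite G'" "EV ?v1 ` ?A1 = mod_span (base d) G'"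
      using mod_span_adjoin[OF subr_image[OF rhom_EV subr_polys] S0 G qC qa c(2,1)] unfolding im by blast
    \<comment> \<open>Composing with \<open>\<sigma>\<close> returns to the original coordinates;
      the substitution permutes the polynomial ring, so the coordinate ring remains the
      same.\<close>
    define v' where "v' = (\<lambda>i. EV ?v1 (\<sigma> i))"
    have v': "EV v' p = EV ?v1 (?\<tau> p)" for p unfolding v'_def by (rule ev_ev[OF rhom_kap, symmetric])
    have "EV v' p = 0 \<longleftrightarrow> p \<in> P" if "p \<in> ?A1" for p
      unfolding v' using a[OF \<tau>A(1)[OF that]] \<tau>A(1)[OF that] by (simp add: P1_def inv)
    moreover have "EV v' ` ?A1 = EV ?v1 ` ?A1"
    proof -
      have "?\<tau> ` ?A1 = ?A1" using \<tau>A inv by (metis (no_types, lifting) image_eqI image_subsetI subsetI subset_antisym)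
      then show ?thesis unfolding v' by (metis image_image)
    qed
    ultimately show ?thesis using G' by (intro exI[of _ v'] exI[of _ d] exI[of _ G']) simp
  qed
qed

end


section \<open>Transcendence degree of prime ideals and the principal ideal theorem\<close>

definition indep_vars :: "'k::field mpoly set \<Rightarrow> nat set \<Rightarrow> bool" where
  "indep_vars P U \<longleftrightarrow> polys U \<inter> P \<subseteq> {0}"

text \<open>For a prime this is the transcendence degree of the residue field, since a transcendence
  basis can be chosen among the classes of the variables; the definition itself stays within
  polynomials.\<close>

definition tr_deg :: "nat \<Rightarrow> 'k::field mpoly set \<Rightarrow> nat" where
  "tr_deg n P = Max {card U | U. U \<subseteq> {..<n} \<and> indep_vars P U}"

lemma finite_indep_cards: "finite {card U | U. U \<subseteq> {..<n::nat} \<and> R U}"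
  by (rule finite_subset[of _ "card ` Pow {..<n}"]) auto

lemma tr_deg_ge: "U \<subseteq> {..<n} \<Longrightarrow> indep_vars P U \<Longrightarrow> card U \<le> tr_deg n P"
  unfolding tr_deg_def by (rule Max_ge[OF finite_indep_cards]) blast

lemma tr_deg_attained:
  assumes "prm (polys {..<n}) P"
  obtains U where "U \<subseteq> {..<n}" "indep_vars P U" "card U = tr_deg n P"
proof -
  have "indep_vars P {}"
    using prm_inter_constants[OF assms] by (auto simp: indep_vars_def)
  then have "tr_deg n P \<in> {card U | U. U \<subseteq> {..<n} \<and> indep_vars P U}"
    unfolding tr_deg_def by (intro Max_in finite_indep_cards) blast
  then show ?thesis using that by auto
qed

lemma algebraic_over_max_indep:
  assumes P: "prm (polys {..<n}) P" and U: "U \<subseteq> {..<n}" "indep_vars P U" "card U = tr_deg n P"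
    and i: "i < n"
  obtains q where "q \<in> coeffs_in (polys U)" "q \<noteq> 0" "poly q (pvar i) \<in> P"
proof (cases "i \<in> U")
  case True
  have "[:- pvar i, 1:] \<in> coeffs_in (polys U)"
    using True by (auto simp: coeffs_in_def coeff_pCons intro: polys_intros split: nat.splits)
  then show ?thesis using that[of "[:- pvar i, 1:]"] idl_0[OF prm_idl[OF P]] by simp
next
  case False
  have "\<not> indep_vars P (insert i U)"
  proof
    assume "indep_vars P (insert i U)"
    then have "card (insert i U) \<le> tr_deg n P" using U i by (intro tr_deg_ge) auto
    then show False using False U finite_subset[OF U(1)] by simp
  qed
  then obtain p where p: "p \<in> polys (insert i U)" "p \<in> P" "p \<noteq> 0" by (auto simp: indep_vars_def)
  then obtain q where "q \<in> coeffs_in (polys U)" "p = poly q (pvar i)" by (metis polys_insert_poly)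
  then show ?thesis using that p by fastforce
qed

section \<open>Comparison of the transcendence degrees of primes\<close>

context universal_field
begin

text \<open>The condition on the leading coefficient keeps the relation nontrivial after evaluation.
  It concerns the point \<open>v\<close>, which may belong to another prime than the one that
  supplied the relation.\<close>

lemma generic_algebraic:
  assumes q: "q \<in> coeffs_in (polys U)" "poly q (pvar i) \<in> P" and v: "\<And>p. p \<in> P \<Longrightarrow> EV v p = 0"
    and nz: "EV v (lead_coeff q) \<noteq> 0"
  shows "\<exists>q. q \<noteq> 0 \<and> q \<in> coeffs_in (EV v ` polys U) \<and> poly q (v i) = 0"
proof (intro exI conjI)
  have "coeff (map_poly (EV v) q) (degree q) \<noteq> 0" using nz by (simp add: coeff_map_poly EV_simps)
  then show "map_poly (EV v) q \<noteq> 0" by auto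
  show "map_poly (EV v) q \<in> coeffs_in (EV v ` polys U)"
    using q(1) by (auto simp: coeffs_in_def coeff_map_poly EV_simps)
  show "poly (map_poly (EV v) q) (v i) = 0" using v[OF q(2)] by (simp add: EV_poly)
qed

text \<open>If \<open>U'\<close> is independent modulo \<open>P'\<close> and \<open>g\<close> lies
  in \<open>P'\<close> but not in \<open>P\<close>, then \<open>U'\<close> together with
  \<open>g\<close> is independent modulo \<open>P\<close>: the constant term of a relation in
  \<open>g\<close> lies in \<open>P'\<close>, hence vanishes, and \<open>g\<close> can be
  cancelled.\<close>

theorem tr_deg_strict_mono:
  fixes P P' :: "'k mpoly set"
  assumes P: "prm (polys {..<n}) P" and P': "prm (polys {..<n}) P'" and lt: "P \<subset> P'"
  shows "tr_deg n P' < tr_deg n P"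
proof -
  let ?A = "polys {..<n} :: 'k mpoly set"
  obtain U where U: "U \<subseteq> {..<n}" "indep_vars P U" "card U = tr_deg n P" using tr_deg_attained[OF P] .
  obtain U' where U': "U' \<subseteq> {..<n}" "indep_vars P' U'" "card U' = tr_deg n P'" using tr_deg_attained[OF P'] .
  obtain g where g: "g \<in> P'" "g \<notin> P" using lt by blast
  have gA: "g \<in> ?A" using g(1) idl_sub[OF prm_idl[OF P']] by blast
  obtain v where v: "\<And>p. p \<in> ?A \<Longrightarrow> EV v p = 0 \<longleftrightarrow> p \<in> P" using noether_generic_point[OF P] by blast
  have PA: "P \<subseteq> ?A" using idl_sub[OF prm_idl[OF P]] by blast
  have subU': "polys U' \<subseteq> ?A" using U'(1) by (rule polys_mono)
  have zero: "Q = 0" if "Q \<in> coeffs_in (polys U')" "poly Q g \<in> P" for Q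
    using that
  proof (induction Q)
    case (pCons c R)
    have R: "R \<in> coeffs_in (polys U')"
      using pCons.prems(1) by (auto simp: coeffs_in_def) (metis coeff_pCons_Suc)
    have c: "c \<in> polys U'" using pCons.prems(1) by (auto simp: coeffs_in_def) (metis coeff_pCons_0)
    have RA: "poly R g \<in> ?A"
      using R subU' gA by (intro poly_in_subr[OF subr_polys]) (auto simp: coeffs_in_def)
    have "c + g * poly R g \<in> P'" using pCons.prems(2) lt by auto
    then have "c + g * poly R g - g * poly R g \<in> P'"
      using RA g(1) by (intro idl_diff[OF subr_polys prm_idl[OF P']] idl_mult2[OF prm_idl[OF P']])
    then have "c = 0" using c U'(2) by (auto simp: indep_vars_def)
    then have "g * poly R g \<in> P" using pCons.prems(2) by simp
    then have "poly R g \<in> P" using prm_prime[OF P gA RA] g(2) by blast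
    then show ?case using pCons.IH R \<open>c = 0\<close> by simp
  qed simp
  have nU': "n \<notin> U'" and finU': "finite U'" using U'(1) finite_subset by auto
  \<comment> \<open>The index \<open>n\<close>, which is not in \<open>U'\<close>, stands for
    \<open>g\<close>.\<close>
  have "card (insert n U') \<le> card U"
  proof (rule alg_independent_card_le_algebraic[OF rhom_kap, where u = v and x = v and f = "v(n := EV v g)" and b = 1 and I = "{..<n}"])
    show "finite U" using U(1) finite_subset by blast
    show "\<exists>q. q \<noteq> 0 \<and> q \<in> coeffs_in (EV v ` polys U) \<and> poly q (v i) = 0" if i: "i \<in> {..<n}" for i
    proof -
      obtain q where q: "q \<in> coeffs_in (polys U)" "q \<noteq> 0" "poly q (pvar i) \<in> P"
        using algebraic_over_max_indep[OF P U] i by blast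
      have "lead_coeff q \<in> polys U" "lead_coeff q \<noteq> 0" using q by (auto simp: coeffs_in_def)
      then have "lead_coeff q \<notin> P" "lead_coeff q \<in> ?A" using U(2) polys_mono[OF U(1)] by (auto simp: indep_vars_def)
      then show ?thesis using v PA q by (intro generic_algebraic) auto
    qed
    show "1 \<in> EV v ` ?A" by (rule image_eqI[of _ _ 1]) (auto simp: EV_simps intro: polys_intros)
    show "1 * (v(n := EV v g)) j \<in> EV v ` ?A" if "j \<in> insert n U'" for j
    proof (cases "j = n")
      case False
      then show ?thesis using that U'(1)
        by (intro image_eqI[of _ _ "pvar j"]) (auto simp: EV_simps intro: pvar_in_polys)
    qed (use gA in simp)
    fix F assume F: "F \<in> polys (insert n U')" "EV (v(n := EV v g)) F = 0"
    obtain Q where Q: "Q \<in> coeffs_in (polys U')" "F = poly Q (pvar n)" using polys_insert_poly[OF F(1)] .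
    have "EV v (poly Q g) = 0" using F(2) unfolding Q(2) EV_upd_poly[OF Q(1) nU'] by (simp add: ev_poly[OF rhom_kap])
    moreover have "poly Q g \<in> ?A"
      using Q(1) subU' gA by (intro poly_in_subr[OF subr_polys]) (auto simp: coeffs_in_def)
    ultimately have "Q = 0" using zero Q(1) v by blast
    then show "F = 0" using Q(2) by simp
  qed (use finU' in auto)
  then show ?thesis using nU' finU' U U' by simp
qed

text \<open>The coordinate \<open>z n\<close> is the inverse of the value of \<open>g\<close>, so a
  high power of that value clears it from any polynomial.\<close>

lemma EV_image_localization:
  assumes g: "g \<in> polys {..<n}" and z: "EV z g * z n = 1" and p: "p \<in> polys {..<Suc n}"
  shows "\<exists>N. EV z g ^ N * EV z p \<in> EV z ` polys {..<n}"
proof -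
  let ?A = "EV z ` polys {..<n}"
  have A: "subr ?A" by (rule subr_image[OF rhom_EV subr_polys])
  have gA: "EV z g \<in> ?A" using g by blast
  let ?T = "{a. \<exists>N. EV z g ^ N * a \<in> ?A}"
  have up: "EV z g ^ N' * a \<in> ?A" if "EV z g ^ N * a \<in> ?A" "N \<le> N'" for N N' a
  proof -
    have "EV z g ^ (N' - N) * (EV z g ^ N * a) \<in> ?A" by (rule subr_mult[OF A subr_power[OF A gA] that(1)])
    then show ?thesis using that(2) by (simp flip: mult.assoc power_add)
  qed
  have T: "subr ?T"
    unfolding subr_def
  proof (intro conjI ballI)
    show "1 \<in> ?T" using subr_1[OF A] by (intro CollectI exI[of _ 0]) simp
    show "- a \<in> ?T" if a: "a \<in> ?T" for a
    proof -
      obtain N where "EV z g ^ N * a \<in> ?A" using a by blast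
      then have "EV z g ^ N * - a \<in> ?A" using subr_minus[OF A] by fastforce
      then show ?thesis by blast
    qed
    fix a b assume "a \<in> ?T" "b \<in> ?T"
    then obtain N N' where N: "EV z g ^ N * a \<in> ?A" "EV z g ^ N' * b \<in> ?A" by auto
    have "EV z g ^ (N + N') * (a + b) \<in> ?A"
      using up[OF N(1), of "N + N'"] up[OF N(2), of "N + N'"] by (auto simp only: distrib_left le_add1 le_add2 intro!: subr_add[OF A])
    then show "a + b \<in> ?T" by blast
    have "EV z g ^ (N + N') * (a * b) \<in> ?A"
      using subr_mult[OF A N] by (simp only: power_add mult_ac)
    then show "a * b \<in> ?T" by blast
  qed
  have "EV z p \<in> ?T"
  proof (rule ev_in_subr[OF rhom_kap T _ p])
    show "kap c \<in> ?T" for c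
      by (intro CollectI exI[of _ 0] image_eqI[of _ _ "pconst c"]) (auto simp: EV_simps pconst_in_polys)
    fix i assume "i \<in> {..<Suc n}"
    show "z i \<in> ?T"
    proof (cases "i = n")
      case True
      then have "EV z g ^ 1 * z i = 1" using z by simp
      then show ?thesis using subr_1[OF A] by (metis (mono_tags, lifting) mem_Collect_eq)
    next
      case False
      then show ?thesis using \<open>i \<in> {..<Suc n}\<close>
        by (intro CollectI exI[of _ 0] image_eqI[of _ _ "pvar i"]) (auto simp: EV_simps intro: pvar_in_polys)
    qed
  qed
  then show ?thesis by blast
qed

lemma EV_\<iota>_image: "EV (\<lambda>i. \<iota> (pvar i)) ` polys {..<d} = base d"
  by (simp add: EV_pvar base_def)

text \<open>The coordinate ring is a finite module over \<open>base d\<close>, so the growth count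
  applies with \<open>b = c = 1\<close>.\<close>

lemma indep_card_le_noether:
  assumes S: "EV v ` polys {..<n} = mod_span (base d) G" "finite G"
    and J: "J \<subseteq> {..<n}" and indep: "\<And>F. F \<in> polys J \<Longrightarrow> EV v F = 0 \<Longrightarrow> F = 0"
  shows "card J \<le> d"
proof -
  let ?S = "EV v ` polys {..<n}"
  have sS: "subr ?S" by (rule subr_image[OF rhom_EV subr_polys])
  have GS: "g \<in> ?S" if "g \<in> G" for g unfolding S(1) by (rule mod_span_base[OF subr_base S(2) that])
  have vS: "v i \<in> ?S" if "i < n" for i
    by (rule image_eqI[of _ _ "pvar i"]) (use that in \<open>auto simp: EV_simps intro: pvar_in_polys\<close>)
  obtain g0 where g0: "g0 \<in> G" "g0 \<noteq> 0"
  proof -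
    have "1 \<in> mod_span (base d) G" using subr_1[OF sS] S(1) by simp
    then obtain c where "1 = (\<Sum>g\<in>G. c g * g)" by (rule mod_spanE)
    then have "\<exists>g\<in>G. g \<noteq> 0" by (metis mult_zero_right sum.neutral zero_neq_one)
    then show ?thesis using that by blast
  qed
  have "card J \<le> card {..<d}"
  proof (rule alg_independent_card_le[OF rhom_kap, where u = "\<lambda>i. \<iota> (pvar i)" and x = v and f = v and b = 1 and c = 1 and I = "{..<n}" and G = G])
    show "1 \<in> EV (\<lambda>i. \<iota> (pvar i)) ` polys {..<d}" unfolding EV_\<iota>_image by (rule subr_1[OF subr_base])
    show "1 * v i * g \<in> mod_span (EV (\<lambda>i. \<iota> (pvar i)) ` polys {..<d}) G" if "i \<in> {..<n}" "g \<in> G" for i g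
      unfolding EV_\<iota>_image S(1)[symmetric] using that vS GS by (auto intro: subr_mult[OF sS])
    show "1 \<in> ?S" by (rule subr_1[OF sS])
    show "1 * v j \<in> ?S" if "j \<in> J" for j using that J vS by auto
  qed (use g0 S(2) indep J in \<open>auto intro: finite_subset\<close>)
  then show ?thesis by simp
qed

lemma min_prm_idl_insertD:
  assumes "min_prm A (idl_insert A P t) Q" "prm A P" "subr A"
  shows "prm A Q" "P \<subseteq> Q" "t \<in> Q"
  using assms idl_insert_supset[OF assms(3), of P t] idl_insert_mem[OF assms(3) prm_idl[OF assms(2)], of t]
  by (auto simp: min_prm_def)

text \<open>After inverting a suitable \<open>g \<notin> Q\<close>, every prime containing \<open>t\<close> has transcendence degree at
  most that of \<open>Q\<close>, so it suffices to find one of transcendence degree at least \<open>tr_deg n P - 1\<close>.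
  If a variable \<open>y\<^sub>j\<close> of a Noether normalization occurs in the norm of \<open>t\<close>, then no nonzero
  polynomial in the other variables is a multiple of \<open>t\<close>.\<close>
theorem principal_ideal_theorem:
  fixes P Q :: "'k mpoly set"
  assumes P: "prm (polys {..<n}) P" and t: "t \<in> polys {..<n}" "t \<notin> P"
    and Q: "min_prm (polys {..<n}) (idl_insert (polys {..<n}) P t) Q"
  shows "tr_deg n P \<le> tr_deg n Q + 1"
proof -
  let ?A = "polys {..<n} :: 'k mpoly set" and ?A1 = "polys {..<Suc n} :: 'k mpoly set"
  have A: "subr ?A" "subr ?A1" by (rule subr_polys)+
  have AA1: "?A \<subseteq> ?A1" by (rule polys_mono) auto
  let ?J = "idl_insert ?A P t"
  have J: "idl ?A ?J" by (rule idl_insert_idl[OF A(1) prm_idl[OF P] t(1)])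
  note Q' = min_prm_idl_insertD[OF Q P A(1)]
  have QA: "Q \<subseteq> ?A" using idl_sub[OF prm_idl[OF Q'(1)]] by blast
  obtain U where U: "U \<subseteq> {..<n}" "indep_vars Q U" "card U = tr_deg n Q" using tr_deg_attained[OF Q'(1)] .
  have "\<forall>i. \<exists>q. i < n \<longrightarrow> q \<in> coeffs_in (polys U) \<and> q \<noteq> 0 \<and> poly q (pvar i) \<in> Q"
    using algebraic_over_max_indep[OF Q'(1) U] by metis
  then obtain q where q: "\<And>i. i < n \<Longrightarrow> q i \<in> coeffs_in (polys U)" "\<And>i. i < n \<Longrightarrow> q i \<noteq> 0"
      "\<And>i. i < n \<Longrightarrow> poly (q i) (pvar i) \<in> Q" by metis
  \<comment> \<open>As \<open>Q\<close> is minimal over \<open>P + (t)\<close>, the relations found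
    modulo \<open>Q\<close> are nilpotent modulo \<open>P + (t)\<close> in the localization at
    \<open>Q\<close>.\<close>
  have "\<forall>i. \<exists>g m. i < n \<longrightarrow> g \<in> ?A - Q \<and> g * poly (q i) (pvar i) ^ m \<in> ?J"
    using min_prm_power_mult[OF A(1) J Q q(3)] by (metis DiffI)
  then obtain gg mm where gg: "\<And>i. i < n \<Longrightarrow> gg i \<in> ?A - Q" "\<And>i. i < n \<Longrightarrow> gg i * poly (q i) (pvar i) ^ mm i \<in> ?J"
    by metis
  have lc: "lead_coeff (q i) \<in> ?A - Q" if "i < n" for i
  proof -
    have "lead_coeff (q i) \<in> polys U" "lead_coeff (q i) \<noteq> 0" using q(1,2)[OF that] by (auto simp: coeffs_in_def)
    then show ?thesis using U(2) polys_mono[OF U(1)] by (auto simp: indep_vars_def)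
  qed
  \<comment> \<open>Primes that contain \<open>P + (t)\<close> and miss \<open>g\<close> contain all
    these relations, and the leading coefficients stay nonzero there. At such a prime all
    coordinates are thus algebraic over those in \<open>U\<close>.\<close>
  define g where "g = (\<Prod>i<n. gg i * lead_coeff (q i))"
  have g: "g \<in> ?A - Q"
    unfolding g_def
  proof (rule prm_prod[OF Q'(1) A(1)])
    fix i assume "i \<in> {..<n}"
    then have "i < n" by simp
    from gg(1)[OF this] lc[OF this] show "gg i * lead_coeff (q i) \<in> ?A - Q"
      using prm_prime[OF Q'(1)] subr_mult[OF A(1)] by blast
  qed simp
  have gP: "g \<notin> P" using g Q'(2) by blast
  obtain v0 where v0: "\<And>p. p \<in> ?A \<Longrightarrow> EV v0 p = 0 \<longleftrightarrow> p \<in> P" using noether_generic_point[OF P] by blast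
  have g0: "EV v0 g \<noteq> 0" using v0 g gP by blast
  \<comment> \<open>An additional coordinate of index \<open>n\<close>, equal to the inverse of
    \<open>g\<close>, presents the localization as a quotient of a polynomial ring by the prime
    \<open>P'\<close>.\<close>
  define v1 where "v1 = v0(n := inverse (EV v0 g))"
  have v1: "EV v1 p = EV v0 p" if "p \<in> ?A" for p unfolding v1_def using that by (rule EV_upd) simp
  have v1g: "EV v1 g * v1 n = 1" using g0 g v1[of g] by (simp add: v1_def)
  define P' where "P' = {p \<in> ?A1. EV v1 p \<in> {0}}"
  have P': "prm ?A1 P'"
    unfolding P'_def by (rule prm_vimage[OF rhom_EV A(2), of UNIV]) (auto simp: prm_def idl_def)
  obtain v d G where v: "\<And>p. p \<in> ?A1 \<Longrightarrow> EV v p = 0 \<longleftrightarrow> p \<in> P'" and G: "finite G"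
    and S: "EV v ` ?A1 = mod_span (base d) G" using noether_generic_point[OF P'] by blast
  have v01: "EV v p = 0 \<longleftrightarrow> EV v1 p = 0" if "p \<in> ?A1" for p using v[OF that] that by (simp add: P'_def)
  let ?S = "EV v ` ?A1"
  have sS: "subr ?S" by (rule subr_image[OF rhom_EV A(2)])
  have tS: "EV v t \<in> ?S" "EV v t \<noteq> 0"
    using t AA1 v01[of t] v1[of t] v0[of t] by auto
  have kapS: "kap c \<in> ?S" for c by (rule image_eqI[of _ _ "pconst c"]) (auto simp: EV_simps pconst_in_polys)
  obtain a r where a: "a \<in> polys {..<d}" "a \<noteq> 0" "\<exists>s\<in>?S. \<iota> a = EV v t * s"
    and dvd: "\<And>f s. f \<in> polys {..<d} \<Longrightarrow> s \<in> ?S \<Longrightarrow> \<iota> f = EV v t * s \<Longrightarrow> a dvd f ^ r"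
    using exists_norm[OF sS S G tS] by blast
  \<comment> \<open>An equation \<open>t * s = 1\<close> would, after multiplication by a power of
    \<open>g\<close>, put \<open>g ^ N - t * s'\<close> into \<open>P\<close> and hence
    \<open>g ^ N\<close> into \<open>Q\<close>.\<close>
  have nonunit: "EV v t * s \<noteq> 1" if "s \<in> ?S" for s
  proof
    assume eq: "EV v t * s = 1"
    obtain s0 where s0: "s0 \<in> ?A1" "s = EV v s0" using \<open>s \<in> ?S\<close> by blast
    have "EV v (1 - t * s0) = 0" using eq by (simp add: s0 EV_simps)
    moreover have "1 - t * s0 \<in> ?A1" using t AA1 s0 by (intro subr_diff[OF A(2)] subr_1[OF A(2)] subr_mult[OF A(2)]) auto
    ultimately have "EV v1 (1 - t * s0) = 0" using v01 by blast
    then have 1: "EV v0 t * EV v1 s0 = 1" using v1[OF t(1)] by (simp add: EV_simps)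
    obtain N s' where s': "EV v1 g ^ N * EV v1 s0 = EV v1 s'" "s' \<in> ?A"
      using EV_image_localization[OF _ v1g s0(1)] g by blast
    have "EV v0 (g ^ N - t * s') = EV v0 g ^ N - EV v0 t * EV v0 s'" by (simp add: EV_simps)
    also have "EV v0 s' = EV v0 g ^ N * EV v1 s0" using s' v1[of s'] v1[of g] g by simp
    also have "EV v0 g ^ N - EV v0 t * (EV v0 g ^ N * EV v1 s0) = EV v0 g ^ N * (1 - EV v0 t * EV v1 s0)"
      by (simp add: algebra_simps)
    finally have "EV v0 (g ^ N - t * s') = 0" using 1 by simp
    moreover have "g ^ N - t * s' \<in> ?A" using g t s' by (auto intro!: polys_intros)
    ultimately have "g ^ N - t * s' \<in> Q" using v0 Q'(2) by blast
    then have "g ^ N - t * s' + t * s' \<in> Q"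
      by (rule idl_add[OF prm_idl[OF Q'(1)]]) (rule idl_mult2[OF prm_idl[OF Q'(1)] s'(2) Q'(3)])
    then show False using prm_power[OF Q'(1) A(1), of g N] g by simp
  qed
  \<comment> \<open>A constant norm would make \<open>t\<close> a unit, so some variable occurs in
    \<open>a\<close>.\<close>
  obtain j where j: "j < d" "0 < top_wt (var_wt j) a"
  proof -
    have "a \<notin> polys {}"
    proof
      assume "a \<in> polys {}"
      then obtain c where c: "a = pconst c" using polys_empty by blast
      obtain s where s: "s \<in> ?S" "\<iota> a = EV v t * s" using a(3) by blast
      have "EV v t * (s * kap (inverse c)) = kap c * kap (inverse c)"
        using s by (simp add: c kap_def mult.assoc)
      also have "\<dots> = kap (c * inverse c)" by (simp add: rhom_mult[OF rhom_kap])
      also have "\<dots> = 1" 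
      proof -
        have "c \<noteq> 0" using a(2) c by auto
        then show ?thesis by (simp add: rhom_1[OF rhom_kap])
      qed
      finally show False using nonunit[of "s * kap (inverse c)"] s kapS by (auto intro: subr_mult[OF sS])
    qed
    then obtain j where "top_wt (var_wt j) a \<noteq> 0" using polys_iff_top_var_wt[OF a(2)] by blast
    moreover from this have "j < d" using a(1) polys_iff_top_var_wt[OF a(2), of "{..<d}"] by auto
    ultimately show ?thesis using that top_var_wt_nonneg[OF a(2), of j] by force
  qed
  let ?K = "{..<d} - {j}"
  have "\<forall>l. \<exists>h. l < d \<longrightarrow> h \<in> ?A1 \<and> EV v h = \<iota> (pvar l)"
    using base_subset_span[OF sS S] pvar_in_polys unfolding base_def by (metis (no_types, lifting) imageE image_eqI lessThan_iff subset_iff)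
  then obtain h where h: "\<And>l. l < d \<Longrightarrow> h l \<in> ?A1" "\<And>l. l < d \<Longrightarrow> EV v (h l) = \<iota> (pvar l)" by metis
  \<comment> \<open>Elements represented by nonzero polynomials in the \<open>d - 1\<close>
    variables other than \<open>j\<close>; modulo a prime avoiding them these variables stay
    independent.\<close>
  define D where "D = {p \<in> ?A1. \<exists>F\<in>polys ?K. F \<noteq> 0 \<and> EV v p = \<iota> F}"
  let ?J1 = "idl_insert ?A1 P' t"
  have tA1: "t \<in> ?A1" using t AA1 by blast
  have J1: "idl ?A1 ?J1" by (rule idl_insert_idl[OF A(2) prm_idl[OF P'] tA1])
  obtain R where R: "prm ?A1 R" "?J1 \<subseteq> R" "R \<inter> D = {}"
  proof (rule exists_prm_avoiding[OF A(2) J1, of D])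
    show "D \<subseteq> ?A1" by (auto simp: D_def)
    show "1 \<in> D" unfolding D_def using subr_1[OF A(2)] subr_1[OF subr_polys, of ?K]
      by (intro CollectI conjI bexI[of _ 1]) (auto simp: EV_simps \<iota>_simps)
    show "x * y \<in> D" if "x \<in> D" "y \<in> D" for x y
    proof -
      from that obtain F F' where "F \<in> polys ?K" "F' \<in> polys ?K" "F \<noteq> 0" "F' \<noteq> 0" "EV v x = \<iota> F" "EV v y = \<iota> F'"
        by (auto simp: D_def)
      then have "F * F' \<in> polys ?K" "F * F' \<noteq> 0" "EV v (x * y) = \<iota> (F * F')"
        by (auto simp: EV_simps \<iota>_simps intro: subr_mult[OF subr_polys])
      then show ?thesis using that subr_mult[OF A(2)] unfolding D_def by blast
    qed
    \<comment> \<open>Otherwise the divisibility property of the norm makes \<open>a\<close> divide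
      a power of a nonzero polynomial that is free of the variable \<open>j\<close>.\<close>
    show "?J1 \<inter> D = {}"
    proof (rule ccontr)
      assume "?J1 \<inter> D \<noteq> {}"
      then obtain p' b F where *: "p' \<in> P'" "b \<in> ?A1" "F \<in> polys ?K" "F \<noteq> 0" "EV v (p' + b * t) = \<iota> F"
        unfolding D_def idl_insert_def by blast
      have "EV v p' = 0" using * v idl_sub[OF prm_idl[OF P']] by blast
      then have "\<iota> F = EV v t * EV v b" using *(5) by (simp add: EV_simps mult.commute)
      then have "a dvd F ^ r"
        using *(2,3) polys_mono[of ?K "{..<d}"] by (intro dvd[of F "EV v b"]) auto
      then obtain e where e: "F ^ r = a * e" by (elim dvdE)
      have "e \<noteq> 0" using e *(4) by (metis mult_zero_right power_not_zero)
      have "F ^ r \<in> polys ?K" using *(3) by (rule subr_power[OF subr_polys])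
      then have "top_wt (var_wt j) (F ^ r) = 0" using *(4) polys_iff_top_var_wt[of "F ^ r" ?K] by auto
      moreover have "top_wt (var_wt j) (F ^ r) = top_wt (var_wt j) a + top_wt (var_wt j) e"
        unfolding e using a(2) \<open>e \<noteq> 0\<close> by (rule top_wt_mult[OF additive_var_wt])
      ultimately show False using j(2) top_var_wt_nonneg[OF \<open>e \<noteq> 0\<close>, of j] by simp
    qed
  qed
  obtain z where z: "\<And>p. p \<in> ?A1 \<Longrightarrow> EV z p = 0 \<longleftrightarrow> p \<in> R" using noether_generic_point[OF R(1)] by blast
  have P'R: "P' \<subseteq> R" using R(2) idl_insert_supset[OF A(2), of P' t] by blast
  have tR: "t \<in> R" using R(2) idl_insert_mem[OF A(2) prm_idl[OF P'], of t] by blast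
  have JR: "?J \<subseteq> R"
  proof -
    have "P \<subseteq> P'"
      unfolding P'_def using v0 v1 idl_sub[OF prm_idl[OF P]] AA1 by auto
    then show ?thesis using P'R tR AA1
      by (auto simp: idl_insert_def intro!: idl_add[OF prm_idl[OF R(1)]] idl_mult[OF prm_idl[OF R(1)]])
  qed
  have zg: "EV z g * z n = 1"
  proof -
    have gn: "g * pvar n - 1 \<in> ?A1" using g AA1 by (intro subr_diff[OF A(2)] subr_mult[OF A(2)] subr_1[OF A(2)] pvar_in_polys) auto
    then have "g * pvar n - 1 \<in> P'" unfolding P'_def using v1g by (simp add: EV_simps)
    then have "EV z (g * pvar n - 1) = 0" using z[OF gn] P'R by blast
    then show ?thesis by (simp add: EV_simps)
  qed
  then have zg0: "EV z g \<noteq> 0" by auto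
  have zgi: "EV z (gg i) \<noteq> 0" "EV z (lead_coeff (q i)) \<noteq> 0" if "i < n" for i
    using zg0 that by (auto simp: g_def EV_simps)
  \<comment> \<open>Modulo \<open>R\<close> the lifts \<open>h l\<close> of the \<open>d - 1\<close>
    variables are independent, while all coordinates are algebraic over those in \<open>U\<close>.
    Powers of \<open>g\<close> remove the additional coordinate from the lifts.\<close>
  have "card ?K \<le> card U"
  proof -
    have "\<forall>l. \<exists>N. l < d \<longrightarrow> EV z g ^ N * EV z (h l) \<in> EV z ` ?A"
      using EV_image_localization[OF _ zg h(1)] g by blast
    then obtain N where N: "\<And>l. l < d \<Longrightarrow> EV z g ^ N l * EV z (h l) \<in> EV z ` ?A" by metis
    let ?N = "\<Sum>l<d. N l"
    have szA: "subr (EV z ` ?A)" by (rule subr_image[OF rhom_EV A(1)])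
    have zgA: "EV z g \<in> EV z ` ?A" using g by blast
    show ?thesis
    proof (rule alg_independent_card_le_algebraic[OF rhom_kap, where u = z and x = z and f = "\<lambda>l. EV z (h l)" and b = "EV z g ^ ?N" and I = "{..<n}"])
      show "finite U" using U(1) finite_subset by blast
      show "\<exists>q. q \<noteq> 0 \<and> q \<in> coeffs_in (EV z ` polys U) \<and> poly q (z i) = 0" if "i \<in> {..<n}" for i
      proof -
        have i: "i < n" using that by simp
        have pA: "poly (q i) (pvar i) \<in> ?A1" using q(3)[OF i] QA AA1 by blast
        have "gg i * poly (q i) (pvar i) ^ mm i \<in> R" using gg(2)[OF i] JR by blast
        then have "EV z (gg i * poly (q i) (pvar i) ^ mm i) = 0"
          using z idl_sub[OF prm_idl[OF R(1)]] by blast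
        then have "EV z (poly (q i) (pvar i)) = 0" using zgi(1)[OF i] by (simp add: EV_simps)
        then have "poly (q i) (pvar i) \<in> R" using z[OF pA] by blast
        then show ?thesis
          using z idl_sub[OF prm_idl[OF R(1)]] zgi(2)[OF i] by (intro generic_algebraic[OF q(1)[OF i]]) blast+
      qed
      show "EV z g ^ ?N \<in> EV z ` ?A" by (rule subr_power[OF szA zgA])
      show "EV z g ^ ?N * EV z (h l) \<in> EV z ` ?A" if "l \<in> ?K" for l
      proof -
        have l: "l < d" using that by simp
        then have "N l \<le> ?N" by (intro member_le_sum) auto
        then have "EV z g ^ ?N * EV z (h l) = EV z g ^ (?N - N l) * (EV z g ^ N l * EV z (h l))"
          by (simp flip: mult.assoc power_add)
        then show ?thesis using subr_mult[OF szA subr_power[OF szA zgA] N[OF l]] by (simp only:)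
      qed
      fix F assume F: "F \<in> polys ?K" "EV (\<lambda>l. EV z (h l)) F = 0"
      show "F = 0"
      proof (rule ccontr)
        assume "F \<noteq> 0"
        let ?p = "ev pconst h F"
        have pA: "?p \<in> ?A1" using F(1) by (rule ev_polys) (use h(1) in auto)
        have "EV z ?p = 0" using F(2) by (simp add: ev_ev[OF rhom_kap])
        then have "?p \<in> R" using z[OF pA] by blast
        moreover have "EV v ?p = EV (\<lambda>i. \<iota> (pvar i)) F"
          unfolding ev_ev[OF rhom_kap] using F(1) by (rule ev_cong[OF rhom_kap]) (use h(2) in auto)
        then have "EV v ?p = \<iota> F" by (simp only: EV_pvar)
        then have "?p \<in> D" using pA F(1) \<open>F \<noteq> 0\<close> by (auto simp: D_def)
        ultimately show False using R(3) by blast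
      qed
    qed (use zg0 in auto)
  qed
  then have dQ: "d \<le> tr_deg n Q + 1" using U(3) j(1) by simp
  obtain V where V: "V \<subseteq> {..<n}" "indep_vars P V" "card V = tr_deg n P" using tr_deg_attained[OF P] .
  have "card V \<le> d"
  proof (rule indep_card_le_noether[OF S G])
    show "V \<subseteq> {..<Suc n}" using V(1) by auto
    fix F assume F: "F \<in> polys V" "EV v F = 0"
    have "F \<in> ?A" using F(1) polys_mono[OF V(1)] by blast
    then have "F \<in> P" using F(2) AA1 v01[of F] v1[of F] v0[of F] by auto
    then show "F = 0" using F(1) V(2) by (auto simp: indep_vars_def)
  qed
  then show ?thesis using V(3) dQ by simp
qed

text \<open>\<open>t\<close> lifts the first variable of a Noether normalization, which exists
  because \<open>d\<close> is at least the transcendence degree. If \<open>t\<close> were a unit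
  modulo \<open>P\<close>, normality would make the inverse of a variable a polynomial.\<close>

lemma exists_proper_insert:
  fixes P :: "'k mpoly set"
  assumes P: "prm (polys {..<n}) P" and td: "tr_deg n P > 0"
  obtains t where "t \<in> polys {..<n}" "t \<notin> P" "1 \<notin> idl_insert (polys {..<n}) P t"
proof -
  let ?A = "polys {..<n} :: 'k mpoly set"
  obtain v d G where v: "\<And>p. p \<in> ?A \<Longrightarrow> EV v p = 0 \<longleftrightarrow> p \<in> P" and G: "finite G"
    and S: "EV v ` ?A = mod_span (base d) G" using noether_generic_point[OF P] by blast
  have sS: "subr (EV v ` ?A)" by (rule subr_image[OF rhom_EV subr_polys])
  obtain V where V: "V \<subseteq> {..<n}" "indep_vars P V" "card V = tr_deg n P" using tr_deg_attained[OF P] .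
  have "card V \<le> d"
  proof (rule indep_card_le_noether[OF S G V(1)])
    fix F assume F: "F \<in> polys V" "EV v F = 0"
    then have "F \<in> P" using v[of F] polys_mono[OF V(1)] by blast
    then show "F = 0" using F(1) V(2) by (auto simp: indep_vars_def)
  qed
  then have d: "0 < d" using V(3) td by simp
  then have "\<iota> (pvar 0) \<in> EV v ` ?A"
    using base_subset_span[OF sS S] pvar_in_polys[of 0 "{..<d}"] by (auto simp: base_def)
  then obtain t where t: "t \<in> ?A" "EV v t = \<iota> (pvar 0)" by (metis imageE)
  note p0 = pvar_nonzero[of 0, where ?'a = 'k]
  have tP: "t \<notin> P" using v[OF t(1)] t(2) p0 by simp
  have "1 \<notin> idl_insert ?A P t"
  proof
    assume "1 \<in> idl_insert ?A P t"
    then obtain p b where pb: "1 = p + b * t" "p \<in> P" "b \<in> ?A" by (auto simp: idl_insert_def)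
    have "EV v p = 0" using v pb(2) idl_sub[OF prm_idl[OF P]] by blast
    then have "1 = EV v b * \<iota> (pvar 0)" using arg_cong[OF pb(1), of "EV v"] by (simp add: EV_simps t(2))
    moreover have "emb (inverse (of_mpoly (pvar 0))) * \<iota> (pvar 0) = 1"
      unfolding \<iota>_def rhom_mult[OF rhom_emb, symmetric] using p0 by (simp add: rhom_1[OF rhom_emb])
    ultimately have "EV v b * \<iota> (pvar 0) = emb (inverse (of_mpoly (pvar 0))) * \<iota> (pvar 0)" by simp
    moreover have "\<iota> (pvar 0) \<noteq> 0" using p0 by simp
    ultimately have "EV v b = emb (inverse (of_mpoly (pvar 0)))" using mult_right_cancel by blast
    then have "emb (inverse (of_mpoly (pvar 0))) \<in> EV v ` ?A" using pb(3) by (metis imageI)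
    then obtain c where "inverse (of_mpoly (pvar 0)) = of_mpoly (c :: 'k mpoly)"
      using integral_in_base[OF sS _ G] S by blast
    then have "of_mpoly (c * pvar 0) = 1" using p0 by (metis left_inverse of_mpoly_eq_0_iff rhom_mult[OF rhom_of_mpoly])
    then have c: "c * pvar 0 = 1" by (metis of_mpoly_1 of_mpoly_eq_iff)
    then have "c \<noteq> 0" by auto
    then have "top_wt (var_wt 0) c + top_wt (var_wt 0) (pvar 0 :: 'k mpoly) = top_wt (var_wt 0) (1 :: 'k mpoly)"
      using top_wt_mult[OF additive_var_wt \<open>c \<noteq> 0\<close> p0, of 0] c by simp
    moreover have "top_wt (var_wt 0) (1 :: 'k mpoly) = 0" by (simp add: top_wt_def var_wt_def)
    moreover have "top_wt (var_wt 0) (pvar 0 :: 'k mpoly) = 1" by (simp add: top_wt_def var_wt_def pvar_def)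
    ultimately show False using top_var_wt_nonneg[OF \<open>c \<noteq> 0\<close>, of 0] by simp
  qed
  then show ?thesis using that t(1) tP by blast
qed

end


section \<open>Chains of primes\<close>

global_interpretation ac: universal_field "to_ac :: 'k::field mpoly fract \<Rightarrow> 'k mpoly fract alg_closure"
  by unfold_locales (simp add: rhom_def)

text \<open>The order-theoretic part of \<open>krull_dim\<close>, for any family of sets: the primes
  of quotients and localizations can then be exchanged for families of primes of the polynomial
  ring.\<close>

definition chain_dim :: "'a set set \<Rightarrow> ereal" where
  "chain_dim F = Sup {ereal (real l) | l. \<exists>C. (\<forall>i\<le>l. C i \<in> F) \<and> (\<forall>i<l. C i \<subset> C (Suc i))}"

lemma chain_dim_ge:
  "(\<And>i. i \<le> l \<Longrightarrow> C i \<in> F) \<Longrightarrow> (\<And>i. i < l \<Longrightarrow> C i \<subset> C (Suc i)) \<Longrightarrow> ereal (real l) \<le> chain_dim F"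
  unfolding chain_dim_def by (rule Sup_upper) blast

lemma chain_dim_le:
  assumes "\<And>l C. (\<And>i. i \<le> l \<Longrightarrow> C i \<in> F) \<Longrightarrow> (\<And>i. i < l \<Longrightarrow> C i \<subset> C (Suc i)) \<Longrightarrow> ereal (real l) \<le> b"
  shows "chain_dim F \<le> b"
  unfolding chain_dim_def by (rule Sup_least) (use assms in blast)

lemma chain_dim_mono: "F \<subseteq> F' \<Longrightarrow> chain_dim F \<le> chain_dim F'"
  by (rule chain_dim_le, rule chain_dim_ge) blast+

definition primes_between :: "nat \<Rightarrow> 'k::field mpoly set \<Rightarrow> 'k mpoly set \<Rightarrow> 'k mpoly set set" where
  "primes_between n M J = {Q. prm (polys {..<n}) Q \<and> J \<subseteq> Q \<and> Q \<subseteq> M}"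

text \<open>\<open>M\<close> will be the whole polynomial ring or the ideal of the origin.\<close>
definition extendable :: "nat \<Rightarrow> 'k::field mpoly set \<Rightarrow> bool" where
  "extendable n M \<longleftrightarrow> (\<forall>P. prm (polys {..<n}) P \<longrightarrow> P \<subseteq> M \<longrightarrow> tr_deg n P > 0 \<longrightarrow>
     (\<exists>t R. t \<in> polys {..<n} \<and> t \<notin> P \<and> prm (polys {..<n}) R \<and> idl_insert (polys {..<n}) P t \<subseteq> R \<and> R \<subseteq> M))"

lemma tr_deg_mono:
  assumes "prm (polys {..<n}) P" "prm (polys {..<n}) Q" "P \<subseteq> Q"
  shows "tr_deg n Q \<le> tr_deg n P"
  using ac.tr_deg_strict_mono[OF assms(1,2)] assms(3) by (cases "P = Q") (auto intro: less_imp_le)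

text \<open>Each step passes to a minimal prime over \<open>P + (t)\<close>, where the transcendence
  degree drops by exactly one, by strict monotonicity on one side and the principal ideal theorem on
  the other. Choosing that prime below \<open>R\<close> keeps the chain inside
  \<open>M\<close>.\<close>

lemma exists_prime_chain:
  assumes M: "extendable n M" and "prm (polys {..<n}) P" "P \<subseteq> M"
  shows "\<exists>C. C 0 = P \<and> (\<forall>i\<le>tr_deg n P. C i \<in> primes_between n M P) \<and> (\<forall>i<tr_deg n P. C i \<subset> C (Suc i))"
  using assms(2,3)
proof (induction "tr_deg n P" arbitrary: P)
  case 0
  then show ?case by (intro exI[of _ "\<lambda>_. P"]) (auto simp: primes_between_def)
next
  case (Suc k)
  let ?A = "polys {..<n} :: 'a mpoly set"
  obtain t R where t: "t \<in> ?A" "t \<notin> P" "prm ?A R" "idl_insert ?A P t \<subseteq> R" "R \<subseteq> M"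
    using M Suc.prems Suc.hyps(2) unfolding extendable_def by (metis zero_less_Suc)
  obtain Q where Q: "min_prm ?A (idl_insert ?A P t) Q" "Q \<subseteq> R" using exists_min_prm_below[OF t(3,4)] .
  note Q' = ac.min_prm_idl_insertD[OF Q(1) Suc.prems(1) subr_polys]
  have lt: "P \<subset> Q" using Q' t(2) by blast
  have "tr_deg n Q < tr_deg n P" by (rule ac.tr_deg_strict_mono[OF Suc.prems(1) Q'(1) lt])
  moreover have "tr_deg n P \<le> tr_deg n Q + 1" by (rule ac.principal_ideal_theorem[OF Suc.prems(1) t(1,2) Q(1)])
  ultimately have k: "k = tr_deg n Q" using Suc.hyps(2) by simp
  obtain C where C: "C 0 = Q" "\<forall>i\<le>k. C i \<in> primes_between n M Q" "\<forall>i<k. C i \<subset> C (Suc i)"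
    using Suc.hyps(1)[OF k Q'(1)] Q(2) t(5) k by auto
  show ?case
  proof (intro exI conjI allI impI)
    let ?C = "case_nat P C"
    show "?C 0 = P" by simp
    show "?C i \<in> primes_between n M P" if "i \<le> tr_deg n P" for i
    proof (cases i)
      case (Suc j)
      then have "C j \<in> primes_between n M Q" using that C(2) Suc.hyps(2) by simp
      then show ?thesis using Suc lt by (auto simp: primes_between_def)
    qed (use Suc.prems in \<open>auto simp: primes_between_def\<close>)
    show "?C i \<subset> ?C (Suc i)" if "i < tr_deg n P" for i
      using that C(1,3) lt Suc.hyps(2)[symmetric] by (cases i) auto
  qed
qed

lemma chain_length_le_tr_deg:
  assumes C: "\<And>i. i \<le> l \<Longrightarrow> prm (polys {..<n}) (C i)" "\<And>i. i < l \<Longrightarrow> C i \<subset> C (Suc i)"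
  shows "l \<le> tr_deg n (C 0)"
proof -
  have "i + tr_deg n (C i) \<le> tr_deg n (C 0)" if "i \<le> l" for i
    using that
  proof (induction i)
    case (Suc i)
    have "tr_deg n (C (Suc i)) < tr_deg n (C i)"
      using Suc.prems C by (intro ac.tr_deg_strict_mono) auto
    then show ?case using Suc by simp
  qed simp
  from this[of l] show ?thesis by simp
qed

theorem chain_dim_eq_tr_deg:
  assumes M: "extendable n M" and P: "prm (polys {..<n}) P" "P \<subseteq> M"
  shows "chain_dim (primes_between n M P) = ereal (real (tr_deg n P))"
proof (rule antisym)
  obtain C where "\<forall>i\<le>tr_deg n P. C i \<in> primes_between n M P" "\<forall>i<tr_deg n P. C i \<subset> C (Suc i)"
    using exists_prime_chain[OF assms] by blast
  then show "ereal (real (tr_deg n P)) \<le> chain_dim (primes_between n M P)" by (intro chain_dim_ge[of _ C]) blast+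
  show "chain_dim (primes_between n M P) \<le> ereal (real (tr_deg n P))"
  proof (rule chain_dim_le)
    fix l C assume C: "\<And>i. i \<le> l \<Longrightarrow> C i \<in> primes_between n M P" "\<And>i. i < l \<Longrightarrow> C i \<subset> C (Suc i)"
    have "l \<le> tr_deg n (C 0)" using C by (intro chain_length_le_tr_deg) (auto simp: primes_between_def)
    also have "\<dots> \<le> tr_deg n P" using C(1)[of 0] P(1) by (intro tr_deg_mono) (auto simp: primes_between_def)
    finally show "ereal (real l) \<le> ereal (real (tr_deg n P))" by simp
  qed
qed

text \<open>With \<open>M\<close> the whole ring this is equidimensionality of the quotient by
  \<open>J\<close>; with \<open>M\<close> the ideal of the origin it expresses the same for the
  localization, whose primes correspond to those inside \<open>M\<close>.\<close>

definition equidim :: "nat \<Rightarrow> 'k::field mpoly set \<Rightarrow> 'k mpoly set \<Rightarrow> bool" where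
  "equidim n M J \<longleftrightarrow> (\<forall>Q. min_prm (polys {..<n}) J Q \<longrightarrow> Q \<subseteq> M \<longrightarrow>
     chain_dim (primes_between n M Q) = chain_dim (primes_between n M J))"

text \<open>The bottom of a chain contains a minimal prime of \<open>J\<close>, so the dimension
  over \<open>J\<close> is the largest transcendence degree of a minimal prime inside
  \<open>M\<close>; each single one attains its own.\<close>

theorem equidim_iff:
  assumes M: "extendable n M"
  shows "equidim n M J \<longleftrightarrow> (\<forall>Q Q'. min_prm (polys {..<n}) J Q \<longrightarrow> Q \<subseteq> M \<longrightarrow>
     min_prm (polys {..<n}) J Q' \<longrightarrow> Q' \<subseteq> M \<longrightarrow> tr_deg n Q = tr_deg n Q')"
proof
  assume eq: "equidim n M J"
  show "\<forall>Q Q'. min_prm (polys {..<n}) J Q \<longrightarrow> Q \<subseteq> M \<longrightarrow>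
     min_prm (polys {..<n}) J Q' \<longrightarrow> Q' \<subseteq> M \<longrightarrow> tr_deg n Q = tr_deg n Q'"
  proof (intro allI impI)
    fix Q Q' assume *: "min_prm (polys {..<n}) J Q" "Q \<subseteq> M" "min_prm (polys {..<n}) J Q'" "Q' \<subseteq> M"
    then have "prm (polys {..<n}) Q" "prm (polys {..<n}) Q'" by (auto simp: min_prm_def)
    then have "ereal (real (tr_deg n Q)) = ereal (real (tr_deg n Q'))"
      using eq * chain_dim_eq_tr_deg[OF M] unfolding equidim_def by metis
    then show "tr_deg n Q = tr_deg n Q'" by simp
  qed
next
  assume eq: "\<forall>Q Q'. min_prm (polys {..<n}) J Q \<longrightarrow> Q \<subseteq> M \<longrightarrow>
     min_prm (polys {..<n}) J Q' \<longrightarrow> Q' \<subseteq> M \<longrightarrow> tr_deg n Q = tr_deg n Q'"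
  show "equidim n M J"
    unfolding equidim_def
  proof (intro allI impI antisym)
    fix Q assume Q: "min_prm (polys {..<n}) J Q" "Q \<subseteq> M"
    then have pQ: "prm (polys {..<n}) Q" by (simp add: min_prm_def)
    show "chain_dim (primes_between n M Q) \<le> chain_dim (primes_between n M J)"
      using Q by (intro chain_dim_mono) (auto simp: primes_between_def min_prm_def)
    show "chain_dim (primes_between n M J) \<le> chain_dim (primes_between n M Q)"
      unfolding chain_dim_eq_tr_deg[OF M pQ Q(2)]
    proof (rule chain_dim_le)
      fix l C assume C: "\<And>i. i \<le> l \<Longrightarrow> C i \<in> primes_between n M J" "\<And>i. i < l \<Longrightarrow> C i \<subset> C (Suc i)"
      have C0: "prm (polys {..<n}) (C 0)" "J \<subseteq> C 0" "C 0 \<subseteq> M" using C(1)[of 0] by (auto simp: primes_between_def)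
      obtain Q' where Q': "min_prm (polys {..<n}) J Q'" "Q' \<subseteq> C 0" using exists_min_prm_below[OF C0(1,2)] .
      have "l \<le> tr_deg n (C 0)" using C by (intro chain_length_le_tr_deg) (auto simp: primes_between_def)
      also have "\<dots> \<le> tr_deg n Q'" using Q' C0(1) by (intro tr_deg_mono) (auto simp: min_prm_def)
      also have "tr_deg n Q' = tr_deg n Q" using eq Q Q' C0(3) by blast
      finally show "ereal (real l) \<le> ereal (real (tr_deg n Q))" by simp
    qed
  qed
qed

section \<open>Extendability for the polynomial ring and for the ideal of the origin\<close>

lemma extendable_polys: "extendable n (polys {..<n})"
  unfolding extendable_def
proof (intro allI impI)
  let ?A = "polys {..<n} :: 'a mpoly set"
  fix P :: "'a mpoly set" assume P: "prm ?A P" "tr_deg n P > 0"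
  obtain t where t: "t \<in> ?A" "t \<notin> P" "1 \<notin> idl_insert ?A P t" using ac.exists_proper_insert[OF P] .
  obtain R where "prm ?A R" "idl_insert ?A P t \<subseteq> R"
    by (rule exists_prm_avoiding[OF subr_polys idl_insert_idl[OF subr_polys prm_idl[OF P(1)] t(1)], of "{1}"])
      (use t(3) in \<open>auto intro: polys_intros\<close>)
  then show "\<exists>t R. t \<in> ?A \<and> t \<notin> P \<and> prm ?A R \<and> idl_insert ?A P t \<subseteq> R \<and> R \<subseteq> ?A"
    using t(1,2) idl_sub[OF prm_idl] by blast
qed

definition origin_polys :: "nat \<Rightarrow> 'k::field mpoly set" where
  "origin_polys n = {p \<in> polys {..<n}. Poly_Mapping.lookup p 0 = 0}"

lemma lookup_pvar_0: "Poly_Mapping.lookup (pvar i) 0 = 0"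
proof -
  have "Poly_Mapping.single i 1 \<noteq> (0 :: nat \<Rightarrow>\<^sub>0 nat)"
    by (metis lookup_single_eq lookup_zero zero_neq_one)
  then show ?thesis by (simp add: pvar_def lookup_single_not_eq)
qed

text \<open>The constant term is the value at the origin.\<close>

lemma rhom_const_term: "rhom (\<lambda>p :: 'k::field mpoly. Poly_Mapping.lookup p 0)"
proof -
  have *: "ev (\<lambda>c. c) (\<lambda>_. 0) p = Poly_Mapping.lookup p 0" for p :: "'k mpoly"
  proof -
    have mv: "monom_val (\<lambda>_. 0 :: 'k) m = (if m = 0 then 1 else 0)" for m
    proof (cases "m = 0")
      case False
      then obtain i where "i \<in> Poly_Mapping.keys m" by (metis keys_eq_empty ex_in_conv)
      then have "monom_val (\<lambda>_. 0 :: 'k) m = 0"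
        unfolding monom_val_def by (intro prod_zero) (auto simp: in_keys_iff)
      then show ?thesis using False by simp
    qed simp
    have "ev (\<lambda>c. c) (\<lambda>_. 0) p = (\<Sum>m\<in>Poly_Mapping.keys p. if m = 0 then Poly_Mapping.lookup p m else 0)"
      unfolding ev_def mv by (intro sum.cong) auto
    then show ?thesis by (simp add: in_keys_iff)
  qed
  have "rhom (ev (\<lambda>c::'k. c) (\<lambda>_. 0))" by (rule rhom_ev) (simp add: rhom_def)
  then show ?thesis using * by (simp add: rhom_def)
qed

lemma prm_origin_polys: "prm (polys {..<n}) (origin_polys n)"
proof -
  have "prm (polys {..<n}) {p \<in> polys {..<n}. (Poly_Mapping.lookup p 0 :: 'a) \<in> {0}}"
    by (rule prm_vimage[OF rhom_const_term subr_polys, of UNIV]) (auto simp: prm_def idl_def)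
  then show ?thesis by (simp add: origin_polys_def)
qed

text \<open>A variable from an independent set lies in the ideal of the origin but not in
  \<open>P\<close>, and the ideal of the origin itself serves as the prime \<open>R\<close>.\<close>

lemma extendable_origin_polys: "extendable n (origin_polys n)"
  unfolding extendable_def
proof (intro allI impI)
  let ?A = "polys {..<n} :: 'a mpoly set"
  fix P :: "'a mpoly set" assume P: "prm ?A P" "P \<subseteq> origin_polys n" "tr_deg n P > 0"
  obtain U where U: "U \<subseteq> {..<n}" "indep_vars P U" "card U = tr_deg n P" using tr_deg_attained[OF P(1)] .
  then obtain i where i: "i \<in> U" using P(3) by fastforce
  have "pvar i \<in> origin_polys n" using i U(1)
    by (auto simp: origin_polys_def lookup_pvar_0 intro: pvar_in_polys)
  moreover have "pvar i \<notin> P"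
  proof
    assume "pvar i \<in> P"
    then have "pvar i = (0 :: 'a mpoly)" using U(2) pvar_in_polys[OF i] by (auto simp: indep_vars_def)
    then show False by simp
  qed
  moreover from calculation have "idl_insert ?A P (pvar i) \<subseteq> origin_polys n"
    using P(2) by (intro idl_insert_least prm_idl prm_origin_polys)
  ultimately show "\<exists>t R. t \<in> ?A \<and> t \<notin> P \<and> prm ?A R \<and> idl_insert ?A P t \<subseteq> R \<and> R \<subseteq> origin_polys n"
    using prm_origin_polys by (metis (mono_tags, lifting) mem_Collect_eq order_refl origin_polys_def)
qed


section \<open>Deformation to leading forms\<close>

lemma wt_comp_mult_homogeneous:
  assumes \<omega>: "additive_wt \<omega>" and x: "\<And>m. m \<in> Poly_Mapping.keys x \<Longrightarrow> \<omega> m = d"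
  shows "wt_comp \<omega> c (x * F) = x * wt_comp \<omega> (c - d) F"
proof -
  let ?W = "\<omega> ` Poly_Mapping.keys F"
  have h: "wt_comp \<omega> c (x * wt_comp \<omega> e F) = (if e = c - d then x * wt_comp \<omega> e F else 0)" for e
  proof -
    have w: "\<omega> m = d + e" if m: "m \<in> Poly_Mapping.keys (x * wt_comp \<omega> e F)" for m
    proof -
      obtain a b where "m = a + b" "a \<in> Poly_Mapping.keys x" "b \<in> Poly_Mapping.keys (wt_comp \<omega> e F)"
        using m keys_mult[of x "wt_comp \<omega> e F"] by blast
      then show ?thesis using x by (simp add: additive_wt_add[OF \<omega>] keys_wt_comp)
    qed
    show ?thesis
    proof (cases "e = c - d")
      case True
      then show ?thesis using w by (simp add: wt_comp_homogeneous)
    next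
      case False
      then have "wt_comp \<omega> c (x * wt_comp \<omega> e F) = 0" using w by (intro wt_comp_eq_0) force
      then show ?thesis using False by simp
    qed
  qed
  have "wt_comp \<omega> c (x * F) = wt_comp \<omega> c (x * (\<Sum>e\<in>insert (c - d) ?W. wt_comp \<omega> e F))"
    by (subst sum_wt_comp) auto
  also have "\<dots> = (\<Sum>e\<in>insert (c - d) ?W. wt_comp \<omega> c (x * wt_comp \<omega> e F))"
    by (simp only: sum_distrib_left wt_comp_sum)
  also have "\<dots> = x * wt_comp \<omega> (c - d) F"
    unfolding h by (subst sum.delta) auto
  finally show ?thesis .
qed

lemma wt_comp_mult:
  assumes \<omega>: "additive_wt \<omega>" and W: "finite W" "\<omega> ` Poly_Mapping.keys p \<subseteq> W"
  shows "wt_comp \<omega> c (p * q) = (\<Sum>d\<in>W. wt_comp \<omega> d p * wt_comp \<omega> (c - d) q)"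
proof -
  have "wt_comp \<omega> c (p * q) = wt_comp \<omega> c ((\<Sum>d\<in>W. wt_comp \<omega> d p) * q)"
    by (subst sum_wt_comp[OF W]) simp
  also have "\<dots> = (\<Sum>d\<in>W. wt_comp \<omega> c (wt_comp \<omega> d p * q))"
    by (simp only: sum_distrib_right wt_comp_sum)
  also have "\<dots> = (\<Sum>d\<in>W. wt_comp \<omega> d p * wt_comp \<omega> (c - d) q)"
    by (intro sum.cong refl wt_comp_mult_homogeneous[OF \<omega>]) (simp add: keys_wt_comp)
  finally show ?thesis .
qed

section \<open>The one-parameter degeneration of a prime to its leading forms\<close>

locale deformation =
  fixes n :: nat and \<omega> :: "(nat \<Rightarrow>\<^sub>0 nat) \<Rightarrow> int" and P :: "'k::field mpoly set"
  assumes \<omega>: "additive_wt \<omega>" and \<omega>n: "\<omega> (Poly_Mapping.single n 1) = 0"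
    and P: "prm (polys {..<n}) P"
begin

text \<open>The new variable, of index \<open>n\<close>, gets weight one, so that multiplication by
  its powers raises a monomial to any larger weight.\<close>

definition \<omega>' :: "(nat \<Rightarrow>\<^sub>0 nat) \<Rightarrow> int" where
  "\<omega>' m = \<omega> m + int (Poly_Mapping.lookup m n)"

text \<open>\<open>dehom\<close> and \<open>special\<close> restrict the family with parameter
  \<open>pvar n\<close> to its fibres at one and at zero.\<close>

definition dehom :: "'k mpoly \<Rightarrow> 'k mpoly" where
  "dehom = ev pconst (\<lambda>i. if i = n then 1 else pvar i)"

definition special :: "'k mpoly \<Rightarrow> 'k mpoly" where
  "special = ev pconst (\<lambda>i. if i = n then 0 else pvar i)"

text \<open>The largest \<open>\<omega>'\<close>-homogeneous ideal whose dehomogenization lies in \<open>P\<close>.\<close>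
definition P' :: "'k mpoly set" where
  "P' = {F \<in> polys {..<Suc n}. \<forall>w. dehom (wt_comp \<omega>' w F) \<in> P}"

lemma \<omega>': "additive_wt \<omega>'"
  using \<omega> by (simp add: additive_wt_def \<omega>'_def lookup_add)

lemma rhom_dehom: "rhom dehom" and rhom_special: "rhom special"
  unfolding dehom_def special_def by (rule rhom_ev[OF rhom_pconst])+

lemma polys_Suc: "polys {..<n} \<subseteq> polys {..<Suc n}"
  by (rule polys_mono) auto

lemma dehom_in: "F \<in> polys (insert n U) \<Longrightarrow> n \<notin> U \<Longrightarrow> dehom F \<in> polys U"
  unfolding dehom_def by (rule ev_polys) (auto intro: polys_intros)

lemma special_in: "F \<in> polys (insert n U) \<Longrightarrow> n \<notin> U \<Longrightarrow> special F \<in> polys U"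
  unfolding special_def by (rule ev_polys) (auto intro: polys_intros)

lemma special_id: "F \<in> polys {..<n} \<Longrightarrow> special F = F"
  unfolding special_def
  using ev_cong[OF rhom_pconst, of F "{..<n}" "\<lambda>i. if i = n then 0 else pvar i" pvar]
  by (simp add: ev_pconst_pvar)

lemma special_pvar: "special (pvar n) = 0" and dehom_pvar: "dehom (pvar n) = 1"
  by (simp_all add: special_def dehom_def ev_pvar[OF rhom_pconst])

definition drop_n :: "(nat \<Rightarrow>\<^sub>0 nat) \<Rightarrow> (nat \<Rightarrow>\<^sub>0 nat)" where
  "drop_n m = m - Poly_Mapping.single n (Poly_Mapping.lookup m n)"

lemma drop_n: "m = drop_n m + Poly_Mapping.single n (Poly_Mapping.lookup m n)"
  by (rule poly_mapping_eqI) (simp add: drop_n_def lookup_add lookup_minus lookup_single when_def)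

lemma lookup_drop_n: "Poly_Mapping.lookup (drop_n m) n = 0"
  by (simp add: drop_n_def lookup_minus)

lemma \<omega>_single_n: "\<omega> (Poly_Mapping.single n k) = 0"
proof (induction k)
  case (Suc k)
  have "Poly_Mapping.single n (Suc k) = Poly_Mapping.single n 1 + Poly_Mapping.single n k"
    by (simp flip: single_add)
  then show ?case using Suc \<omega>n by (simp only: additive_wt_add[OF \<omega>])
qed (simp add: additive_wt_0[OF \<omega>])

lemma \<omega>_drop_n: "\<omega> (drop_n m) = \<omega> m"
  by (metis \<omega> \<omega>_single_n add.right_neutral additive_wt_add drop_n)

lemma ev_monomial_off_n:
  assumes v: "\<And>i. i \<noteq> n \<Longrightarrow> v i = pvar i" and m: "Poly_Mapping.lookup m n = 0"
  shows "ev pconst v (Poly_Mapping.single m c) = Poly_Mapping.single m c"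
proof -
  have "Poly_Mapping.single m c \<in> polys (- {n})" using m by (auto simp: polys_def in_keys_iff)
  then have "ev pconst v (Poly_Mapping.single m c) = ev pconst pvar (Poly_Mapping.single m c)"
    by (rule ev_cong[OF rhom_pconst]) (use v in auto)
  then show ?thesis by (simp add: ev_pconst_pvar)
qed

lemma single_drop_n:
  "Poly_Mapping.single m (c::'k) = Poly_Mapping.single (drop_n m) c * pvar n ^ Poly_Mapping.lookup m n"
proof -
  have "pvar n ^ k = Poly_Mapping.single (Poly_Mapping.single n k) (1::'k)" for k
    by (induction k) (simp_all add: pvar_def mult_single flip: single_add)
  then show ?thesis by (simp add: mult_single flip: drop_n)
qed

lemma dehom_single: "dehom (Poly_Mapping.single m c) = Poly_Mapping.single (drop_n m) c"
  by (subst single_drop_n)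
    (simp add: rhom_simps[OF rhom_dehom] dehom_pvar, simp add: dehom_def ev_monomial_off_n lookup_drop_n)

lemma special_single:
  "special (Poly_Mapping.single m c) = (if Poly_Mapping.lookup m n = 0 then Poly_Mapping.single m c else 0)"
proof (cases "Poly_Mapping.lookup m n = 0")
  case True
  then show ?thesis by (simp add: special_def ev_monomial_off_n)
next
  case False
  then have "special (pvar n ^ Poly_Mapping.lookup m n) = 0"
    by (simp add: rhom_simps[OF rhom_special] special_pvar)
  then show ?thesis using False by (subst single_drop_n) (simp add: rhom_mult[OF rhom_special])
qed

lemma dehom_sum: "dehom F = (\<Sum>m\<in>Poly_Mapping.keys F. Poly_Mapping.single (drop_n m) (Poly_Mapping.lookup F m))"
  by (subst mpoly_sum_single[of F]) (simp add: rhom_sum[OF rhom_dehom] dehom_single del: single_zero)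

lemma keys_dehom:
  assumes "m \<in> Poly_Mapping.keys (dehom F)"
  obtains m' where "m' \<in> Poly_Mapping.keys F" "m = drop_n m'"
proof -
  have "m \<in> (\<Union>m'\<in>Poly_Mapping.keys F. Poly_Mapping.keys (Poly_Mapping.single (drop_n m') (Poly_Mapping.lookup F m')))"
    using assms keys_sum[of "\<lambda>m'. Poly_Mapping.single (drop_n m') (Poly_Mapping.lookup F m')" "Poly_Mapping.keys F"]
    unfolding dehom_sum by blast
  then show ?thesis using that by (auto split: if_splits)
qed

lemma wt_comp_single: "wt_comp \<chi> w (Poly_Mapping.single m c) = (if \<chi> m = w then Poly_Mapping.single m c else 0)"
  by (rule poly_mapping_eqI) (auto simp: lookup_wt_comp lookup_single when_def)

text \<open>A monomial of \<open>\<omega>'\<close>-weight \<open>w\<close> that contains the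
  variable \<open>n\<close> has smaller weight for \<open>\<omega>\<close>. So in weight
  \<open>w\<close> only the monomials without this variable survive on either side.\<close>

lemma wt_comp_special: "wt_comp \<omega> w (dehom (wt_comp \<omega>' w F)) = wt_comp \<omega> w (special F)"
proof -
  have mono: "wt_comp \<omega> w (dehom (wt_comp \<omega>' w (Poly_Mapping.single m c))) = wt_comp \<omega> w (special (Poly_Mapping.single m c))" for m c
  proof (cases "Poly_Mapping.lookup m n = 0")
    case True
    then have "drop_n m = m" using drop_n[of m] by simp
    then show ?thesis using True
      by (simp add: wt_comp_single dehom_single special_single \<omega>'_def rhom_0[OF rhom_dehom])
  next
    case False
    then show ?thesis
      by (auto simp: wt_comp_single dehom_single special_single \<omega>'_def \<omega>_drop_n rhom_0[OF rhom_dehom])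
  qed
  show ?thesis
    by (subst (1 2) mpoly_sum_single[of F])
      (simp only: wt_comp_sum rhom_sum[OF rhom_dehom] rhom_sum[OF rhom_special] mono)
qed

text \<open>If neither factor lies in \<open>P'\<close>, consider in each the component of largest
  weight whose dehomogenization lies outside \<open>P\<close>. All other contributions to the
  product in the sum of these weights lie in \<open>P\<close>, and primality of \<open>P\<close>
  applies.\<close>

lemma prm_P': "prm (polys {..<Suc n}) P'"
proof -
  let ?A = "polys {..<n} :: 'k mpoly set" and ?A1 = "polys {..<Suc n} :: 'k mpoly set"
  have ins: "{..<Suc n} = insert n {..<n}" by auto
  have dA: "dehom (wt_comp \<omega>' w F) \<in> ?A" if "F \<in> ?A1" for w F
    using wt_comp_in_polys[OF that] unfolding ins by (rule dehom_in) simp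
  note idP = prm_idl[OF P]
  have comp: "dehom (wt_comp \<omega>' c (F * G)) = (\<Sum>d\<in>W. dehom (wt_comp \<omega>' d F) * dehom (wt_comp \<omega>' (c - d) G))"
    if "finite W" "\<omega>' ` Poly_Mapping.keys F \<subseteq> W" for c F G W
    by (simp add: wt_comp_mult[OF \<omega>' that] rhom_simps[OF rhom_dehom])
  have "idl ?A1 P'"
    unfolding idl_def
  proof (intro conjI ballI)
    show "P' \<subseteq> ?A1" by (auto simp: P'_def)
    show "0 \<in> P'" using idl_0[OF idP] by (simp add: P'_def rhom_simps[OF rhom_dehom] subr_0[OF subr_polys])
    show "F + G \<in> P'" if "F \<in> P'" "G \<in> P'" for F G
      using that by (auto simp: P'_def wt_comp_add rhom_simps[OF rhom_dehom] subr_add[OF subr_polys] intro: idl_add[OF idP])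
    show "a * F \<in> P'" if a: "a \<in> ?A1" and F: "F \<in> P'" for a F
    proof -
      have "dehom (wt_comp \<omega>' w (a * F)) \<in> P" for w
        unfolding comp[of "\<omega>' ` Poly_Mapping.keys a" a w F, simplified]
        using a F dA by (intro idl_sum[OF idP] idl_mult[OF idP]) (auto simp: P'_def)
      then show ?thesis using a F by (auto simp: P'_def intro: subr_mult[OF subr_polys])
    qed
  qed
  moreover have "1 \<notin> P'"
  proof
    assume "1 \<in> P'"
    then have "dehom (wt_comp \<omega>' 0 1) \<in> P" by (simp add: P'_def)
    moreover have "wt_comp \<omega>' 0 1 = (1 :: 'k mpoly)"
      by (rule wt_comp_homogeneous) (simp add: additive_wt_0[OF \<omega>'])
    ultimately show False using prm_1[OF P] by (simp add: rhom_1[OF rhom_dehom])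
  qed
  moreover have "F \<in> P' \<or> G \<in> P'" if F: "F \<in> ?A1" and G: "G \<in> ?A1" and FG: "F * G \<in> P'" for F G
  proof (rule ccontr)
    assume no: "\<not> ?thesis"
    define S where "S F = {w. dehom (wt_comp \<omega>' w F) \<notin> P}" for F
    have Sk: "S F \<subseteq> \<omega>' ` Poly_Mapping.keys F" for F
    proof
      fix w assume w: "w \<in> S F"
      show "w \<in> \<omega>' ` Poly_Mapping.keys F"
      proof (rule ccontr)
        assume "w \<notin> \<omega>' ` Poly_Mapping.keys F"
        then have "wt_comp \<omega>' w F = 0" by (intro wt_comp_eq_0) blast
        then show False using w idl_0[OF idP] by (simp add: S_def rhom_0[OF rhom_dehom])
      qed
    qed
    have finS: "finite (S F)" for F using Sk by (rule finite_subset) simp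
    have ne: "S F \<noteq> {}" "S G \<noteq> {}" using no F G by (auto simp: P'_def S_def)
    define a where "a = Max (S F)" define b where "b = Max (S G)"
    have a: "a \<in> S F" "\<And>w. w > a \<Longrightarrow> w \<notin> S F" and b: "b \<in> S G" "\<And>w. w > b \<Longrightarrow> w \<notin> S G"
      unfolding a_def b_def using finS ne by (auto simp: Max_in dest: Max_ge)
    let ?W = "\<omega>' ` Poly_Mapping.keys F"
    let ?t = "\<lambda>d. dehom (wt_comp \<omega>' d F) * dehom (wt_comp \<omega>' (a + b - d) G)"
    have aW: "a \<in> ?W" using a(1) Sk by blast
    have "dehom (wt_comp \<omega>' (a + b) (F * G)) \<in> P" using FG by (simp add: P'_def)
    then have "(\<Sum>d\<in>?W. ?t d) \<in> P" by (subst (asm) comp[of ?W]) auto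
    moreover have "(\<Sum>d\<in>?W - {a}. ?t d) \<in> P"
    proof (rule idl_sum[OF idP])
      fix d assume "d \<in> ?W - {a}"
      then consider "d > a" | "a + b - d > b" by force
      then show "?t d \<in> P"
      proof cases
        case 1
        then have "dehom (wt_comp \<omega>' d F) \<in> P" using a(2) by (auto simp: S_def)
        then show ?thesis using dA[OF G] by (intro idl_mult2[OF idP])
      next
        case 2
        then have "dehom (wt_comp \<omega>' (a + b - d) G) \<in> P" using b(2) unfolding S_def by blast
        then show ?thesis using dA[OF F] by (intro idl_mult[OF idP])
      qed
    qed
    ultimately have "(\<Sum>d\<in>?W. ?t d) - (\<Sum>d\<in>?W - {a}. ?t d) \<in> P" by (rule idl_diff[OF subr_polys idP])
    then have "?t a \<in> P" using aW by (simp add: sum.remove[of ?W a])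
    then show False using prm_prime[OF P dA[OF F] dA[OF G], of a b] a(1) b(1) by (auto simp: S_def)
  qed
  ultimately show ?thesis by (simp add: prm_def)
qed

lemma pvar_notin_P': "pvar n \<notin> P'"
proof
  assume "pvar n \<in> P'"
  then have "dehom (wt_comp \<omega>' 1 (pvar n)) \<in> P" by (simp add: P'_def)
  moreover have "wt_comp \<omega>' 1 (pvar n) = (pvar n :: 'k mpoly)"
    using \<omega>n by (intro wt_comp_homogeneous) (simp add: pvar_def \<omega>'_def)
  ultimately show False using prm_1[OF P] by (simp add: dehom_pvar)
qed

text \<open>Every nonzero \<open>\<omega>\<close>-component of \<open>special F\<close> is the
  leading form of an element of \<open>P\<close>, namely of the dehomogenized component of
  \<open>F\<close> of the same weight.\<close>

lemma P'_special:
  assumes F: "F \<in> P'" and lead: "\<And>f. f \<in> P \<Longrightarrow> f \<noteq> 0 \<Longrightarrow> lead_form \<omega> f \<in> Q" and Q: "idl (polys {..<n}) Q"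
  shows "special F \<in> Q"
proof -
  have comp: "wt_comp \<omega> w (special F) \<in> Q" for w
  proof (cases "wt_comp \<omega> w (special F) = 0")
    case False
    let ?G = "dehom (wt_comp \<omega>' w F)"
    have G: "?G \<in> P" using F by (simp add: P'_def)
    have top: "wt_comp \<omega> w ?G \<noteq> 0" using False by (simp add: wt_comp_special)
    have "top_wt \<omega> ?G = w"
    proof (rule top_wt_eqI[OF _ top])
      fix m assume "m \<in> Poly_Mapping.keys ?G"
      then obtain m' where "m' \<in> Poly_Mapping.keys (wt_comp \<omega>' w F)" "m = drop_n m'" by (rule keys_dehom)
      then show "\<omega> m \<le> w" by (auto simp: keys_wt_comp \<omega>_drop_n \<omega>'_def)
    qed
    then have "lead_form \<omega> ?G = wt_comp \<omega> w (special F)" by (simp add: lead_form_def wt_comp_special)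
    moreover have "?G \<noteq> 0" using top by auto
    ultimately show ?thesis using lead[OF G] by simp
  qed (use idl_0[OF Q] in simp)
  have "(\<Sum>w\<in>\<omega> ` Poly_Mapping.keys (special F). wt_comp \<omega> w (special F)) \<in> Q"
    by (rule idl_sum[OF Q comp])
  then show ?thesis by (simp add: sum_wt_comp)
qed

definition homogenize :: "'k mpoly \<Rightarrow> 'k mpoly" where
  "homogenize f = (\<Sum>m\<in>Poly_Mapping.keys f.
     Poly_Mapping.single (m + Poly_Mapping.single n (nat (top_wt \<omega> f - \<omega> m))) (Poly_Mapping.lookup f m))"

text \<open>A counterpart of \<open>P'_special\<close>: each leading form of an element of
  \<open>P\<close> occurs in the fibre at zero.\<close>

lemma homogenize:
  assumes f: "f \<in> P" "f \<noteq> 0"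
  shows "homogenize f \<in> P'" "special (homogenize f) = lead_form \<omega> f"
proof -
  have fA: "f \<in> polys {..<n}" using f(1) idl_sub[OF prm_idl[OF P]] by blast
  have mn: "Poly_Mapping.lookup m n = 0" if "m \<in> Poly_Mapping.keys f" for m
    using fA that by (force simp: polys_def simp flip: not_in_keys_iff_lookup_eq_zero)
  have wt: "\<omega> m \<le> top_wt \<omega> f" if "m \<in> Poly_Mapping.keys f" for m using that by (rule top_wt_ge)
  let ?m = "\<lambda>m. m + Poly_Mapping.single n (nat (top_wt \<omega> f - \<omega> m))"
  have w': "\<omega>' (?m m) = top_wt \<omega> f" if "m \<in> Poly_Mapping.keys f" for m
    using mn[OF that] wt[OF that] by (simp add: \<omega>'_def additive_wt_add[OF \<omega>] \<omega>_single_n lookup_add)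
  have dr: "drop_n (?m m) = m" if "m \<in> Poly_Mapping.keys f" for m
    using mn[OF that] by (intro poly_mapping_eqI) (simp add: drop_n_def lookup_add lookup_minus lookup_single when_def)
  have de: "dehom (homogenize f) = f"
    unfolding homogenize_def rhom_sum[OF rhom_dehom] dehom_single
    by (subst (3) mpoly_sum_single) (simp add: dr)
  have comp: "wt_comp \<omega>' w (homogenize f) = (if w = top_wt \<omega> f then homogenize f else 0)" for w
    unfolding homogenize_def wt_comp_sum wt_comp_single using w' by (simp cong: sum.cong)
  have "homogenize f \<in> polys {..<Suc n}"
    unfolding homogenize_def
  proof (rule subr_sum[OF subr_polys])
    fix m assume "m \<in> Poly_Mapping.keys f"
    then have "Poly_Mapping.keys m \<subseteq> {..<n}" using fA by (auto simp: polys_def)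
    then have "Poly_Mapping.keys (?m m) \<subseteq> {..<Suc n}" by (auto simp: keys_add_nat split: if_splits)
    then show "Poly_Mapping.single (?m m) (Poly_Mapping.lookup f m) \<in> polys {..<Suc n}"
      by (simp add: polys_def)
  qed
  then show "homogenize f \<in> P'"
    using f(1) idl_0[OF prm_idl[OF P]] by (simp add: P'_def comp de rhom_0[OF rhom_dehom])
  show "special (homogenize f) = lead_form \<omega> f"
  proof -
    have "special (Poly_Mapping.single (?m m) (Poly_Mapping.lookup f m)) =
        wt_comp \<omega> (top_wt \<omega> f) (Poly_Mapping.single m (Poly_Mapping.lookup f m))"
      if "m \<in> Poly_Mapping.keys f" for m
      using mn[OF that] wt[OF that] by (auto simp: special_single wt_comp_single lookup_add)
    then have "special (homogenize f) = wt_comp \<omega> (top_wt \<omega> f) (\<Sum>m\<in>Poly_Mapping.keys f. Poly_Mapping.single m (Poly_Mapping.lookup f m))"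
      unfolding homogenize_def rhom_sum[OF rhom_special] wt_comp_sum by (intro sum.cong) auto
    then show ?thesis by (simp add: lead_form_def flip: mpoly_sum_single)
  qed
qed

text \<open>Division by \<open>pvar n\<close> leaves the remainder \<open>special F\<close>.\<close>

lemma diff_special:
  assumes F: "F \<in> polys {..<Suc n}" and R: "idl (polys {..<Suc n}) R" "pvar n \<in> R"
  shows "F - special F \<in> R"
proof -
  have ins: "{..<Suc n} = insert n {..<n}" by auto
  obtain Q where Q: "Q \<in> coeffs_in (polys {..<n})" "F = poly Q (pvar n)"
    using F unfolding ins by (rule polys_insert_poly)
  obtain c H where cH: "Q = pCons c H" by (metis pCons_cases)
  have c: "c \<in> polys {..<n}" using Q(1) cH by (auto simp: coeffs_in_def) (metis coeff_pCons_0)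
  have H: "H \<in> coeffs_in (polys {..<n})" using Q(1) cH by (auto simp: coeffs_in_def) (metis coeff_pCons_Suc)
  have "F - special F = poly H (pvar n) * pvar n"
    using special_id[OF c] by (simp add: Q(2) cH rhom_simps[OF rhom_special] special_pvar mult.commute)
  moreover have "poly H (pvar n) \<in> polys {..<Suc n}"
    unfolding ins by (rule ac.poly_in_polys_insert[OF H])
  ultimately show ?thesis using idl_mult[OF R(1) _ R(2)] by simp
qed

text \<open>\<open>dehom\<close> is injective on \<open>\<omega>'\<close>-homogeneous polynomials,
  because the weight determines the exponent of the variable \<open>n\<close>. Hence a set
  independent modulo \<open>P\<close> becomes, with \<open>n\<close> added, independent modulo
  \<open>P'\<close>.\<close>

lemma tr_deg_P': "tr_deg n P + 1 \<le> tr_deg (Suc n) P'"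
proof -
  obtain U where U: "U \<subseteq> {..<n}" "indep_vars P U" "card U = tr_deg n P" using tr_deg_attained[OF P] .
  have nU: "n \<notin> U" "finite U" using U(1) finite_subset by auto
  have "indep_vars P' (insert n U)"
    unfolding indep_vars_def
  proof clarify
    fix F assume F: "F \<in> polys (insert n U)" "F \<in> P'"
    have "wt_comp \<omega>' w F = 0" for w
    proof (rule ccontr)
      let ?H = "wt_comp \<omega>' w F"
      assume "?H \<noteq> 0"
      then obtain m where m: "m \<in> Poly_Mapping.keys ?H" by (metis keys_eq_empty ex_in_conv)
      have "dehom ?H \<in> polys U" using wt_comp_in_polys[OF F(1)] nU(1) by (rule dehom_in)
      moreover have "dehom ?H \<in> P" using F(2) by (simp add: P'_def)
      ultimately have "dehom ?H = 0" using U(2) by (auto simp: indep_vars_def)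
      moreover have "Poly_Mapping.lookup (dehom ?H) (drop_n m) = Poly_Mapping.lookup ?H m"
      proof -
        have inj: "m' = m" if "m' \<in> Poly_Mapping.keys ?H" "drop_n m' = drop_n m" for m'
        proof -
          have "\<omega>' m' = \<omega>' m" using that(1) m by (auto simp: keys_wt_comp)
          then have "Poly_Mapping.lookup m' n = Poly_Mapping.lookup m n"
            using that(2) \<omega>_drop_n[of m] \<omega>_drop_n[of m'] by (simp add: \<omega>'_def)
          then show ?thesis using that(2) drop_n[of m] drop_n[of m'] by simp
        qed
        have "Poly_Mapping.lookup (dehom ?H) (drop_n m) =
            (\<Sum>m'\<in>Poly_Mapping.keys ?H. if m' = m then Poly_Mapping.lookup ?H m' else 0)"
          unfolding dehom_sum lookup_sum using inj by (intro sum.cong) (auto simp: lookup_single when_def)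
        then show ?thesis using m by simp
      qed
      ultimately show False using m by (simp add: in_keys_iff)
    qed
    then have "(\<Sum>w\<in>\<omega>' ` Poly_Mapping.keys F. wt_comp \<omega>' w F) = 0" by simp
    then show "F = 0" by (simp add: sum_wt_comp)
  qed
  then have "card (insert n U) \<le> tr_deg (Suc n) P'" using U(1) by (intro tr_deg_ge) auto
  then show ?thesis using U(3) nU by simp
qed

text \<open>The preimage \<open>Q'\<close> of \<open>Q\<close> under \<open>special\<close> is
  minimal over \<open>P' + (pvar n)\<close>, as a smaller prime would contract to a smaller prime
  over \<open>L\<close>. The degree gained from \<open>P\<close> to \<open>P'\<close> is the one
  lost in the principal ideal theorem. \<open>L\<close> need not contain all leading forms of
  \<open>P\<close>, since it will come from an ideal inside \<open>P\<close>.\<close>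

theorem tr_deg_le_lead:
  assumes Q: "min_prm (polys {..<n}) L Q" and L: "L \<subseteq> lead_form \<omega> ` (P - {0})"
    and lead: "\<And>f. f \<in> P \<Longrightarrow> f \<noteq> 0 \<Longrightarrow> lead_form \<omega> f \<in> Q"
  shows "tr_deg n P \<le> tr_deg n Q"
proof -
  let ?A = "polys {..<n} :: 'k mpoly set" and ?A1 = "polys {..<Suc n} :: 'k mpoly set"
  have ins: "{..<Suc n} = insert n {..<n}" by auto
  have pQ: "prm ?A Q" using Q by (simp add: min_prm_def)
  define Q' where "Q' = {F \<in> ?A1. special F \<in> Q}"
  have spA: "special F \<in> ?A" if "F \<in> ?A1" for F using that unfolding ins by (rule special_in) simp
  have Q': "prm ?A1 Q'" unfolding Q'_def by (rule prm_vimage[OF rhom_special subr_polys pQ spA])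
  have xA1: "pvar n \<in> ?A1" by (rule pvar_in_polys) simp
  have xQ': "pvar n \<in> Q'" using xA1 idl_0[OF prm_idl[OF pQ]] by (simp add: Q'_def special_pvar)
  have P'Q': "P' \<subseteq> Q'"
    using P'_special[OF _ lead prm_idl[OF pQ]] by (auto simp: Q'_def P'_def)
  have min: "min_prm ?A1 (idl_insert ?A1 P' (pvar n)) Q'"
    unfolding min_prm_def
  proof (intro conjI allI impI)
    show "prm ?A1 Q'" by (rule Q')
    show "idl_insert ?A1 P' (pvar n) \<subseteq> Q'" by (rule idl_insert_least[OF prm_idl[OF Q'] P'Q' xQ'])
    fix R assume R: "prm ?A1 R" "idl_insert ?A1 P' (pvar n) \<subseteq> R" "R \<subseteq> Q'"
    have xR: "pvar n \<in> R" using R(2) idl_insert_mem[OF subr_polys prm_idl[OF prm_P']] by blast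
    have P'R: "P' \<subseteq> R" using R(2) idl_insert_supset[OF subr_polys, of P'] by blast
    note idR = prm_idl[OF R(1)]
    have R0: "prm ?A (R \<inter> ?A)" by (rule prm_inter[OF subr_polys polys_Suc R(1)])
    have "R \<inter> ?A \<subseteq> Q" using R(3) special_id by (auto simp: Q'_def)
    moreover have "L \<subseteq> R \<inter> ?A"
    proof
      fix l assume "l \<in> L"
      then obtain f where f: "f \<in> P" "f \<noteq> 0" "l = lead_form \<omega> f" using L by blast
      have hR: "homogenize f \<in> R" using homogenize(1)[OF f(1,2)] P'R by blast
      have hA: "homogenize f \<in> ?A1" using hR idl_sub[OF idR] by blast
      have "homogenize f - (homogenize f - special (homogenize f)) \<in> R"
        using hR diff_special[OF hA idR xR] by (rule idl_diff[OF subr_polys idR])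
      then show "l \<in> R \<inter> ?A"
        using spA[OF hA] homogenize(2)[OF f(1,2)] f(3) by simp
    qed
    ultimately have eq: "R \<inter> ?A = Q" using Q R0 by (simp add: min_prm_def)
    have "Q' \<subseteq> R"
    proof
      fix F assume F: "F \<in> Q'"
      then have FA: "F \<in> ?A1" and "special F \<in> R" using eq by (auto simp: Q'_def)
      then have "special F + (F - special F) \<in> R"
        using diff_special[OF FA idR xR] by (intro idl_add[OF idR])
      then show "F \<in> R" by simp
    qed
    then show "R = Q'" using R(3) by blast
  qed
  have "tr_deg n P + 1 \<le> tr_deg (Suc n) P'" by (rule tr_deg_P')
  also have "\<dots> \<le> tr_deg (Suc n) Q' + 1"
    by (rule ac.principal_ideal_theorem[OF prm_P' xA1 pvar_notin_P' min])
  also have "tr_deg (Suc n) Q' \<le> tr_deg n Q"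
  proof -
    obtain U where U: "U \<subseteq> {..<Suc n}" "indep_vars Q' U" "card U = tr_deg (Suc n) Q'" using tr_deg_attained[OF Q'] .
    have "n \<notin> U"
    proof
      assume "n \<in> U"
      then have "pvar n \<in> polys U \<inter> Q'" using xQ' pvar_in_polys by auto
      then have "pvar n \<in> {0 :: 'k mpoly}" using U(2) unfolding indep_vars_def by blast
      then show False by simp
    qed
    then have Un: "U \<subseteq> {..<n}" using U(1) less_Suc_eq by auto
    have "Q \<subseteq> Q'" using idl_sub[OF prm_idl[OF pQ]] special_id polys_Suc by (auto simp: Q'_def)
    then have "indep_vars Q U" using U(2) by (auto simp: indep_vars_def)
    then show ?thesis using tr_deg_ge[OF Un] U(3) by metis
  qed
  finally show ?thesis by simp
qed

end

text \<open>Leading forms multiply, so the nonzero polynomials with leading form outside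
  \<open>Q\<close> are a multiplicative set. The ideal \<open>I\<close> misses it, and a prime over
  \<open>I\<close> avoiding it contains the wanted minimal prime \<open>P\<close>.\<close>

theorem lead_form_prime_component:
  assumes \<omega>: "additive_wt \<omega>" "\<omega> (Poly_Mapping.single n 1) = 0"
    and I: "idl (polys {..<n}) I" and Q: "min_prm (polys {..<n}) (lead_form \<omega> ` (I - {0})) Q"
  obtains P where "min_prm (polys {..<n}) I P" "tr_deg n P = tr_deg n Q"
    "\<forall>f\<in>P. f \<noteq> 0 \<longrightarrow> lead_form \<omega> f \<in> Q"
proof -
  let ?A = "polys {..<n} :: 'a mpoly set"
  have pQ: "prm ?A Q" using Q by (simp add: min_prm_def)
  let ?D = "{f \<in> ?A. f \<noteq> 0 \<and> lead_form \<omega> f \<notin> Q}"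
  have lA: "lead_form \<omega> f \<in> ?A" if "f \<in> ?A" for f
    unfolding lead_form_def using that by (rule wt_comp_in_polys)
  obtain P1 where P1: "prm ?A P1" "I \<subseteq> P1" "P1 \<inter> ?D = {}"
  proof (rule exists_prm_avoiding[OF subr_polys I, of ?D])
    have "lead_form \<omega> 1 = (1 :: 'a mpoly)"
      unfolding lead_form_def by (rule wt_comp_homogeneous) (simp add: top_wt_def)
    then show "1 \<in> ?D" using prm_1[OF pQ] by (simp add: subr_1[OF subr_polys])
    show "f * g \<in> ?D" if "f \<in> ?D" "g \<in> ?D" for f g
      using that lA prm_prime[OF pQ, of "lead_form \<omega> f" "lead_form \<omega> g"]
      by (auto simp: lead_form_mult[OF \<omega>(1)] subr_mult[OF subr_polys])
    show "I \<inter> ?D = {}" using Q by (auto simp: min_prm_def)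
  qed auto
  obtain P where P: "min_prm ?A I P" "P \<subseteq> P1" using exists_min_prm_below[OF P1(1,2)] .
  have pP: "prm ?A P" using P(1) by (simp add: min_prm_def)
  have lead: "lead_form \<omega> f \<in> Q" if "f \<in> P" "f \<noteq> 0" for f
    using that P(2) P1(3) idl_sub[OF prm_idl[OF pP]] by blast
  have IP: "I \<subseteq> P" and minP: "min_prm ?A I P" using P(1) by (auto simp: min_prm_def)
  interpret deformation n \<omega> P by unfold_locales (use \<omega> pP in auto)
  have "tr_deg n P \<le> tr_deg n Q"
  proof (rule tr_deg_le_lead[OF Q _ lead])
    show "lead_form \<omega> ` (I - {0}) \<subseteq> lead_form \<omega> ` (P - {0})" using IP by blast
  qed
  moreover have "tr_deg n Q \<le> tr_deg n P"
  proof -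
    obtain U where U: "U \<subseteq> {..<n}" "indep_vars Q U" "card U = tr_deg n Q" using tr_deg_attained[OF pQ] .
    have "indep_vars P U"
      unfolding indep_vars_def
    proof clarify
      fix f assume f: "f \<in> polys U" "f \<in> P"
      show "f = 0"
      proof (rule ccontr)
        assume "f \<noteq> 0"
        then have "lead_form \<omega> f \<in> Q" "lead_form \<omega> f \<noteq> 0" using lead f(2) lead_form_nonzero by auto
        moreover have "lead_form \<omega> f \<in> polys U" unfolding lead_form_def using f(1) by (rule wt_comp_in_polys)
        ultimately show False using U(2) by (auto simp: indep_vars_def)
      qed
    qed
    then show ?thesis using tr_deg_ge[OF U(1)] U(3) by metis
  qed
  ultimately show ?thesis using that minP lead by simp
qed


section \<open>Translation to quotient rings and localizations\<close>

lemma ring_on_simps [simp]: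
  "carrier (ring_on A) = A" "monoid.mult (ring_on A) = (*)" "one (ring_on A) = 1"
  "zero (ring_on A) = 0" "add (ring_on A) = (+)"
  by (simp_all add: ring_on_def)

lemma cring_ring_on:
  assumes "subr A"
  shows "cring (ring_on A)"
proof (rule cringI)
  show "abelian_group (ring_on A)"
  proof (rule abelian_groupI)
    fix x assume "x \<in> carrier (ring_on A)"
    then show "\<exists>y\<in>carrier (ring_on A). y \<oplus>\<^bsub>ring_on A\<^esub> x = \<zero>\<^bsub>ring_on A\<^esub>"
      using subr_minus[OF assms] by (intro bexI[of _ "- x"]) auto
  qed (use assms in \<open>auto simp: subr_0 subr_add add_ac\<close>)
  show "comm_monoid (ring_on A)"
    by (rule comm_monoidI) (use assms in \<open>auto simp: subr_1 subr_mult mult_ac\<close>)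
qed (auto simp: distrib_right)

lemma ideal_ring_on_iff:
  assumes A: "subr A"
  shows "ideal J (ring_on A) \<longleftrightarrow> idl A J"
proof
  interpret cring "ring_on A" by (rule cring_ring_on[OF A])
  assume J: "ideal J (ring_on A)"
  interpret J: ideal J "ring_on A" by (rule J)
  show "idl A J"
    unfolding idl_def using J.a_subset J.zero_closed J.a_closed J.I_l_closed by auto
next
  interpret cring "ring_on A" by (rule cring_ring_on[OF A])
  assume J: "idl A J"
  show "ideal J (ring_on A)"
  proof (rule idealI[OF ring_axioms])
    show "subgroup J (add_monoid (ring_on A))"
    proof (rule group.subgroupI[OF a_group])
      have inv: "\<ominus>\<^bsub>ring_on A\<^esub> a = - a" if "a \<in> J" for a
        using that idl_sub[OF J] subr_minus[OF A] by (intro minus_equality) auto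
      show "inv\<^bsub>add_monoid (ring_on A)\<^esub> a \<in> J" if "a \<in> J" for a
        using inv[OF that] idl_minus[OF A J that] by (simp add: a_inv_def)
    qed (use idl_sub[OF J] idl_0[OF J] idl_add[OF J] in auto)
  qed (use J in \<open>auto intro: idl_mult idl_mult2\<close>)
qed

lemma primeideal_ring_on_iff:
  assumes A: "subr A"
  shows "primeideal P (ring_on A) \<longleftrightarrow> prm A P"
proof
  assume P: "primeideal P (ring_on A)"
  interpret P: primeideal P "ring_on A" by (rule P)
  have i: "idl A P" using P.is_ideal ideal_ring_on_iff[OF A] by blast
  moreover have "1 \<notin> P" using P.one_imp_carrier P.I_notcarr by auto
  ultimately show "prm A P" using P.I_prime by (auto simp: prm_def)
next
  assume P: "prm A P"
  show "primeideal P (ring_on A)"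
  proof (rule primeidealI[OF _ cring_ring_on[OF A]])
    show "ideal P (ring_on A)" using prm_idl[OF P] ideal_ring_on_iff[OF A] by blast
    show "carrier (ring_on A) \<noteq> P" using prm_1[OF P] subr_1[OF A] by auto
  qed (use prm_prime[OF P] in auto)
qed

lemma genideal_ring_on:
  assumes A: "subr A" and S: "S \<subseteq> A"
  shows "idl A (genideal (ring_on A) S)" "S \<subseteq> genideal (ring_on A) S"
    "idl A J \<Longrightarrow> genideal (ring_on A) S \<subseteq> J \<longleftrightarrow> S \<subseteq> J"
proof -
  interpret cring "ring_on A" by (rule cring_ring_on[OF A])
  show "idl A (genideal (ring_on A) S)"
    using genideal_ideal[of S] S ideal_ring_on_iff[OF A] by simp
  show self: "S \<subseteq> genideal (ring_on A) S" using genideal_self[of S] S by simp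
  show "genideal (ring_on A) S \<subseteq> J \<longleftrightarrow> S \<subseteq> J" if "idl A J"
    using genideal_minimal[of J S] that ideal_ring_on_iff[OF A] self by blast
qed

section \<open>Krull dimension of quotient rings\<close>

lemma chain_dim_le_image:
  assumes "\<And>P. P \<in> F \<Longrightarrow> f P \<in> F'" "\<And>P Q. P \<in> F \<Longrightarrow> Q \<in> F \<Longrightarrow> P \<subset> Q \<Longrightarrow> f P \<subset> f Q"
  shows "chain_dim F \<le> chain_dim F'"
proof (rule chain_dim_le)
  fix l C assume C: "\<And>i. i \<le> l \<Longrightarrow> C i \<in> F" "\<And>i. i < l \<Longrightarrow> C i \<subset> C (Suc i)"
  show "ereal (real l) \<le> chain_dim F'"
  proof (rule chain_dim_ge)
    show "f (C i) \<in> F'" if "i \<le> l" for i using assms(1) C(1) that by blast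
    show "f (C i) \<subset> f (C (Suc i))" if "i < l" for i
      using assms(2)[OF C(1) C(1) C(2)[OF that]] that by simp
  qed
qed

lemma krull_dim_eq_chain_dim: "krull_dim R = chain_dim {P. primeideal P R}"
  unfolding krull_dim_def chain_dim_def by simp

lemma rcos_mem_image:
  assumes "ring R" "ideal J R" "ideal P R" "J \<subseteq> P" "a \<in> carrier R"
    and "J +>\<^bsub>R\<^esub> a \<in> (+>\<^bsub>R\<^esub>) J ` P"
  shows "a \<in> P"
proof -
  interpret ring R by fact
  interpret J: ideal J R by fact
  interpret P: ideal P R by fact
  obtain p where p: "p \<in> P" "J +>\<^bsub>R\<^esub> a = J +>\<^bsub>R\<^esub> p" using assms(6) by auto
  have "a \<in> J +>\<^bsub>R\<^esub> p" using J.a_rcos_self[OF assms(5)] p(2) by simp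
  then obtain j where "j \<in> J" "a = j \<oplus>\<^bsub>R\<^esub> p" by (auto simp: a_r_coset_def')
  then show ?thesis using assms(4) p(1) P.a_closed by blast
qed

theorem krull_dim_Quot:
  assumes R: "cring R" and J: "ideal J R"
  shows "krull_dim (R Quot J) = chain_dim {P. primeideal P R \<and> J \<subseteq> P}"
proof -
  interpret cring R by fact
  interpret J: ideal J R by fact
  have hom: "ring_hom_ring R (R Quot J) ((+>\<^bsub>R\<^esub>) J)" by (rule J.rcos_ring_hom_ring)
  interpret h: ring_hom_ring R "R Quot J" "(+>\<^bsub>R\<^esub>) J" by (rule hom)
  have Qc: "cring (R Quot J)" by (rule J.quotient_is_cring[OF R])
  define f where "f K = {r \<in> carrier R. J +>\<^bsub>R\<^esub> r \<in> K}" for K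
  define g where "g P = (+>\<^bsub>R\<^esub>) J ` P" for P
  have f: "primeideal (f K) R \<and> J \<subseteq> f K" if K: "primeideal K (R Quot J)" for K
  proof -
    interpret K: primeideal K "R Quot J" by (rule K)
    have "zero (R Quot J) = J" unfolding FactRing_def by simp
    then have JK: "J \<in> K" using additive_subgroup.zero_closed[OF ideal.axioms(1)[OF K.is_ideal]] by metis
    have "J \<subseteq> f K"
    proof
      fix r assume r: "r \<in> J"
      then have "J +>\<^bsub>R\<^esub> r = J" by (rule J.a_rcos_const)
      then show "r \<in> f K" using JK J.a_Hcarr[OF r] by (simp add: f_def)
    qed
    moreover have "primeideal (f K) R" unfolding f_def by (rule h.primeideal_vimage[OF R K])
    ultimately show ?thesis by blast
  qed
  have mem: "J +>\<^bsub>R\<^esub> a \<in> g P \<longleftrightarrow> a \<in> P" if "ideal P R" "J \<subseteq> P" "a \<in> carrier R" for a P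
    unfolding g_def using rcos_mem_image[OF ring_axioms J that] by blast
  have g: "primeideal (g P) (R Quot J)" if P: "primeideal P R" "J \<subseteq> P" for P
  proof -
    interpret P: primeideal P R by (rule P)
    note mem' = mem[OF P.is_ideal P(2)]
    show ?thesis
    proof (rule primeidealI[OF _ Qc])
      show "ideal (g P) (R Quot J)" unfolding g_def by (rule ring_ideal_imp_quot_ideal[OF J P.is_ideal])
      show "carrier (R Quot J) \<noteq> g P"
      proof
        assume "carrier (R Quot J) = g P"
        then have "J +>\<^bsub>R\<^esub> \<one>\<^bsub>R\<^esub> \<in> g P" using h.hom_closed[OF one_closed] by simp
        then have "\<one>\<^bsub>R\<^esub> \<in> P" using mem'[OF one_closed] by blast
        then show False using P.one_imp_carrier P.I_notcarr by blast
      qed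
      fix a b assume a: "a \<in> carrier (R Quot J)" and b: "b \<in> carrier (R Quot J)"
        and ab: "a \<otimes>\<^bsub>R Quot J\<^esub> b \<in> g P"
      obtain x where x: "x \<in> carrier R" "a = J +>\<^bsub>R\<^esub> x"
        using a unfolding FactRing_def using A_RCOSETS_def'[of R J] by auto
      obtain y where y: "y \<in> carrier R" "b = J +>\<^bsub>R\<^esub> y"
        using b unfolding FactRing_def using A_RCOSETS_def'[of R J] by auto
      have "J +>\<^bsub>R\<^esub> (x \<otimes>\<^bsub>R\<^esub> y) \<in> g P" using ab h.hom_mult[OF x(1) y(1)] x(2) y(2) by simp
      then have "x \<otimes>\<^bsub>R\<^esub> y \<in> P" using mem'[OF m_closed[OF x(1) y(1)]] by blast
      then have "x \<in> P \<or> y \<in> P" by (rule P.I_prime[OF x(1) y(1)])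
      then show "a \<in> g P \<or> b \<in> g P" unfolding x(2) y(2) mem'[OF x(1)] mem'[OF y(1)] .
    qed
  qed
  have gmono: "g P \<subset> g Q" if PQ: "primeideal P R" "J \<subseteq> P" "primeideal Q R" "J \<subseteq> Q" "P \<subset> Q" for P Q
  proof -
    interpret P: primeideal P R by fact
    interpret Q: primeideal Q R by fact
    obtain a where a: "a \<in> Q" "a \<notin> P" using PQ(5) by blast
    then have "J +>\<^bsub>R\<^esub> a \<in> g Q" "J +>\<^bsub>R\<^esub> a \<notin> g P"
      using mem[OF P.is_ideal PQ(2), of a] mem[OF Q.is_ideal PQ(4), of a] Q.a_subset by auto
    moreover have "g P \<subseteq> g Q" using PQ(5) by (auto simp: g_def)
    ultimately show ?thesis by blast
  qed
  have fmono: "f K \<subset> f L" if KL: "primeideal K (R Quot J)" "primeideal L (R Quot J)" "K \<subset> L" for K L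
  proof -
    interpret L: primeideal L "R Quot J" by fact
    obtain a where a: "a \<in> L" "a \<notin> K" using KL(3) by blast
    then obtain x where "x \<in> carrier R" "a = J +>\<^bsub>R\<^esub> x"
      using L.a_subset unfolding FactRing_def using A_RCOSETS_def'[of R J] by auto
    then have "x \<in> f L" "x \<notin> f K" using a by (auto simp: f_def)
    moreover have "f K \<subseteq> f L" using KL(3) by (auto simp: f_def)
    ultimately show ?thesis by blast
  qed
  show ?thesis
    unfolding krull_dim_eq_chain_dim
  proof (rule antisym)
    show "chain_dim {P. primeideal P (R Quot J)} \<le> chain_dim {P. primeideal P R \<and> J \<subseteq> P}"
      by (rule chain_dim_le_image[of _ f]) (use f fmono in auto)
    show "chain_dim {P. primeideal P R \<and> J \<subseteq> P} \<le> chain_dim {P. primeideal P (R Quot J)}"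
      by (rule chain_dim_le_image[of _ g]) (use g gmono in auto)
  qed
qed

lemma equidimensional_quot_ring_on:
  assumes A: "subr A" and J: "idl A J"
  shows "equidimensional_quot (ring_on A) J \<longleftrightarrow> (\<forall>Q. min_prm A J Q \<longrightarrow>
    chain_dim {P. prm A P \<and> Q \<subseteq> P} = chain_dim {P. prm A P \<and> J \<subseteq> P})"
proof -
  have dim: "krull_dim (ring_on A Quot K) = chain_dim {P. prm A P \<and> K \<subseteq> P}" if "idl A K" for K
    using krull_dim_Quot[OF cring_ring_on[OF A], of K] that
    by (simp add: ideal_ring_on_iff[OF A] primeideal_ring_on_iff[OF A])
  have "minimal_prime (ring_on A) J Q \<longleftrightarrow> min_prm A J Q" for Q
    unfolding minimal_prime_def min_prm_def primeideal_ring_on_iff[OF A] ..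
  then show ?thesis
    unfolding equidimensional_quot_def using dim J by (auto simp: min_prm_def prm_idl)
qed

section \<open>Quotients of the polynomial ring\<close>

lemma poly_ring_eq: "poly_ring n = ring_on (polys {..<n})"
  by (simp add: poly_ring_def polys_def)

lemma equidimensional_quot_poly_ring:
  assumes "idl (polys {..<n}) J"
  shows "equidimensional_quot (poly_ring n) J \<longleftrightarrow> equidim n (polys {..<n}) J"
proof -
  have "primes_between n (polys {..<n}) K = {P. prm (polys {..<n}) P \<and> K \<subseteq> P}" for K :: "'a mpoly set"
    unfolding primes_between_def using idl_sub[OF prm_idl] by blast
  moreover have "Q \<subseteq> polys {..<n}" if "min_prm (polys {..<n}) J Q" for Q
    using that idl_sub[OF prm_idl] unfolding min_prm_def by blast
  ultimately show ?thesis
    unfolding poly_ring_eq equidimensional_quot_ring_on[OF subr_polys assms] equidim_def by simp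
qed

text \<open>A prime contains a set exactly when it contains the ideal generated by it, and
  \<open>equidim\<close> refers to primes only.\<close>

lemma equidim_genideal:
  assumes "S \<subseteq> polys {..<n}"
  shows "equidim n M (genideal (poly_ring n) S) \<longleftrightarrow> equidim n M S"
proof -
  have iff: "genideal (poly_ring n) S \<subseteq> P \<longleftrightarrow> S \<subseteq> P" if "prm (polys {..<n}) P" for P
    unfolding poly_ring_eq by (rule genideal_ring_on(3)[OF subr_polys assms prm_idl[OF that]])
  have "min_prm (polys {..<n}) (genideal (poly_ring n) S) Q \<longleftrightarrow> min_prm (polys {..<n}) S Q" for Q
    unfolding min_prm_def by (simp add: iff cong: conj_cong imp_cong)
  moreover have "primes_between n M (genideal (poly_ring n) S) = primes_between n M S"
    unfolding primes_between_def by (simp add: iff cong: conj_cong)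
  ultimately show ?thesis unfolding equidim_def by simp
qed

section \<open>The local ring at the origin and its primes\<close>

lemma origin_ideal_eq: "origin_ideal n = (origin_polys n :: 'k::field mpoly set)"
proof -
  let ?V = "pvar ` {..<n} :: 'k mpoly set"
  have V: "?V \<subseteq> polys {..<n}" by (auto intro: pvar_in_polys)
  have eq: "origin_ideal n = genideal (ring_on (polys {..<n})) ?V"
    by (simp add: origin_ideal_def poly_ring_eq pvar_def[abs_def])
  have gen: "idl (polys {..<n}) (origin_ideal n :: 'k mpoly set)" "?V \<subseteq> origin_ideal n"
      "\<And>J. idl (polys {..<n}) J \<Longrightarrow> origin_ideal n \<subseteq> J \<longleftrightarrow> ?V \<subseteq> J"
    unfolding eq by (rule genideal_ring_on[OF subr_polys V])+
  have "?V \<subseteq> origin_polys n"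
    by (auto simp: origin_polys_def lookup_pvar_0 intro: pvar_in_polys)
  then have "origin_ideal n \<subseteq> (origin_polys n :: 'k mpoly set)"
    using gen(3)[OF prm_idl[OF prm_origin_polys]] by blast
  moreover have "p \<in> origin_ideal n" if p: "p \<in> origin_polys n" for p :: "'k mpoly"
  proof (subst mpoly_sum_single, rule idl_sum[OF gen(1)])
    fix m assume m: "m \<in> Poly_Mapping.keys p"
    then have "m \<noteq> 0" using p by (auto simp: origin_polys_def in_keys_iff)
    then obtain i where i: "i \<in> Poly_Mapping.keys m" by (metis keys_eq_empty ex_in_conv)
    have keys: "Poly_Mapping.keys m \<subseteq> {..<n}" using p m by (auto simp: origin_polys_def polys_def)
    let ?c = "Poly_Mapping.lookup p m" and ?m' = "m - Poly_Mapping.single i 1"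
    have "?m' + Poly_Mapping.single i 1 = m"
      using i by (intro poly_mapping_eqI) (auto simp: lookup_add lookup_minus lookup_single when_def in_keys_iff)
    then have eq': "Poly_Mapping.single ?m' ?c * pvar i = Poly_Mapping.single m ?c"
      unfolding pvar_def mult_single by simp
    have "Poly_Mapping.single ?m' ?c \<in> polys {..<n}"
      using keys by (auto simp: polys_def in_keys_iff lookup_minus subset_iff)
    moreover have "(pvar i :: 'k mpoly) \<in> origin_ideal n" by (rule subsetD[OF gen(2)], rule imageI) (use i keys in auto)
    ultimately show "Poly_Mapping.single m ?c \<in> origin_ideal n"
      unfolding eq'[symmetric] by (rule idl_mult[OF gen(1)])
  qed
  ultimately show ?thesis by blast
qed

text \<open>For the whole polynomial ring this is the local ring at the origin, for an ideal its
  extension to that ring.\<close>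

definition local_fracs :: "nat \<Rightarrow> 'k::field mpoly set \<Rightarrow> 'k mpoly fract set" where
  "local_fracs n P = {Fract p q | p q. p \<in> P \<and> q \<in> polys {..<n} - origin_polys n}"

lemma origin_local_ring_eq: "origin_local_ring n = ring_on (local_fracs n (polys {..<n}))"
  by (simp add: origin_local_ring_def local_fracs_def origin_ideal_eq poly_ring_eq)

context
  fixes n :: nat
begin

private abbreviation "A \<equiv> polys {..<n}"
private abbreviation "M \<equiv> origin_polys n"

lemma origin_units: "q \<in> A - M \<Longrightarrow> q \<noteq> 0"
  using idl_0[OF prm_idl[OF prm_origin_polys]] by blast

lemma origin_units_mult: "q \<in> A - M \<Longrightarrow> q' \<in> A - M \<Longrightarrow> q * q' \<in> A - M"
  using prm_prime[OF prm_origin_polys] subr_mult[OF subr_polys] by blast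

lemma origin_units_1: "1 \<in> A - M"
  using prm_1[OF prm_origin_polys] subr_1[OF subr_polys] by blast

lemma local_fracsI: "p \<in> P \<Longrightarrow> q \<in> A - M \<Longrightarrow> Fract p q \<in> local_fracs n P"
  unfolding local_fracs_def by blast

lemma local_fracsE:
  assumes "x \<in> local_fracs n P"
  obtains p q where "x = Fract p q" "p \<in> P" "q \<in> A" "q \<notin> M" "q \<noteq> 0"
proof -
  obtain p q where "x = Fract p q" "p \<in> P" "q \<in> A - M"
    using assms unfolding local_fracs_def by blast
  then show ?thesis using that[of p q] origin_units[of q] by blast
qed

lemma idl_local_fracs:
  assumes "idl A P"
  shows "idl (local_fracs n A) (local_fracs n P)"
  unfolding idl_def
proof (intro conjI ballI)
  show "local_fracs n P \<subseteq> local_fracs n A" using idl_sub[OF assms] by (auto simp: local_fracs_def)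
  show "0 \<in> local_fracs n P"
    using local_fracsI[OF idl_0[OF assms] origin_units_1] by (simp add: fract_collapse)
  show "x + y \<in> local_fracs n P" if xy: "x \<in> local_fracs n P" "y \<in> local_fracs n P" for x y
  proof -
    obtain p q where x: "x = Fract p q" "p \<in> P" "q \<in> A" "q \<notin> M" "q \<noteq> 0" using xy(1) by (rule local_fracsE)
    obtain p' q' where y: "y = Fract p' q'" "p' \<in> P" "q' \<in> A" "q' \<notin> M" "q' \<noteq> 0" using xy(2) by (rule local_fracsE)
    have "p * q' + p' * q \<in> P" using x y by (intro idl_add[OF assms] idl_mult2[OF assms])
    then have "Fract (p * q' + p' * q) (q * q') \<in> local_fracs n P"
      using x y origin_units_mult by (intro local_fracsI) auto
    then show ?thesis using x y by simp
  qed
  show "a * x \<in> local_fracs n P" if ax: "a \<in> local_fracs n A" "x \<in> local_fracs n P" for a x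
  proof -
    obtain p q where x: "x = Fract p q" "p \<in> P" "q \<in> A" "q \<notin> M" "q \<noteq> 0" using ax(2) by (rule local_fracsE)
    obtain p' q' where a: "a = Fract p' q'" "p' \<in> A" "q' \<in> A" "q' \<notin> M" "q' \<noteq> 0" using ax(1) by (rule local_fracsE)
    have "Fract (p' * p) (q' * q) \<in> local_fracs n P"
      using x a origin_units_mult by (intro local_fracsI idl_mult[OF assms]) auto
    then show ?thesis using x a by simp
  qed
qed

lemma subr_local_fracs: "subr (local_fracs n A)"
proof -
  have A: "idl A A" by (auto simp: idl_def intro: polys_intros)
  note i = idl_local_fracs[OF A]
  have "- x \<in> local_fracs n A" if "x \<in> local_fracs n A" for x
    using that by (auto elim!: local_fracsE intro!: local_fracsI polys_intros)
  moreover have "1 \<in> local_fracs n A"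
    using local_fracsI[OF subr_1[OF subr_polys] origin_units_1] by (simp add: fract_collapse)
  ultimately show ?thesis using idl_add[OF i] idl_mult[OF i] by (auto simp: subr_def)
qed

lemma of_mpoly_in_local_fracs: "p \<in> P \<Longrightarrow> of_mpoly p \<in> local_fracs n P"
  unfolding of_mpoly_def by (rule local_fracsI) (use origin_units_1 in auto)

text \<open>A denominator outside the ideal of the origin lies outside \<open>P\<close>, so
  primality cancels it.\<close>

lemma of_mpoly_in_local_fracs_iff:
  assumes P: "prm A P" "P \<subseteq> M" and p: "p \<in> A"
  shows "of_mpoly p \<in> local_fracs n P \<longleftrightarrow> p \<in> P"
proof
  assume "of_mpoly p \<in> local_fracs n P"
  then obtain p' q where q: "of_mpoly p = Fract p' q" "p' \<in> P" "q \<in> A" "q \<notin> M" "q \<noteq> 0" by (rule local_fracsE)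
  then have "p * q \<in> P" by (simp add: of_mpoly_def eq_fract)
  then show "p \<in> P" using prm_prime[OF P(1) p q(3)] q(4) P(2) by blast
qed (rule of_mpoly_in_local_fracs)

lemma prm_local_fracs:
  assumes P: "prm A P" "P \<subseteq> M"
  shows "prm (local_fracs n A) (local_fracs n P)"
  unfolding prm_def
proof (intro conjI ballI impI)
  show "idl (local_fracs n A) (local_fracs n P)" by (rule idl_local_fracs[OF prm_idl[OF P(1)]])
  show "1 \<notin> local_fracs n P"
    using of_mpoly_in_local_fracs_iff[OF P subr_1[OF subr_polys]] prm_1[OF P(1)] by simp
  fix a b assume "a \<in> local_fracs n A" "b \<in> local_fracs n A" and ab: "a * b \<in> local_fracs n P"
  then obtain p q p' q' where a: "a = Fract p q" "p \<in> A" "q \<in> A" "q \<notin> M" "q \<noteq> 0"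
    and b: "b = Fract p' q'" "p' \<in> A" "q' \<in> A" "q' \<notin> M" "q' \<noteq> 0"
    by (metis local_fracsE)
  obtain r s where r: "a * b = Fract r s" "r \<in> P" "s \<in> A" "s \<notin> M" "s \<noteq> 0" using ab by (rule local_fracsE)
  have "(p * p') * s = r * (q * q')" using a b r by (simp add: eq_fract)
  also have "\<dots> \<in> P" using r(2) a(3) b(3) by (intro idl_mult2[OF prm_idl[OF P(1)]] subr_mult[OF subr_polys])
  finally have "p * p' \<in> P"
    using prm_prime[OF P(1), of "p * p'" s] a(2) b(2) r(3,4) P(2) subr_mult[OF subr_polys] by blast
  then have "p \<in> P \<or> p' \<in> P" using prm_prime[OF P(1) a(2) b(2)] by blast
  then show "a \<in> local_fracs n P \<or> b \<in> local_fracs n P"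
    using a b by (auto intro: local_fracsI)
qed

definition contract :: "'k::field mpoly fract set \<Rightarrow> 'k mpoly set" where
  "contract K = {p \<in> A. of_mpoly p \<in> K}"

lemma prm_contract:
  assumes K: "prm (local_fracs n A) K"
  shows "prm A (contract K)" "contract K \<subseteq> M"
proof -
  show "prm A (contract K)"
    unfolding contract_def
    by (rule prm_vimage[OF rhom_of_mpoly subr_polys K of_mpoly_in_local_fracs])
  show "contract K \<subseteq> M"
  proof (rule ccontr)
    assume "\<not> ?thesis"
    then obtain p where p: "p \<in> A - M" "of_mpoly p \<in> K" by (auto simp: contract_def)
    have "Fract 1 p * of_mpoly p \<in> K"
      using p(1) by (intro idl_mult[OF prm_idl[OF K] _ p(2)] local_fracsI) (auto intro: polys_intros)
    also have "Fract 1 p * of_mpoly p = 1"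
      using origin_units[OF p(1)] by (simp add: of_mpoly_def One_fract_def eq_fract)
    finally show False using prm_1[OF K] by blast
  qed
qed

lemma local_fracs_contract:
  assumes K: "prm (local_fracs n A) K"
  shows "local_fracs n (contract K) = K"
proof
  show "local_fracs n (contract K) \<subseteq> K"
  proof
    fix x assume "x \<in> local_fracs n (contract K)"
    then obtain p q where x: "x = Fract p q" "p \<in> contract K" "q \<in> A" "q \<notin> M" "q \<noteq> 0" by (rule local_fracsE)
    have "of_mpoly p * Fract 1 q \<in> K"
      using x by (intro idl_mult2[OF prm_idl[OF K]] local_fracsI) (auto simp: contract_def intro: polys_intros)
    then show "x \<in> K" using x(1) by (simp add: of_mpoly_def)
  qed
  show "K \<subseteq> local_fracs n (contract K)"
  proof
    fix x assume x: "x \<in> K"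
    then obtain p q where pq: "x = Fract p q" "p \<in> A" "q \<in> A" "q \<notin> M" "q \<noteq> 0"
      using idl_sub[OF prm_idl[OF K]] by (metis local_fracsE)
    have "of_mpoly p = x * of_mpoly q" using pq by (simp add: of_mpoly_def eq_fract)
    also have "\<dots> \<in> K" using x pq(3) by (intro idl_mult2[OF prm_idl[OF K]] of_mpoly_in_local_fracs)
    finally show "x \<in> local_fracs n (contract K)" using pq by (auto simp: contract_def intro!: local_fracsI)
  qed
qed

lemma contract_local_fracs:
  assumes "prm A P" "P \<subseteq> M"
  shows "contract (local_fracs n P) = P"
proof -
  have "p \<in> contract (local_fracs n P) \<longleftrightarrow> p \<in> P" for p
    using of_mpoly_in_local_fracs_iff[OF assms, of p] idl_sub[OF prm_idl[OF assms(1)], of p]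
    by (auto simp: contract_def)
  then show ?thesis by blast
qed

text \<open>\<open>contract\<close> and \<open>local_fracs n\<close> are mutually inverse between
  the primes of the local ring and the primes inside the ideal of the origin. The form of the
  hypothesis covers both the extension of \<open>I\<close> and that of a minimal prime.\<close>

lemma chain_dim_local:
  assumes J: "\<And>K. prm (local_fracs n A) K \<Longrightarrow> J' \<subseteq> K \<longleftrightarrow> J \<subseteq> contract K"
  shows "chain_dim {K. prm (local_fracs n A) K \<and> J' \<subseteq> K} = chain_dim (primes_between n M J)"
proof (rule antisym)
  show "chain_dim {K. prm (local_fracs n A) K \<and> J' \<subseteq> K} \<le> chain_dim (primes_between n M J)"
  proof (rule chain_dim_le_image[of _ contract])
    show "contract K \<in> primes_between n M J" if "K \<in> {K. prm (local_fracs n A) K \<and> J' \<subseteq> K}" for K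
    proof -
      have K: "prm (local_fracs n A) K" "J' \<subseteq> K" using that by auto
      then show ?thesis using prm_contract[OF K(1)] J[OF K(1)] by (simp add: primes_between_def)
    qed
    fix K L assume *: "K \<in> {K. prm (local_fracs n A) K \<and> J' \<subseteq> K}" "L \<in> {K. prm (local_fracs n A) K \<and> J' \<subseteq> K}" "K \<subset> L"
    then have pKL: "prm (local_fracs n A) K" "prm (local_fracs n A) L" by auto
    have "contract K \<noteq> contract L"
    proof
      assume "contract K = contract L"
      then have "K = L" using local_fracs_contract[OF pKL(1)] local_fracs_contract[OF pKL(2)] by metis
      then show False using *(3) by blast
    qed
    then show "contract K \<subset> contract L" using *(3) by (auto simp: contract_def)
  qed
  show "chain_dim (primes_between n M J) \<le> chain_dim {K. prm (local_fracs n A) K \<and> J' \<subseteq> K}"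
  proof (rule chain_dim_le_image[of _ "local_fracs n"])
    show "local_fracs n P \<in> {K. prm (local_fracs n A) K \<and> J' \<subseteq> K}" if "P \<in> primes_between n M J" for P
    proof -
      have P: "prm A P" "P \<subseteq> M" "J \<subseteq> P" using that by (auto simp: primes_between_def)
      then show ?thesis
        using prm_local_fracs[OF P(1,2)] J[OF prm_local_fracs[OF P(1,2)]] contract_local_fracs[OF P(1,2)] by simp
    qed
    fix P Q assume *: "P \<in> primes_between n M J" "Q \<in> primes_between n M J" "P \<subset> Q"
    then have P: "prm A P" "P \<subseteq> M" and Q: "prm A Q" "Q \<subseteq> M" by (auto simp: primes_between_def)
    have "local_fracs n P \<noteq> local_fracs n Q"
    proof
      assume "local_fracs n P = local_fracs n Q"
      then have "P = Q" using contract_local_fracs[OF P] contract_local_fracs[OF Q] by metis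
      then show False using *(3) by blast
    qed
    then show "local_fracs n P \<subset> local_fracs n Q" using *(3) by (auto simp: local_fracs_def)
  qed
qed

text \<open>A minimal prime of \<open>I\<close> inside the ideal of the origin extends to a minimal
  prime of the extended ideal, and the chains of primes above both have the same lengths.\<close>

theorem equidimensional_at_origin_imp:
  assumes I: "idl A I" and eq: "equidimensional_at_origin n I"
  shows "equidim n M I"
proof -
  let ?S = "local_fracs n A" and ?E = "origin_extension n I"
  have IS: "of_mpoly ` I \<subseteq> ?S" using idl_sub[OF I] of_mpoly_in_local_fracs by blast
  have E: "?E = genideal (ring_on ?S) (of_mpoly ` I)"
    by (simp add: origin_extension_def origin_local_ring_eq of_mpoly_def[abs_def])
  note gen = genideal_ring_on[OF subr_local_fracs IS, folded E]
  have sub: "?E \<subseteq> K \<longleftrightarrow> I \<subseteq> contract K" if "prm ?S K" for K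
    using gen(3)[OF prm_idl[OF that]] idl_sub[OF I] by (auto simp: contract_def)
  have eq': "chain_dim {P. prm ?S P \<and> K \<subseteq> P} = chain_dim {P. prm ?S P \<and> ?E \<subseteq> P}" if "min_prm ?S ?E K" for K
    using eq that unfolding equidimensional_at_origin_def origin_local_ring_eq
      equidimensional_quot_ring_on[OF subr_local_fracs gen(1)] by blast
  show ?thesis
    unfolding equidim_def
  proof (intro allI impI)
    fix Q assume Q: "min_prm A I Q" "Q \<subseteq> M"
    then have pQ: "prm A Q" "I \<subseteq> Q" by (auto simp: min_prm_def)
    let ?K = "local_fracs n Q"
    have pK: "prm ?S ?K" by (rule prm_local_fracs[OF pQ(1) Q(2)])
    have "min_prm ?S ?E ?K"
      unfolding min_prm_def
    proof (intro conjI allI impI)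
      show "?E \<subseteq> ?K" using sub[OF pK] contract_local_fracs[OF pQ(1) Q(2)] pQ(2) by simp
      fix L assume L: "prm ?S L" "?E \<subseteq> L" "L \<subseteq> ?K"
      have "contract L \<subseteq> Q" using L(3) contract_local_fracs[OF pQ(1) Q(2)] by (auto simp: contract_def)
      then have "contract L = Q" using Q(1) prm_contract[OF L(1)] sub[OF L(1)] L(2) by (auto simp: min_prm_def)
      then show "L = ?K" using local_fracs_contract[OF L(1)] by simp
    qed (rule pK)
    from eq'[OF this] have "chain_dim {P. prm ?S P \<and> ?K \<subseteq> P} = chain_dim {P. prm ?S P \<and> ?E \<subseteq> P}" .
    moreover have "?K \<subseteq> L \<longleftrightarrow> Q \<subseteq> contract L" if "prm ?S L" for L
    proof
      assume "?K \<subseteq> L"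
      then show "Q \<subseteq> contract L" using contract_local_fracs[OF pQ(1) Q(2)] by (auto simp: contract_def)
    next
      assume "Q \<subseteq> contract L"
      then have "?K \<subseteq> local_fracs n (contract L)" by (auto simp: local_fracs_def)
      then show "?K \<subseteq> L" using local_fracs_contract[OF that] by simp
    qed
    ultimately show "chain_dim (primes_between n M Q) = chain_dim (primes_between n M I)"
      using chain_dim_local[of ?E I] chain_dim_local[of ?K Q] sub by simp
  qed
qed

end


section \<open>Leading forms of highest and lowest degree\<close>

text \<open>The sign \<open>e\<close> selects highest or lowest degree. Summing only over
  \<open>i < n\<close> gives the deformation variable of index \<open>n\<close> weight zero, as
  \<open>deformation\<close> demands.\<close>

definition deg_wt :: "nat \<Rightarrow> int \<Rightarrow> (nat \<Rightarrow>\<^sub>0 nat) \<Rightarrow> int" where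
  "deg_wt n e m = e * int (\<Sum>i<n. Poly_Mapping.lookup m i)"

lemma additive_deg_wt: "additive_wt (deg_wt n e)"
  by (simp add: additive_wt_def deg_wt_def lookup_add sum.distrib distrib_left)

lemma deg_wt_single: "deg_wt n e (Poly_Mapping.single n 1) = 0"
  by (simp add: deg_wt_def lookup_single when_def)

lemma deg_wt_eq:
  assumes "f \<in> polys {..<n}" "m \<in> Poly_Mapping.keys f"
  shows "deg_wt n e m = e * int (mon_degree m)"
proof -
  have "mon_degree m = (\<Sum>i<n. Poly_Mapping.lookup m i)"
    unfolding mon_degree_def using assms
    by (intro sum.mono_neutral_left) (auto simp: polys_def in_keys_iff)
  then show ?thesis by (simp add: deg_wt_def)
qed

lemma hom_component_eq: "hom_component d f = wt_comp mon_degree d f"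
  by (simp add: hom_component_def wt_comp_def)

lemma max_form_eq:
  assumes "f \<in> polys {..<n}" "f \<noteq> 0"
  shows "max_form f = lead_form (deg_wt n 1) f"
proof -
  let ?K = "Poly_Mapping.keys f"
  have "deg_wt n 1 ` ?K = int ` (mon_degree ` ?K)"
    using deg_wt_eq[OF assms(1), of _ 1] by (force simp: image_image intro: image_cong)
  then have "top_wt (deg_wt n 1) f = int (Max (mon_degree ` ?K))"
    unfolding top_wt_def using assms(2) by (simp add: mono_Max_commute[of int] monoI)
  note top = this
  show ?thesis
    unfolding max_form_def hom_component_eq lead_form_def
  proof (rule poly_mapping_eqI, goal_cases)
    case (1 m)
    show ?case
      using top deg_wt_eq[OF assms(1), of m 1]
      by (cases "m \<in> Poly_Mapping.keys f") (auto simp: lookup_wt_comp in_keys_iff)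
  qed
qed

lemma min_form_eq:
  assumes "f \<in> polys {..<n}" "f \<noteq> 0"
  shows "min_form f = lead_form (deg_wt n (- 1)) f"
proof -
  let ?K = "Poly_Mapping.keys f"
  have "Min (mon_degree ` ?K) \<in> mon_degree ` ?K" using assms(2) by (intro Min_in) auto
  then obtain m where m: "m \<in> ?K" "mon_degree m = Min (mon_degree ` ?K)" by auto
  have "top_wt (deg_wt n (- 1)) f = - int (Min (mon_degree ` ?K))"
    unfolding top_wt_def
  proof (rule Max_eqI)
    show "- int (Min (mon_degree ` ?K)) \<in> deg_wt n (- 1) ` ?K"
      using m deg_wt_eq[OF assms(1) m(1), of "- 1"] by (intro image_eqI[of _ _ m]) auto
    show "y \<le> - int (Min (mon_degree ` ?K))" if "y \<in> deg_wt n (- 1) ` ?K" for y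
      using that deg_wt_eq[OF assms(1), of _ "- 1"] by auto
  qed simp
  note top = this
  show ?thesis
    unfolding min_form_def hom_component_eq lead_form_def
  proof (rule poly_mapping_eqI, goal_cases)
    case (1 m)
    show ?case
      using top deg_wt_eq[OF assms(1), of m "- 1"]
      by (cases "m \<in> Poly_Mapping.keys f") (auto simp: lookup_wt_comp in_keys_iff)
  qed
qed

lemma lead_form_image_subset: "I \<subseteq> polys U \<Longrightarrow> lead_form \<omega> ` (I - {0}) \<subseteq> polys U"
  unfolding lead_form_def by (auto intro!: wt_comp_in_polys)

text \<open>The transcendence degrees of minimal primes over the leading forms occur among those of
  minimal primes of \<open>I\<close>. The hypothesis \<open>sub\<close> places the latter inside
  \<open>M\<close>, where \<open>eq\<close> compares them.\<close>

lemma equidim_lead_forms: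
  assumes I: "idl (polys {..<n}) I" and M: "extendable n M" and eq: "equidim n M I"
    and sub: "\<And>P Q. min_prm (polys {..<n}) I P \<Longrightarrow> prm (polys {..<n}) Q \<Longrightarrow>
      \<forall>f\<in>P. f \<noteq> 0 \<longrightarrow> lead_form (deg_wt n e) f \<in> Q \<Longrightarrow> P \<subseteq> M"
  shows "equidim n (polys {..<n}) (lead_form (deg_wt n e) ` (I - {0}))"
  unfolding equidim_iff[OF extendable_polys]
proof (intro allI impI)
  let ?L = "lead_form (deg_wt n e) ` (I - {0})"
  fix Q Q' assume Q: "min_prm (polys {..<n}) ?L Q" and Q': "min_prm (polys {..<n}) ?L Q'"
  obtain P where P: "min_prm (polys {..<n}) I P" "tr_deg n P = tr_deg n Q"
      "\<forall>f\<in>P. f \<noteq> 0 \<longrightarrow> lead_form (deg_wt n e) f \<in> Q"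
    by (rule lead_form_prime_component[OF additive_deg_wt deg_wt_single I Q])
  obtain P' where P': "min_prm (polys {..<n}) I P'" "tr_deg n P' = tr_deg n Q'"
      "\<forall>f\<in>P'. f \<noteq> 0 \<longrightarrow> lead_form (deg_wt n e) f \<in> Q'"
    by (rule lead_form_prime_component[OF additive_deg_wt deg_wt_single I Q'])
  have "P \<subseteq> M" "P' \<subseteq> M"
    using sub[OF P(1) _ P(3)] sub[OF P'(1) _ P'(3)] Q Q' by (auto simp: min_prm_def)
  then show "tr_deg n Q = tr_deg n Q'"
    using eq P P' unfolding equidim_iff[OF M] by metis
qed

text \<open>The monomial one is the only monomial in these variables of degree zero, the lowest
  possible.\<close>

lemma lead_form_const:
  assumes f: "f \<in> polys {..<n}" and c: "Poly_Mapping.lookup f 0 \<noteq> 0"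
  shows "lead_form (deg_wt n (- 1)) f = pconst (Poly_Mapping.lookup f 0)"
proof -
  have "top_wt (deg_wt n (- 1)) f = 0"
    unfolding top_wt_def
    using c by (intro Max_eqI) (auto simp: deg_wt_def in_keys_iff intro!: image_eqI[of _ _ 0] sum_nonneg)
  moreover have "m = 0" if "m \<in> Poly_Mapping.keys f" "deg_wt n (- 1) m = 0" for m
  proof (rule poly_mapping_eqI)
    fix i
    have "Poly_Mapping.lookup m i = 0" if "i < n" for i
    proof -
      have "(\<Sum>i<n. Poly_Mapping.lookup m i) = 0"
        using \<open>deg_wt n (- 1) m = 0\<close> by (simp add: deg_wt_def del: of_nat_sum)
      then show ?thesis using that by simp
    qed
    moreover have "Poly_Mapping.lookup m i = 0" if "\<not> i < n" for i
      using f \<open>m \<in> Poly_Mapping.keys f\<close> that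
      by (force simp: polys_def simp flip: not_in_keys_iff_lookup_eq_zero)
    ultimately show "Poly_Mapping.lookup m i = Poly_Mapping.lookup 0 i" by (cases "i < n") auto
  qed
  moreover have "deg_wt n (- 1) 0 = 0" by (simp add: deg_wt_def)
  ultimately show ?thesis
    unfolding lead_form_def
    by (intro poly_mapping_eqI) (auto simp: lookup_wt_comp lookup_single when_def in_keys_iff)
qed

theorem corollary3p13:
  fixes n :: nat and I :: "'k::field mpoly set"
  assumes "ideal I (poly_ring n)"
  shows "(equidimensional_variety n I \<longrightarrow> equidimensional_part_at_infinity n I) \<and>
         (equidimensional_at_origin n I \<longrightarrow> equidimensional_tangent_cone n I)"
proof -
  let ?A = "polys {..<n} :: 'k mpoly set"
  have I: "idl ?A I" using assms ideal_ring_on_iff[OF subr_polys] unfolding poly_ring_eq by blast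
  have IA: "I \<subseteq> ?A" using idl_sub[OF I] by blast
  have maxs: "{max_form f | f. f \<in> I \<and> f \<noteq> 0} = lead_form (deg_wt n 1) ` (I - {0})"
    using max_form_eq IA by (force simp: image_def)
  have mins: "{min_form f | f. f \<in> I \<and> f \<noteq> 0} = lead_form (deg_wt n (- 1)) ` (I - {0})"
    using min_form_eq IA by (force simp: image_def)
  have quot: "equidimensional_quot (poly_ring n) (genideal (poly_ring n) (lead_form \<omega> ` (I - {0}))) \<longleftrightarrow>
      equidim n ?A (lead_form \<omega> ` (I - {0}))" for \<omega>
  proof -
    note sub = lead_form_image_subset[OF IA, of \<omega>]
    have "idl ?A (genideal (poly_ring n) (lead_form \<omega> ` (I - {0})))"
      unfolding poly_ring_eq by (rule genideal_ring_on(1)[OF subr_polys sub])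
    then show ?thesis by (simp only: equidimensional_quot_poly_ring equidim_genideal[OF sub])
  qed
  show ?thesis
  proof (intro conjI impI)
    assume "equidimensional_variety n I"
    then have "equidim n ?A I"
      unfolding equidimensional_variety_def by (simp only: equidimensional_quot_poly_ring[OF I])
    then have "equidim n ?A (lead_form (deg_wt n 1) ` (I - {0}))"
      by (rule equidim_lead_forms[OF I extendable_polys]) (auto simp: min_prm_def dest: prm_idl idl_sub)
    then show "equidimensional_part_at_infinity n I"
      unfolding equidimensional_part_at_infinity_def max_ideal_def maxs quot .
  next
    assume "equidimensional_at_origin n I"
    then have "equidim n (origin_polys n) I" by (rule equidimensional_at_origin_imp[OF I])
    then have "equidim n ?A (lead_form (deg_wt n (- 1)) ` (I - {0}))"
    proof (rule equidim_lead_forms[OF I extendable_origin_polys])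
      fix P Q :: "'k mpoly set"
      assume P: "min_prm ?A I P" and Q: "prm ?A Q"
        and lead: "\<forall>f\<in>P. f \<noteq> 0 \<longrightarrow> lead_form (deg_wt n (- 1)) f \<in> Q"
      show "P \<subseteq> origin_polys n"
      proof
        fix f assume f: "f \<in> P"
        then have fA: "f \<in> ?A" using P prm_idl idl_sub unfolding min_prm_def by blast
        have "Poly_Mapping.lookup f 0 = 0"
        proof (rule ccontr)
          assume c: "Poly_Mapping.lookup f 0 \<noteq> 0"
          then have "f \<noteq> 0" by auto
          then have "pconst (Poly_Mapping.lookup f 0) \<in> Q" using lead f lead_form_const[OF fA c] by metis
          then show False using prm_pconst[OF Q] c by blast
        qed
        then show "f \<in> origin_polys n" using fA by (simp add: origin_polys_def)
      qed
    qed
    then show "equidimensional_tangent_cone n I"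
      unfolding equidimensional_tangent_cone_def min_ideal_def mins quot .
  qed
qed

end
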